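(* Let $C\equiv f(x,y)=0$ be a plane branch with semigroup of values $\langle 4,s_1\rangle$ belonging to one of the normal form families NF 4.$i$, $1\le i\le 4$, and let $\lambda_i$ be its Zariski invariant. Let $D(u,v)=0$ be the discriminant curve of the morphism $(x,f)$. Then $D(u,v)=0$ is degenerate (in the sense of Kouchnirenko, with respect to $(u,v)$) and its topological type is determined by the semigroup $S(f)=\langle 4,s_1\rangle$ and the Zariski invariant $\lambda_i$ of $C$. Moreover: (1) If $\lambda_i=0$, then the discriminant curve is the triple smooth branch $(v+u^{s_1})^3=0$. (2) If $\lambda_i\ne0$, then $\lambda_i=2s_1-4j$ for some $2\le j\le\left[\frac{s_1}{4}\right]$ and: (a) when $\gcd(3,2s_1+\lambda_i)=1$, the discriminant curve $D(u,v)=0$ is a branch with semigroup of values $\langle 3,2s_1+\lambda_i\rangle$; (b) when $\gcd(3,2s_1+\lambda_i)=3$, the discriminant curve is the union of three smooth branches $D_l(u,v)=0$, $1\le l\le3$, with intersection numbers $i_0(D_l,D_r)=\frac{2s_1+\lambda_i}{3}$ for $l\ne r$.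
   Context: A plane branch is a germ at $0\in\mathbb C^2$ of a curve $f(x,y)=0$ with $f\in\mathbb C\{x,y\}$ irreducible; its multiplicity is the order of $f$, and it is smooth if the multiplicity is 1. With $i_0(f,h)=\dim_{\mathbb C}\mathbb C\{x,y\}/(f,h)$, the semigroup of values is $S(C)=S(f)=\{i_0(f,h): h\not\equiv0\bmod f\}$; $\langle s_0,\dots,s_g\rangle$ denotes the semigroup with minimal generators $s_0<\dots<s_g$. Two branches have the same topological type iff they have the same semigroup. $[z]$ is the integral part of $z$. Zariski invariant: for a Puiseux parametrization $(x(t),y(t))$ of $C$ and $\omega=g\,dx+h\,dy$ with $g,h\in\mathbb C\{x,y\}$, put $\nu(\omega)=\mathrm{ord}_t\big(g(x(t),y(t))x'(t)+h(x(t),y(t))y'(t)\big)+1$ and $\Lambda=\{\nu(\omega)\}$ (over $\omega$ not vanishing on $C$). If $\Lambda\setminus S(C)\ne\emptyset$, the Zariski invariant is $\min(\Lambda\setminus S(C))-n$, with $n$ the multiplicity; otherwise it is $0$. Normal form families NF 4.$i$ for $1\le i\le4$ ($s_1>4$ odd): branches $x=t^4,\ y=\sigma_i(t)$ with Zariski invariant $\lambda_i$, given by the equation $f_i(x,y)=\prod_{\omega^4=1}\big(y-\sigma_i(\omega x^{1/4})\big)$, where - $\lambda_1=0$ and $\sigma_1(t)=t^{s_1}$; - for $i=2,3,4$: $\lambda_i=2s_1-4j$ with $2\le j\le[\frac{s_1}{4}]$, and $$\sigma_i(t)=t^{s_1}+t^{\lambda_i}+\sum_{l} a_l\,t^{3s_1-4([\frac{s_1}{4}]+j+1-l)},\quad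 a_l\in\mathbb C,$$ with the following ranges of $l$ and conditions: $i=2$: $k\le l\le k+j-2$ for some $1\le k\le[\frac{s_1}{4}]-j$, and $a_k\ne0$; $i=3$: $[\frac{s_1}{4}]-j+1\le l\le[\frac{s_1}{4}]$, and $a_{[s_1/4]-j+1}=\frac{3s_1-4j}{2s_1}$; $i=4$: $[\frac{s_1}{4}]-j+1\le l\le[\frac{s_1}{4}]-1$, and $a_{[s_1/4]-j+1}\ne\frac{3s_1-4j}{2s_1}$. Discriminant: if $n$ is the order of $f$ and $\frac{\partial f}{\partial y}=(\text{unit})\cdot\prod_{j=1}^{n-1}(y-\gamma_j(x))$ is the Newton–Puiseux factorization, the discriminant curve of $(x,f):(x,y)\mapsto(u,v)=(x,f(x,y))$ is $D(u,v)=\prod_{j=1}^{n-1}(v-f(u,\gamma_j(u)))=0$ (counted with multiplicities). Non-degeneracy: the Newton polygon $\mathcal N(h)$ of $h=\sum a_{ij}u^iv^j$ is the convex hull of $\mathrm{supp}(h)+\mathbb R_{\ge0}^2$. $h$ is non degenerate if for every compact edge $L$ of $\mathcal N(h)$, with $h_L=\sum_{(i,j)\in L\cap\mathrm{supp}(h)}a_{ij}u^iv^j$ and $j_0=\min\{j:(i,j)\in L\}$, the polynomial $h_L(1,z)/z^{j_0}$ has no multiple roots; otherwise $h$ is degenerate. *)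

theory Defs
  imports
    "HOL-Analysis.Analysis"
    "HOL-Computational_Algebra.Computational_Algebra"
begin

section \<open>Convergent power series in two variables\<close>

text \<open>
  A power series \<open>\<Sum>a\<^sub>i\<^sub>j x\<^sup>i y\<^sup>j\<close> is represented as an element of \<open>\<complex>[[x]][[y]]\<close>: the outer
  variable is \<open>y\<close> (or \<open>v\<close>), the inner one is \<open>x\<close> (or \<open>u\<close>, or a root \<open>t\<close> of these).
\<close>

definition convergent2 :: "complex fps fps \<Rightarrow> bool" where
  "convergent2 F \<longleftrightarrow>
     (\<exists>r::real. r > 0 \<and> (\<lambda>(i, j). norm (fps_nth (fps_nth F j) i) * r ^ (i + j)) summable_on UNIV)"

lemma convergent2D:
  assumes "convergent2 F"
  shows "\<exists>M R::real. M \<ge> 0 \<and> R > 0 \<and> (\<forall>i j. norm (fps_nth (fps_nth F j) i) \<le> M * R ^ (i + j))"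
proof -
  obtain r :: real where r: "r > 0"
    and s: "(\<lambda>(i, j). norm (fps_nth (fps_nth F j) i) * r ^ (i + j)) summable_on UNIV"
    using assms by (auto simp: convergent2_def)
  define g where "g = (\<lambda>(i, j). norm (fps_nth (fps_nth F j) i) * r ^ (i + j))"
  have g0: "g p \<ge> 0" for p
    using r by (auto simp: g_def split: prod.splits)
  have gs: "g summable_on UNIV"
    using s by (simp add: g_def)
  have gle: "g p \<le> infsum g UNIV" for p
  proof -
    have "infsum g {p} \<le> infsum g UNIV"
      by (rule infsum_mono2) (use gs g0 in auto)
    then show ?thesis by simp
  qed
  have "norm (fps_nth (fps_nth F j) i) \<le> infsum g UNIV * (1 / r) ^ (i + j)" for i j
    using gle[of "(i, j)"] r by (simp add: g_def power_divide field_simps)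
  moreover have "infsum g UNIV \<ge> 0"
    using g0 by (simp add: infsum_nonneg)
  ultimately show ?thesis
    using r by (intro exI[of _ "infsum g UNIV"] exI[of _ "1 / r"]) auto
qed

lemma convergent2I:
  fixes M R :: real
  assumes R: "R > 0" and b: "\<And>i j. norm (fps_nth (fps_nth F j) i) \<le> M * R ^ (i + j)"
  shows "convergent2 F"
proof -
  define r where "r = 1 / (2 * R)"
  have r: "r > 0" "R * r = 1 / 2"
    using R by (auto simp: r_def)
  define g where "g = (\<lambda>(i, j). norm (fps_nth (fps_nth F j) i) * r ^ (i + j))"
  have M: "M \<ge> 0"
    using b[of 0 0] by (simp add: order_trans[OF norm_ge_zero])
  have g0: "g p \<ge> 0" for p
    using r by (auto simp: g_def split: prod.splits)
  have half: "sum (\<lambda>i. (1 / 2 :: real) ^ i) A \<le> 2" if "finite A" for A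
  proof -
    have "sum (\<lambda>i. (1 / 2 :: real) ^ i) A \<le> (\<Sum>i. (1 / 2) ^ i)"
      by (rule sum_le_suminf) (use that in \<open>auto simp: summable_geometric\<close>)
    also have "\<dots> = 2"
      by (simp add: suminf_geometric)
    finally show ?thesis .
  qed
  have gle: "g (i, j) \<le> M * ((1 / 2) ^ i * (1 / 2) ^ j)" for i j
  proof -
    have "g (i, j) \<le> M * R ^ (i + j) * r ^ (i + j)"
      using mult_right_mono[OF b, of "r ^ (i + j)" j i] r by (simp add: g_def)
    also have "\<dots> = M * (R * r) ^ (i + j)"
      by (simp add: power_mult_distrib)
    also have "\<dots> = M * ((1 / 2) ^ i * (1 / 2) ^ j)"
      by (simp only: r power_add)
    finally show ?thesis .
  qed
  have bound: "sum g X \<le> M * 4" if X: "finite X" for X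
  proof -
    have "sum g X \<le> sum g (fst ` X \<times> snd ` X)"
      by (rule sum_mono2) (use X g0 in \<open>auto simp: subset_fst_snd\<close>)
    also have "\<dots> \<le> (\<Sum>(i, j)\<in>fst ` X \<times> snd ` X. M * ((1 / 2) ^ i * (1 / 2) ^ j))"
      by (rule sum_mono) (use gle in auto)
    also have "\<dots> = M * (sum (\<lambda>i. (1 / 2) ^ i) (fst ` X) * sum (\<lambda>i. (1 / 2) ^ i) (snd ` X))"
      by (simp only: sum_product flip: sum.cartesian_product) (simp only: sum_distrib_left)
    also have "\<dots> \<le> M * (2 * 2)"
      by (intro mult_left_mono mult_mono half) (use X M in \<open>auto intro: sum_nonneg\<close>)
    finally show ?thesis by simp
  qed
  have "g summable_on UNIV"
    by (rule nonneg_bounded_partial_sums_imp_summable_on[where C = "M * 4"])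
      (use g0 bound in \<open>auto simp: eventually_finite_subsets_at_top\<close>)
  then show ?thesis
    using r unfolding convergent2_def g_def by blast
qed

lemma convergent2_common_bound:
  assumes "convergent2 F" "convergent2 G"
  obtains M R :: real where "M \<ge> 0" "R > 0"
    "\<And>i j. norm (fps_nth (fps_nth F j) i) \<le> M * R ^ (i + j)"
    "\<And>i j. norm (fps_nth (fps_nth G j) i) \<le> M * R ^ (i + j)"
proof -
  obtain M1 R1 :: real where 1: "M1 \<ge> 0" "R1 > 0"
    "\<And>i j. norm (fps_nth (fps_nth F j) i) \<le> M1 * R1 ^ (i + j)"
    using convergent2D[OF assms(1)] by blast
  obtain M2 R2 :: real where 2: "M2 \<ge> 0" "R2 > 0"
    "\<And>i j. norm (fps_nth (fps_nth G j) i) \<le> M2 * R2 ^ (i + j)"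
    using convergent2D[OF assms(2)] by blast
  show thesis
  proof (rule that[of "max M1 M2" "max R1 R2"])
    show "norm (fps_nth (fps_nth F j) i) \<le> max M1 M2 * max R1 R2 ^ (i + j)" for i j
      by (rule order_trans[OF 1(3)]) (use 1 2 in \<open>auto intro!: mult_mono power_mono\<close>)
    show "norm (fps_nth (fps_nth G j) i) \<le> max M1 M2 * max R1 R2 ^ (i + j)" for i j
      by (rule order_trans[OF 2(3)]) (use 1 2 in \<open>auto intro!: mult_mono power_mono\<close>)
  qed (use 1 2 in auto)
qed

lemma convergent2_0: "convergent2 0"
  by (rule convergent2I[of 1 _ 0]) auto

lemma convergent2_polynomial:
  assumes "\<And>i j. i + j > N \<Longrightarrow> fps_nth (fps_nth F j) i = 0"
  shows "convergent2 F"
proof -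
  define S where "S = (\<lambda>(i, j). norm (fps_nth (fps_nth F j) i)) ` ({..N} \<times> {..N})"
  have fin: "finite S" by (simp add: S_def)
  have "norm (fps_nth (fps_nth F j) i) \<le> Max (insert 0 S) * 1 ^ (i + j)" for i j
  proof (cases "i + j > N")
    case True
    then show ?thesis using assms fin by simp
  next
    case False
    then have "norm (fps_nth (fps_nth F j) i) \<in> S"
      by (auto simp: S_def intro!: rev_image_eqI[of "(i, j)"])
    then show ?thesis using fin by simp
  qed
  then show ?thesis by (intro convergent2I[of 1]) auto
qed

lemma convergent2_uminus: "convergent2 F \<Longrightarrow> convergent2 (- F)"
  by (simp add: convergent2_def)

lemma convergent2_add:
  assumes "convergent2 F" "convergent2 G"
  shows "convergent2 (F + G)"
proof -
  obtain M R :: real where *: "M \<ge> 0" "R > 0"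
    "\<And>i j. norm (fps_nth (fps_nth F j) i) \<le> M * R ^ (i + j)"
    "\<And>i j. norm (fps_nth (fps_nth G j) i) \<le> M * R ^ (i + j)"
    using convergent2_common_bound[OF assms] by blast
  show ?thesis
  proof (rule convergent2I[of R _ "M + M"])
    show "norm (fps_nth (fps_nth (F + G) j) i) \<le> (M + M) * R ^ (i + j)" for i j
      using norm_triangle_mono[OF *(3) *(4), of j i j i] by (simp add: distrib_right)
  qed (use * in auto)
qed

lemma convergent2_mult:
  assumes "convergent2 F" "convergent2 G"
  shows "convergent2 (F * G)"
proof -
  obtain M R :: real where *: "M \<ge> 0" "R > 0"
    "\<And>i j. norm (fps_nth (fps_nth F j) i) \<le> M * R ^ (i + j)"
    "\<And>i j. norm (fps_nth (fps_nth G j) i) \<le> M * R ^ (i + j)"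
    using convergent2_common_bound[OF assms] by blast
  show ?thesis
  proof (rule convergent2I[of "2 * R" _ "M * M"])
    fix i j
    have "norm (fps_nth (fps_nth (F * G) j) i) =
        norm (\<Sum>l=0..j. \<Sum>k=0..i. fps_nth (fps_nth F l) k * fps_nth (fps_nth G (j - l)) (i - k))"
      by (simp add: fps_mult_nth fps_sum_nth)
    also have "\<dots> \<le> (\<Sum>l=0..j. \<Sum>k=0..i. M * M * R ^ (i + j))"
    proof (intro order_trans[OF norm_sum] sum_mono)
      fix l k assume lk: "l \<in> {0..j}" "k \<in> {0..i}"
      have "norm (fps_nth (fps_nth F l) k * fps_nth (fps_nth G (j - l)) (i - k)) \<le>
          (M * R ^ (k + l)) * (M * R ^ ((i - k) + (j - l)))"
        unfolding norm_mult by (intro mult_mono *) (use * in auto)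
      also have "\<dots> = M * M * R ^ ((k + l) + ((i - k) + (j - l)))"
        by (simp only: power_add mult_ac)
      also have "(k + l) + ((i - k) + (j - l)) = i + j"
        using lk by auto
      finally show "norm (fps_nth (fps_nth F l) k * fps_nth (fps_nth G (j - l)) (i - k)) \<le>
          M * M * R ^ (i + j)" .
    qed
    also have "\<dots> = real ((j + 1) * (i + 1)) * (M * M * R ^ (i + j))"
      by (simp add: algebra_simps)
    also have "\<dots> \<le> 2 ^ (i + j) * (M * M * R ^ (i + j))"
    proof (intro mult_right_mono)
      have "(j + 1) * (i + 1) \<le> 2 ^ j * 2 ^ i"
        by (intro mult_mono) (auto simp: Suc_le_eq less_exp)
      then show "real ((j + 1) * (i + 1)) \<le> 2 ^ (i + j)"
        by (metis of_nat_le_iff of_nat_numeral of_nat_power power_add mult.commute)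
    qed (use * in auto)
    also have "\<dots> = M * M * (2 * R) ^ (i + j)"
      by (simp add: power_mult_distrib mult_ac)
    finally show "norm (fps_nth (fps_nth (F * G) j) i) \<le> M * M * (2 * R) ^ (i + j)" .
  qed (use * in auto)
qed

typedef cps2 = "{F. convergent2 F}"
  morphisms series Abs_cps2
  using convergent2_0 by auto

setup_lifting type_definition_cps2

instantiation cps2 :: idom
begin

lift_definition zero_cps2 :: cps2 is 0
  by (rule convergent2_0)

lift_definition one_cps2 :: cps2 is 1
  by (rule convergent2_polynomial[of 0]) auto

lift_definition plus_cps2 :: "cps2 \<Rightarrow> cps2 \<Rightarrow> cps2" is "(+)"
  by (rule convergent2_add)

lift_definition uminus_cps2 :: "cps2 \<Rightarrow> cps2" is uminus
  by (rule convergent2_uminus)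

lift_definition minus_cps2 :: "cps2 \<Rightarrow> cps2 \<Rightarrow> cps2" is "(-)"
  using convergent2_add convergent2_uminus by (metis add_uminus_conv_diff)

lift_definition times_cps2 :: "cps2 \<Rightarrow> cps2 \<Rightarrow> cps2" is "(*)"
  by (rule convergent2_mult)

instance
  by standard (transfer; simp add: algebra_simps)+

end

lift_definition X_cps2 :: cps2 is "fps_const fps_X"
  by (rule convergent2_polynomial[of 1]) (auto simp: fps_X_def)

lift_definition Y_cps2 :: cps2 is fps_X
  by (rule convergent2_polynomial[of 1]) (auto simp: fps_X_def)

lift_definition const_cps2 :: "complex \<Rightarrow> cps2" is "\<lambda>c. fps_const (fps_const c)"
  by (rule convergent2_polynomial[of 0]) auto

definition coeff2 :: "cps2 \<Rightarrow> nat \<Rightarrow> nat \<Rightarrow> complex" where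
  "coeff2 f i j = fps_nth (fps_nth (series f) j) i"

definition order2 :: "cps2 \<Rightarrow> nat" where
  "order2 f = (LEAST n. \<exists>i j. i + j = n \<and> coeff2 f i j \<noteq> 0)"

text \<open>\<open>G(a(t), b(t))\<close>. Only meaningful if \<open>a\<close> and \<open>b\<close> have no constant term; for such \<open>b\<close> the
  terms with \<open>j > n\<close> do not contribute to the coefficient of \<open>t\<^sup>n\<close>.\<close>

definition subst2 :: "complex fps fps \<Rightarrow> complex fps \<Rightarrow> complex fps \<Rightarrow> complex fps" where
  "subst2 G a b = Abs_fps (\<lambda>n. \<Sum>j\<le>n. fps_nth (fps_compose (fps_nth G j) a * b ^ j) n)"

text \<open>\<open>G(t\<^sup>n, y)\<close>. This is how fractional powers of \<open>x\<close> are handled: an identity between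
  series in \<open>x\<^bsup>1/n\<^esup>\<close> and \<open>y\<close> is stated after substituting \<open>x = t\<^sup>n\<close>.\<close>

definition ramify :: "nat \<Rightarrow> complex fps fps \<Rightarrow> complex fps fps" where
  "ramify n G = Abs_fps (\<lambda>j. fps_compose (fps_nth G j) (fps_X ^ n))"


section \<open>Plane branches and their semigroups\<close>

definition plane_branch :: "cps2 \<Rightarrow> bool" where
  "plane_branch f \<longleftrightarrow> irreducible f"

definition smooth_branch :: "cps2 \<Rightarrow> bool" where
  "smooth_branch f \<longleftrightarrow> plane_branch f \<and> order2 f = 1"

text \<open>\<open>B\<close> maps injectively to a \<open>\<complex>\<close>-vector space basis of \<open>\<complex>{x,y} / I\<close>.\<close>

definition quotient_basis :: "cps2 set \<Rightarrow> cps2 set \<Rightarrow> bool" where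
  "quotient_basis I B \<longleftrightarrow> finite B \<and>
     (\<forall>g. \<exists>!c. c \<in> B \<rightarrow>\<^sub>E UNIV \<and> g - (\<Sum>b\<in>B. const_cps2 (c b) * b) \<in> I)"

definition quotient_dim :: "cps2 set \<Rightarrow> enat" where
  "quotient_dim I = (INF B \<in> {B. quotient_basis I B}. enat (card B))"

definition intersection_number :: "cps2 \<Rightarrow> cps2 \<Rightarrow> enat" where
  "intersection_number f h = quotient_dim {a * f + b * h | a b. True}"

definition value_semigroup :: "cps2 \<Rightarrow> nat set" where
  "value_semigroup f = {n. \<exists>h. \<not> f dvd h \<and> intersection_number f h = enat n}"

inductive_set additive_span :: "nat set \<Rightarrow> nat set" for A :: "nat set" where
  zero: "0 \<in> additive_span A"
| add: "a \<in> A \<Longrightarrow> n \<in> additive_span A \<Longrightarrow> a + n \<in> additive_span A"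

text \<open>\<open>S = \<langle>s\<^sub>0, \<dots>, s\<^sub>g\<rangle>\<close>, where the notation includes that the generators are increasing and
  minimal.\<close>

definition minimally_generated :: "nat set \<Rightarrow> nat list \<Rightarrow> bool" where
  "minimally_generated S ss \<longleftrightarrow>
     S = additive_span (set ss) \<and> sorted_wrt (<) ss \<and>
     (\<forall>s\<in>set ss. s \<notin> additive_span (set ss - {s}))"

text \<open>Curves are given with their decomposition into branches, repeated according to
  multiplicity; a repeated branch has intersection number \<open>\<infinity>\<close> with itself. Two curves have the
  same topological type iff their branches correspond bijectively with equal semigroups and
  equal pairwise intersection numbers.\<close>

definition same_topological_type :: "cps2 \<Rightarrow> cps2 \<Rightarrow> bool" where
  "same_topological_type C C' \<longleftrightarrow>
     (\<exists>(m::nat) B B'.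
        C = (\<Prod>k<m. B k) \<and> C' = (\<Prod>k<m. B' k) \<and>
        (\<forall>k<m. plane_branch (B k) \<and> plane_branch (B' k) \<and>
               value_semigroup (B k) = value_semigroup (B' k)) \<and>
        (\<forall>k<m. \<forall>l<m. k \<noteq> l \<longrightarrow>
               intersection_number (B k) (B l) = intersection_number (B' k) (B' l)))"


section \<open>Differential values and the Zariski invariant\<close>

text \<open>A Puiseux parametrization \<open>(t\<^sup>k, y(t))\<close>, which exists for every branch other than
  \<open>x = 0\<close>; the gcd condition makes it primitive.\<close>

definition puiseux_parametrization :: "cps2 \<Rightarrow> nat \<Rightarrow> complex fps \<Rightarrow> bool" where
  "puiseux_parametrization f k y \<longleftrightarrow>
     k > 0 \<and> fps_conv_radius y > 0 \<and> fps_nth y 0 = 0 \<and>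
     subst2 (series f) (fps_X ^ k) y = 0 \<and>
     Gcd (insert k {m. fps_nth y m \<noteq> 0}) = 1"

definition pullback_form :: "cps2 \<Rightarrow> cps2 \<Rightarrow> complex fps \<Rightarrow> complex fps \<Rightarrow> complex fps" where
  "pullback_form g h x y =
     subst2 (series g) x y * fps_deriv x + subst2 (series h) x y * fps_deriv y"

text \<open>Two Puiseux parametrizations of a branch differ by \<open>t \<mapsto> \<omega>t\<close> with \<open>\<omega>\<^sup>k = 1\<close>, so the set
  below does not depend on the one used.\<close>

definition differential_values :: "cps2 \<Rightarrow> nat set" where
  "differential_values f =
     {subdegree (pullback_form g h (fps_X ^ k) y) + 1 | g h k y.
        puiseux_parametrization f k y \<and> pullback_form g h (fps_X ^ k) y \<noteq> 0}"

definition zariski_invariant :: "cps2 \<Rightarrow> nat" where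
  "zariski_invariant f =
     (if differential_values f - value_semigroup f \<noteq> {}
      then (LEAST m. m \<in> differential_values f - value_semigroup f) - order2 f
      else 0)"


section \<open>The normal form families\<close>

text \<open>\<open>f = \<Prod>(y - \<sigma>(\<omega> x\<^bsup>1/n\<^esup>))\<close>, the product being over all \<open>\<omega>\<close> with \<open>\<omega>\<^sup>n = 1\<close>.\<close>

definition puiseux_equation :: "nat \<Rightarrow> complex fps \<Rightarrow> cps2 \<Rightarrow> bool" where
  "puiseux_equation n \<sigma> f \<longleftrightarrow>
     ramify n (series f) =
       (\<Prod>\<omega> | \<omega> ^ n = 1. fps_X - fps_const (fps_compose \<sigma> (fps_const \<omega> * fps_X)))"

definition nf_series :: "nat \<Rightarrow> nat \<Rightarrow> (nat \<Rightarrow> complex) \<Rightarrow> nat set \<Rightarrow> complex fps" where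
  "nf_series s1 j a L =
     fps_X ^ s1 + fps_X ^ (2 * s1 - 4 * j) +
     (\<Sum>l\<in>L. fps_const (a l) * fps_X ^ (3 * s1 - 4 * (s1 div 4 + j + 1 - l)))"

text \<open>\<open>nf_param i s1 lam \<sigma>\<close>: \<open>\<sigma>\<close> has the shape \<open>\<sigma>\<^sub>i\<close> with \<open>\<lambda>\<^sub>i = lam\<close>. None of the subtractions
  truncates in the given ranges.\<close>

inductive nf_param :: "nat \<Rightarrow> nat \<Rightarrow> nat \<Rightarrow> complex fps \<Rightarrow> bool" where
  nf1: "nf_param 1 s1 0 (fps_X ^ s1)"
| nf2: "2 \<le> j \<Longrightarrow> j \<le> s1 div 4 \<Longrightarrow> 1 \<le> k \<Longrightarrow> k \<le> s1 div 4 - j \<Longrightarrow> a k \<noteq> 0 \<Longrightarrow>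
        nf_param 2 s1 (2 * s1 - 4 * j) (nf_series s1 j a {k..k + j - 2})"
| nf3: "2 \<le> j \<Longrightarrow> j \<le> s1 div 4 \<Longrightarrow>
        a (s1 div 4 - j + 1) = of_nat (3 * s1 - 4 * j) / of_nat (2 * s1) \<Longrightarrow>
        nf_param 3 s1 (2 * s1 - 4 * j) (nf_series s1 j a {s1 div 4 - j + 1..s1 div 4})"
| nf4: "2 \<le> j \<Longrightarrow> j \<le> s1 div 4 \<Longrightarrow>
        a (s1 div 4 - j + 1) \<noteq> of_nat (3 * s1 - 4 * j) / of_nat (2 * s1) \<Longrightarrow>
        nf_param 4 s1 (2 * s1 - 4 * j) (nf_series s1 j a {s1 div 4 - j + 1..s1 div 4 - 1})"

definition NF4 :: "nat \<Rightarrow> nat \<Rightarrow> cps2 \<Rightarrow> bool" where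
  "NF4 i s1 f \<longleftrightarrow>
     s1 > 4 \<and> odd s1 \<and>
     (\<exists>\<sigma>. nf_param i s1 (zariski_invariant f) \<sigma> \<and> puiseux_equation 4 \<sigma> f)"


section \<open>The discriminant curve of \<open>(x, f)\<close>\<close>

text \<open>\<open>D(u, v) = \<Prod>(v - f(u, \<gamma>\<^sub>j(u)))\<close>, where \<open>\<gamma>\<^sub>1, \<dots>, \<gamma>\<^sub>n\<^sub>-\<^sub>1\<close> are the Newton--Puiseux roots of
  \<open>\<partial>f/\<partial>y\<close>. For a common denominator \<open>N\<close> of the exponents, \<open>\<gamma> j\<close> below is \<open>\<gamma>\<^sub>j(t\<^sup>N) \<in> \<complex>{t}\<close>.
  Note that \<open>fps_deriv\<close> acts on the outer variable \<open>y\<close>.\<close>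

definition discriminant_curve :: "cps2 \<Rightarrow> cps2 \<Rightarrow> bool" where
  "discriminant_curve f D \<longleftrightarrow>
     (\<exists>N w \<gamma>. N > 0 \<and> w dvd 1 \<and>
        (\<forall>j\<in>{1..<order2 f}. fps_conv_radius (\<gamma> j) > 0 \<and> fps_nth (\<gamma> j) 0 = 0) \<and>
        ramify N (fps_deriv (series f)) =
          ramify N (series w) * (\<Prod>j\<in>{1..<order2 f}. fps_X - fps_const (\<gamma> j)) \<and>
        ramify N (series D) =
          (\<Prod>j\<in>{1..<order2 f}. fps_X - fps_const (subst2 (series f) (fps_X ^ N) (\<gamma> j))))"


section \<open>Kouchnirenko non-degeneracy\<close>

definition support2 :: "cps2 \<Rightarrow> (nat \<times> nat) set" where
  "support2 h = {(i, j). coeff2 h i j \<noteq> 0}"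

definition newton_polygon :: "cps2 \<Rightarrow> (real \<times> real) set" where
  "newton_polygon h =
     convex hull {(real i + a, real j + b) | i j a b. (i, j) \<in> support2 h \<and> 0 \<le> a \<and> 0 \<le> b}"

text \<open>\<open>h\<^sub>L(1, z) / z\<^bsup>j\<^sub>0\<^esup>\<close>; the division is exact.\<close>

definition edge_poly :: "cps2 \<Rightarrow> (real \<times> real) set \<Rightarrow> complex poly" where
  "edge_poly h L =
     (\<Sum>(i, j) | (i, j) \<in> support2 h \<and> (real i, real j) \<in> L. monom (coeff2 h i j) j) div
     monom 1 (LEAST j. \<exists>i. (real i, real j) \<in> L)"

definition nondegenerate :: "cps2 \<Rightarrow> bool" where
  "nondegenerate h \<longleftrightarrow>
     (\<forall>L. L edge_of newton_polygon h \<and> compact L \<longrightarrow> rsquarefree (edge_poly h L))"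

end

theory Submission
  imports Defs
begin

text \<open>
  With \<open>A = t\<^sup>s\<close>, \<open>B = t\<^bsup>\<lambda>\<^esup>\<close> and \<open>C\<close> the tail of \<open>\<sigma>\<close>, the substitution \<open>t \<mapsto> \<omega>t\<close> multiplies
  \<open>A, B, C\<close> by \<open>\<eta>, \<eta>\<^sup>2, \<eta>\<^sup>3\<close> where \<open>\<eta> = \<omega>\<^sup>s\<close>, so that the product over the conjugates is
  \<open>f = y\<^sup>4 - 2py\<^sup>2 - 4qy + r\<close> with \<open>p = B\<^sup>2 + 2AC\<close>, \<open>q = B(A\<^sup>2 + C\<^sup>2)\<close> and \<open>r = -x\<^sup>s + \<dots>\<close>. The polar
  curve is \<open>y\<^sup>3 = py + q\<close>. Put \<open>M = 2s + \<lambda>\<close>. As \<open>3 ord(p) > 2 ord(q)\<close>, the roots are \<open>\<gamma> = c x\<^bsup>M/12\<^esup> + \<dots>\<close>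
  with \<open>c\<^sup>3 = 1\<close>, and on them \<open>f = r - 3q\<gamma> - p\<gamma>\<^sup>2 = r - 3c u\<^bsup>M/3\<^esup> + \<dots>\<close>. So the three roots of
  the discriminant agree with \<open>r = -u\<^sup>s + \<dots>\<close> up to the order \<open>M/3 > s\<close>, which makes the Newton polygon
  degenerate. The substitutions \<open>t \<mapsto> \<xi>t\<close> permute these roots, which shows that they are series in
  \<open>u\<^bsup>1/3\<^esup>\<close> when \<open>3\<close> does not divide \<open>M\<close>, and in \<open>u\<close> otherwise.

  For a branch with parametrization \<open>(t\<^sup>n, y(t))\<close> the intersection numbers are orders in \<open>t\<close>: series
  whose orders run through \<open>\<Gamma> - (k + \<Gamma>)\<close>, a set with \<open>k\<close> elements, form a basis of the quotient by
  a series of order \<open>k\<close>.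
\<close>

section \<open>Evaluating the outer variable\<close>

text \<open>Intersection numbers and semigroups are defined by quotients of the ring of convergent
  series, whereas orders of contact are visible only on parametrizations. The bridge is division by
  a linear factor \<open>Y - b\<close>: it is explicit, quotient and remainder converge, and both
  are unique, so they inherit every symmetry under rotations of t. Applied to all conjugates, it
  identifies the kernel of h |-> h(t^n, y(t)) with the ideal of the branch. Interpolation at the
  conjugates shows that all series of large order are values, so that approximation order by order
  becomes an exact identity after finitely many steps.

  \<open>discriminant_curve\<close> leaves the denominator N and the unit w arbitrary. The polar
  roots are therefore taken as given: their equations come from cancelling linear factors, with w
  carried along, and N disappears when the roots descend to u or its cube root.

  In the normal forms the whole tail has order above \<lambda>. This keeps it out of the leading
  terms of q and r and keeps p above the order that would disturb the cubic y^3 = q; hence the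
  families with \<lambda> > 0 can be treated alike.\<close>

definition eval_y :: "complex fps \<Rightarrow> complex fps fps \<Rightarrow> complex fps" where
  "eval_y b H = Abs_fps (\<lambda>m. \<Sum>j\<le>m. fps_nth (fps_nth H j * b ^ j) m)"

text \<open>Horner's scheme: the coefficient of Y^j in the quotient of H by Y - b is the tail of H
  beyond degree j, shifted down and evaluated at b.\<close>

definition quot_y :: "complex fps \<Rightarrow> complex fps fps \<Rightarrow> complex fps fps" where
  "quot_y b H = Abs_fps (\<lambda>j. eval_y b (fps_shift (Suc j) H))"

text \<open>One operation for both substitutions in the inner variable: \<open>fps_X ^ n\<close>
  yields \<open>ramify\<close>, a constant multiple of \<open>fps_X\<close> yields
  \<open>rot_coeffs\<close>.\<close>

definition compose_coeffs :: "complex fps \<Rightarrow> complex fps fps \<Rightarrow> complex fps fps" where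
  "compose_coeffs a H = Abs_fps (\<lambda>j. fps_compose (fps_nth H j) a)"

lemma ramify_eq_compose_coeffs: "ramify n = compose_coeffs (fps_X ^ n)"
  by (simp add: ramify_def compose_coeffs_def fun_eq_iff)

lemma subst2_eq_eval_y: "subst2 G (fps_X ^ n) b = eval_y b (ramify n G)"
  by (simp add: subst2_def eval_y_def ramify_def)

lemma nth_mult_power_eq_0:
  fixes b :: "complex fps"
  assumes "fps_nth b 0 = 0" "m < j"
  shows "fps_nth (c * b ^ j) m = 0"
  using assms startsby_zero_power_prefix[OF assms(1), of j]
  by (auto simp: fps_mult_nth intro!: sum.neutral)

lemma eval_y_nth_ge:
  assumes "fps_nth b 0 = 0" "m \<le> k"
  shows "fps_nth (eval_y b H) m = (\<Sum>j\<le>k. fps_nth (fps_nth H j * b ^ j) m)"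
  unfolding eval_y_def fps_nth_Abs_fps
  by (rule sum.mono_neutral_left) (use assms nth_mult_power_eq_0 in auto)

text \<open>Horner's step. The two sides truncate the sum at different degrees, which
  \<open>eval_y_nth_ge\<close> reconciles since b^j starts in order j.\<close>

lemma eval_y_rec:
  assumes "fps_nth b 0 = 0"
  shows "eval_y b H = fps_nth H 0 + b * eval_y b (fps_shift 1 H)"
proof (rule fps_ext)
  fix m
  have "fps_nth (b * eval_y b (fps_shift 1 H)) m =
      (\<Sum>i=0..m. fps_nth b i * (\<Sum>j\<le>m. fps_nth (fps_nth H (Suc j) * b ^ j) (m - i)))"
    using assms by (simp add: fps_mult_nth eval_y_nth_ge[of b _ m])
  also have "\<dots> = (\<Sum>j\<le>m. fps_nth (b * (fps_nth H (Suc j) * b ^ j)) m)"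
    unfolding fps_mult_nth[of b] sum_distrib_left by (rule sum.swap)
  also have "\<dots> = (\<Sum>j\<le>m. fps_nth (fps_nth H (Suc j) * b ^ Suc j) m)"
    by (simp add: mult_ac)
  finally have *: "fps_nth (b * eval_y b (fps_shift 1 H)) m = \<dots>" .
  have "fps_nth (eval_y b H) m = (\<Sum>j\<le>Suc m. fps_nth (fps_nth H j * b ^ j) m)"
    using assms by (simp add: eval_y_nth_ge[of b m "Suc m"])
  also have "\<dots> = fps_nth (fps_nth H 0) m + (\<Sum>j\<le>m. fps_nth (fps_nth H (Suc j) * b ^ Suc j) m)"
    by (subst sum.atMost_Suc_shift) simp
  finally show "fps_nth (eval_y b H) m = fps_nth (fps_nth H 0 + b * eval_y b (fps_shift 1 H)) m"
    using * by simp
qed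

lemma eval_y_division:
  assumes "fps_nth b 0 = 0"
  shows "H = (fps_X - fps_const b) * quot_y b H + fps_const (eval_y b H)"
proof (rule fps_ext)
  fix j
  show "fps_nth H j = fps_nth ((fps_X - fps_const b) * quot_y b H + fps_const (eval_y b H)) j"
  proof (cases j)
    case 0
    then show ?thesis
      using eval_y_rec[OF assms, of H] by (simp add: algebra_simps quot_y_def)
  next
    case (Suc k)
    then show ?thesis
      using eval_y_rec[OF assms, of "fps_shift (Suc k) H"]
      by (simp add: algebra_simps quot_y_def flip: fps_shift_fps_shift)
  qed
qed

text \<open>The coefficients satisfy Q_j = b Q_(j+1), so Q_0 is divisible by every power of b and
  vanishes; and c is - b Q_0.\<close>

lemma linear_times_eq_const:
  assumes b: "fps_nth b 0 = 0" and eq: "(fps_X - fps_const b) * Q = fps_const (c::complex fps)"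
  shows "c = 0"
proof -
  have step: "fps_nth Q j = b * fps_nth Q (Suc j)" for j
    using arg_cong[OF eq, of "\<lambda>F. fps_nth F (Suc j)"] by (simp add: algebra_simps)
  have pow: "fps_nth Q 0 = b ^ m * fps_nth Q m" for m
  proof (induction m)
    case (Suc m)
    then show ?case by (simp add: step[of m] mult_ac)
  qed simp
  have "fps_nth Q 0 = 0"
  proof (rule fps_ext)
    fix m
    show "fps_nth (fps_nth Q 0) m = fps_nth 0 m"
      unfolding pow[of "Suc m"] using nth_mult_power_eq_0[OF b, of m "Suc m"]
      by (simp add: mult.commute)
  qed
  then show ?thesis
    using arg_cong[OF eq, of "\<lambda>F. fps_nth F 0"] by (simp add: algebra_simps)
qed

text \<open>The value at b is the remainder modulo Y - b. The laws for constants, sums and products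
  below then follow by exhibiting a quotient.\<close>

lemma eval_y_unique:
  assumes b: "fps_nth b 0 = 0" and eq: "H = (fps_X - fps_const b) * Q + fps_const c"
  shows "eval_y b H = c"
proof -
  have sub: "l * (Q - q) = d - c" if "l * q + d = l * Q + c" for l q Q c d :: "complex fps fps"
    using that by (simp add: algebra_simps)
  have "(fps_X - fps_const b) * (Q - quot_y b H) = fps_const (eval_y b H - c)"
    using sub[OF trans[OF eval_y_division[OF b, of H, symmetric] eq]] by simp
  from linear_times_eq_const[OF b this] show ?thesis by simp
qed

lemma eval_y_eq_0_dvd:
  assumes "fps_nth b 0 = 0" "eval_y b H = 0"
  shows "H = (fps_X - fps_const b) * quot_y b H"
  using eval_y_division[OF assms(1), of H] unfolding assms(2) fps_const_0_eq_0 add_0_right .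

lemma eval_y_const [simp]: "fps_nth b 0 = 0 \<Longrightarrow> eval_y b (fps_const c) = c"
  by (rule eval_y_unique[of _ _ 0]) auto

lemma eval_y_0 [simp]: "fps_nth b 0 = 0 \<Longrightarrow> eval_y b 0 = 0"
  using eval_y_const[of b 0] by simp

lemma eval_y_1 [simp]: "fps_nth b 0 = 0 \<Longrightarrow> eval_y b 1 = 1"
  using eval_y_const[of b 1] by simp

lemma eval_y_numeral [simp]: "fps_nth b 0 = 0 \<Longrightarrow> eval_y b (numeral w) = numeral w"
  using eval_y_const[of b "numeral w"] by (simp flip: numeral_fps_const)

lemma eval_y_X [simp]: "fps_nth b 0 = 0 \<Longrightarrow> eval_y b fps_X = b"
  by (rule eval_y_unique[of _ _ 1]) auto

lemma eval_y_add [simp]: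
  assumes b: "fps_nth b 0 = 0"
  shows "eval_y b (G + H) = eval_y b G + eval_y b H"
proof (rule eval_y_unique[OF b])
  let ?l = "fps_X - fps_const b"
  have "G + H = (?l * quot_y b G + fps_const (eval_y b G)) + (?l * quot_y b H + fps_const (eval_y b H))"
    by (rule arg_cong2[where f = "(+)"]) (rule eval_y_division[OF b])+
  then show "G + H = ?l * (quot_y b G + quot_y b H) + fps_const (eval_y b G + eval_y b H)"
    by (simp only: ring_distribs add_ac flip: fps_const_add)
qed

lemma eval_y_mult [simp]:
  assumes b: "fps_nth b 0 = 0"
  shows "eval_y b (G * H) = eval_y b G * eval_y b H"
proof (rule eval_y_unique[OF b])
  let ?l = "fps_X - fps_const b"
  let ?q = "quot_y b G" and ?r = "quot_y b H"
  let ?c = "fps_const (eval_y b G)" and ?d = "fps_const (eval_y b H)"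
  have "G * H = (?l * ?q + ?c) * (?l * ?r + ?d)"
    by (rule arg_cong2[where f = "(*)"]) (rule eval_y_division[OF b])+
  also have "\<dots> = ?l * (?q * (?l * ?r + ?d) + ?c * ?r) + ?c * ?d"
    by (simp only: ring_distribs mult_ac add_ac)
  finally show "G * H = ?l * (?q * (?l * ?r + ?d) + ?c * ?r) + fps_const (eval_y b G * eval_y b H)"
    by simp
qed

lemma eval_y_uminus [simp]: "fps_nth b 0 = 0 \<Longrightarrow> eval_y b (- H) = - eval_y b H"
  using eval_y_add[of b H "- H"] by (simp add: add_eq_0_iff del: eval_y_add)

lemma eval_y_diff [simp]:
  "fps_nth b 0 = 0 \<Longrightarrow> eval_y b (G - H) = eval_y b G - eval_y b H"
  using eval_y_add[of b G "- H"] by (simp del: eval_y_add)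

lemma eval_y_power [simp]: "fps_nth b 0 = 0 \<Longrightarrow> eval_y b (H ^ k) = eval_y b H ^ k"
  by (induction k) auto

lemma eval_y_sum: "fps_nth b 0 = 0 \<Longrightarrow> eval_y b (sum f A) = (\<Sum>x\<in>A. eval_y b (f x))"
  by (induction A rule: infinite_finite_induct) auto

lemma eval_y_prod: "fps_nth b 0 = 0 \<Longrightarrow> eval_y b (prod f A) = (\<Prod>x\<in>A. eval_y b (f x))"
  by (induction A rule: infinite_finite_induct) auto

section \<open>Substitutions in the inner variable\<close>

lemma compose_coeffs_nth [simp]: "fps_nth (compose_coeffs a H) j = fps_compose (fps_nth H j) a"
  by (simp add: compose_coeffs_def)

lemma compose_coeffs_add: "compose_coeffs a (G + H) = compose_coeffs a G + compose_coeffs a H"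
  by (simp add: fps_eq_iff[of "compose_coeffs _ _"] fps_compose_add_distrib)

lemma compose_coeffs_uminus: "compose_coeffs a (- G) = - compose_coeffs a G"
  by (simp add: fps_eq_iff[of "compose_coeffs _ _"] fps_compose_uminus)

lemma compose_coeffs_diff: "compose_coeffs a (G - H) = compose_coeffs a G - compose_coeffs a H"
  by (simp add: fps_eq_iff[of "compose_coeffs _ _"] fps_compose_sub_distrib)

lemma compose_coeffs_sum: "compose_coeffs a (sum f A) = (\<Sum>x\<in>A. compose_coeffs a (f x))"
  by (simp add: fps_eq_iff[of "compose_coeffs _ _"] fps_compose_sum_distrib fps_sum_nth)

lemma compose_coeffs_const: "compose_coeffs a (fps_const c) = fps_const (fps_compose c a)"
  by (simp add: fps_eq_iff[of "compose_coeffs _ _"])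

lemma compose_coeffs_1: "compose_coeffs a 1 = 1"
  using compose_coeffs_const[of a 1] by simp

lemma compose_coeffs_X: "compose_coeffs a fps_X = fps_X"
  by (simp add: fps_eq_iff[of "compose_coeffs _ _"] fps_X_def)

lemma compose_coeffs_mult:
  "fps_nth a 0 = 0 \<Longrightarrow> compose_coeffs a (G * H) = compose_coeffs a G * compose_coeffs a H"
  by (simp add: fps_eq_iff[of "compose_coeffs _ _"] fps_mult_nth[of G] fps_mult_nth[of "compose_coeffs _ _"]
      fps_compose_sum_distrib fps_compose_mult_distrib)

lemma compose_coeffs_power:
  "fps_nth a 0 = 0 \<Longrightarrow> compose_coeffs a (G ^ k) = compose_coeffs a G ^ k"
  by (induction k) (auto simp: compose_coeffs_1 compose_coeffs_mult)

lemma compose_coeffs_prod: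
  "fps_nth a 0 = 0 \<Longrightarrow> compose_coeffs a (prod f A) = (\<Prod>x\<in>A. compose_coeffs a (f x))"
  by (induction A rule: infinite_finite_induct) (auto simp: compose_coeffs_1 compose_coeffs_mult)

lemmas compose_coeffs_simps = compose_coeffs_add compose_coeffs_uminus compose_coeffs_diff
  compose_coeffs_sum compose_coeffs_const compose_coeffs_1 compose_coeffs_X compose_coeffs_mult
  compose_coeffs_power compose_coeffs_prod

lemma compose_coeffs_compose:
  "fps_nth a 0 = 0 \<Longrightarrow> fps_nth b 0 = 0 \<Longrightarrow>
    compose_coeffs a (compose_coeffs b H) = compose_coeffs (fps_compose b a) H"
  by (simp add: fps_eq_iff[of "compose_coeffs _ _"] fps_compose_assoc)

lemma inj_compose:
  fixes a :: "complex fps"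
  assumes "fps_nth a 0 = 0" "a \<noteq> 0" "fps_compose b a = fps_compose c a"
  shows "b = c"
proof -
  have "fps_compose (b - c) a = 0"
    using assms(3) by (simp add: fps_compose_sub_distrib)
  then show ?thesis
    using assms(1,2) by (simp add: fps_compose_eq_0_iff)
qed

lemma inj_compose_coeffs:
  assumes "fps_nth a 0 = 0" "a \<noteq> 0" "compose_coeffs a G = compose_coeffs a H"
  shows "G = H"
proof (rule fps_ext)
  fix j
  show "fps_nth G j = fps_nth H j"
    by (rule inj_compose[OF assms(1,2)])
      (use arg_cong[OF assms(3), of "\<lambda>F. fps_nth F j"] in simp)
qed

lemma eval_y_compose:
  assumes "fps_nth a 0 = 0" "fps_nth b 0 = 0"
  shows "eval_y (fps_compose b a) (compose_coeffs a H) = fps_compose (eval_y b H) a"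
proof (rule eval_y_unique)
  show "fps_nth (fps_compose b a) 0 = 0"
    using assms by simp
  show "compose_coeffs a H = (fps_X - fps_const (fps_compose b a)) * compose_coeffs a (quot_y b H)
      + fps_const (fps_compose (eval_y b H) a)"
    by (subst eval_y_division[OF assms(2), of H]) (simp add: compose_coeffs_simps assms)
qed

section \<open>Rotations of the parameter t, the Galois action over the series in
  \<open>t ^ n\<close>\<close>

definition rot :: "complex \<Rightarrow> complex fps \<Rightarrow> complex fps" where
  "rot \<omega> z = fps_compose z (fps_const \<omega> * fps_X)"

lemma rot_nth [simp]: "fps_nth (rot \<omega> z) m = \<omega> ^ m * fps_nth z m"
  by (simp add: rot_def)

lemma rot_1 [simp]: "rot 1 z = z"
  by (simp add: fps_eq_iff)

lemma rot_rot [simp]: "rot \<omega> (rot \<zeta> z) = rot (\<omega> * \<zeta>) z"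
  by (simp add: fps_eq_iff power_mult_distrib)

lemma primitive_root_exists:
  assumes "k > 0"
  obtains \<zeta> :: complex where "\<zeta> ^ k = 1" "\<And>m. \<zeta> ^ m = 1 \<Longrightarrow> k dvd m"
proof
  define \<zeta> where "\<zeta> = exp (2 * of_real pi * \<i> * of_nat 1 / of_nat k)"
  show "\<zeta> ^ k = 1"
    unfolding \<zeta>_def by (rule complex_root_unity) (use assms in auto)
  fix m assume "\<zeta> ^ m = 1"
  also have "\<zeta> ^ m = exp (2 * of_real pi * \<i> * of_nat m / of_nat k)"
    by (simp add: \<zeta>_def flip: exp_of_nat_mult) (simp add: mult_ac)
  finally show "k dvd m"
    using complex_root_unity_eq_1[of k m] assms by simp
qed

text \<open>For a primitive k-th root of unity \<zeta> the coefficient of t^m is multiplied by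
  \<zeta>^m, which is 1 only if k divides m.\<close>

lemma rot_invariant_imp_power:
  assumes k: "k > 0" and inv: "\<And>\<zeta>. \<zeta> ^ k = 1 \<Longrightarrow> rot \<zeta> z = z"
  shows "z = fps_compose (Abs_fps (\<lambda>m. fps_nth z (k * m))) (fps_X ^ k)"
proof (rule fps_ext)
  fix m
  obtain \<zeta> :: complex where \<zeta>: "\<zeta> ^ k = 1" "\<And>m. \<zeta> ^ m = 1 \<Longrightarrow> k dvd m"
    using primitive_root_exists[OF k] by blast
  have "\<zeta> ^ m * fps_nth z m = fps_nth z m"
    using inv[OF \<zeta>(1)] by (metis rot_nth)
  then have "k dvd m" if "fps_nth z m \<noteq> 0"
    using that \<zeta>(2) by simp
  then show "fps_nth z m = fps_nth (fps_compose (Abs_fps (\<lambda>m. fps_nth z (k * m))) (fps_X ^ k)) m"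
    by (auto simp: fps_nth_compose_X_power)
qed

lemma rot_compose_X_power:
  assumes "\<omega> ^ n = \<zeta>"
  shows "rot \<omega> (fps_compose z (fps_X ^ n)) = fps_compose (rot \<zeta> z) (fps_X ^ n)"
  using assms by (auto simp: fps_eq_iff fps_nth_compose_X_power simp flip: power_mult)

section \<open>Convergence\<close>

text \<open>A single constant serves as factor and as ratio, which keeps later estimates free of a
  separate M.\<close>

lemma convergent2_altdef:
  "convergent2 F \<longleftrightarrow> (\<exists>R\<ge>1. \<forall>i j. norm (fps_nth (fps_nth F j) i) \<le> R ^ (i + j + 1))"
proof
  assume "convergent2 F"
  then obtain M R :: real where MR: "M \<ge> 0" "R > 0"
      "\<And>i j. norm (fps_nth (fps_nth F j) i) \<le> M * R ^ (i + j)"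
    using convergent2D by blast
  define S where "S = Max {1, M, R}"
  have S: "S \<ge> 1" "M \<le> S" "R \<le> S"
    by (auto simp: S_def)
  have "norm (fps_nth (fps_nth F j) i) \<le> S ^ (i + j + 1)" for i j
  proof -
    have "M * R ^ (i + j) \<le> S * S ^ (i + j)"
      using S MR(1,2) by (intro mult_mono power_mono) auto
    then show ?thesis
      using MR(3)[of j i] by simp
  qed
  then show "\<exists>R\<ge>1. \<forall>i j. norm (fps_nth (fps_nth F j) i) \<le> R ^ (i + j + 1)"
    using S(1) by blast
next
  assume "\<exists>R\<ge>1. \<forall>i j. norm (fps_nth (fps_nth F j) i) \<le> R ^ (i + j + 1)"
  then obtain R :: real where "R \<ge> 1" "\<And>i j. norm (fps_nth (fps_nth F j) i) \<le> R ^ (i + j + 1)"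
    by blast
  then show "convergent2 F"
    by (intro convergent2I[of R _ R]) auto
qed

text \<open>If indices grow at most by the factor c, the ratio R becomes R^c. This settles all
  reindexings: ramification, its inverse, and rotations by numbers of modulus 1.\<close>

lemma convergent2_dominated:
  assumes F: "convergent2 F"
    and le: "\<And>i j. \<exists>i' j'. i' + j' \<le> c * (i + j) \<and>
      norm (fps_nth (fps_nth G j) i) \<le> norm (fps_nth (fps_nth F j') i')"
  shows "convergent2 G"
proof -
  obtain R :: real where R: "R \<ge> 1" "\<And>i j. norm (fps_nth (fps_nth F j) i) \<le> R ^ (i + j + 1)"
    using F convergent2_altdef by blast
  show ?thesis
  proof (rule convergent2I)
    show "R ^ c > 0"
      using R(1) by simp
    fix i j
    obtain i' j' where ij: "i' + j' \<le> c * (i + j)"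
        "norm (fps_nth (fps_nth G j) i) \<le> norm (fps_nth (fps_nth F j') i')"
      using le by blast
    note ij(2)
    also have "norm (fps_nth (fps_nth F j') i') \<le> R ^ (i' + j' + 1)"
      by (rule R)
    also have "\<dots> \<le> R ^ (c * (i + j) + 1)"
      using R(1) ij(1) by (intro power_increasing) auto
    also have "\<dots> = R * (R ^ c) ^ (i + j)"
      by (simp add: power_mult)
    finally show "norm (fps_nth (fps_nth G j) i) \<le> R * (R ^ c) ^ (i + j)" .
  qed
qed

lemma convergent2_diff: "convergent2 F \<Longrightarrow> convergent2 G \<Longrightarrow> convergent2 (F - G)"
  using convergent2_add[of F "- G"] convergent2_uminus by simp

lemma convergent2_1: "convergent2 1"
  by (rule convergent2_polynomial[of 0]) auto

lemma convergent2_X: "convergent2 fps_X"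
  by (rule convergent2_polynomial[of 1]) (auto simp: fps_X_def)

lemma convergent2_prod: "(\<And>x. x \<in> A \<Longrightarrow> convergent2 (f x)) \<Longrightarrow> convergent2 (prod f A)"
  by (induction A rule: infinite_finite_induct) (auto intro: convergent2_1 convergent2_mult)

text \<open>A series in one variable is viewed as a series in two that is constant in the outer one,
  so that the closure properties of \<open>convergent2\<close> apply to both kinds.\<close>

abbreviation conv1 :: "complex fps \<Rightarrow> bool" where
  "conv1 b \<equiv> convergent2 (fps_const b)"

lemma conv1_mult: "conv1 a \<Longrightarrow> conv1 b \<Longrightarrow> conv1 (a * b)"
  using convergent2_mult[of "fps_const a" "fps_const b"] by simp

lemma conv1_diff: "conv1 a \<Longrightarrow> conv1 b \<Longrightarrow> conv1 (a - b)"
  using convergent2_diff[of "fps_const a" "fps_const b"] by simp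

lemma conv1_prod: "(\<And>x. x \<in> A \<Longrightarrow> conv1 (f x)) \<Longrightarrow> conv1 (prod f A)"
  by (induction A rule: infinite_finite_induct)
    (use convergent2_1 in \<open>auto intro: conv1_mult\<close>)

lemma conv1_const: "conv1 (fps_const c)"
  by (rule convergent2_polynomial[of 0]) auto

lemma conv1_fps_X_power: "conv1 (fps_X ^ k)"
  by (rule convergent2_polynomial[of k]) auto

lemma conv1_cutoff: "conv1 (fps_cutoff k b)"
  by (rule convergent2_polynomial[of k]) auto

lemma convergent2_compose_X_power:
  assumes "n > 0" "convergent2 H"
  shows "convergent2 (compose_coeffs (fps_X ^ n) H)"
proof (rule convergent2_dominated[OF assms(2), of 1])
  fix i j
  show "\<exists>i' j'. i' + j' \<le> 1 * (i + j) \<and>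
    norm (fps_nth (fps_nth (compose_coeffs (fps_X ^ n) H) j) i) \<le> norm (fps_nth (fps_nth H j') i')"
    by (rule exI[of _ "i div n"], rule exI[of _ j]) (auto simp: fps_nth_compose_X_power)
qed

lemma convergent2_extract:
  assumes "convergent2 (compose_coeffs (fps_X ^ n) H)" "n > 0"
  shows "convergent2 H"
proof (rule convergent2_dominated[OF assms(1), of n])
  fix i j
  have "n * i + j \<le> n * i + n * j"
    using assms(2) by simp
  then show "\<exists>i' j'. i' + j' \<le> n * (i + j) \<and>
    norm (fps_nth (fps_nth H j) i) \<le> norm (fps_nth (fps_nth (compose_coeffs (fps_X ^ n) H) j') i')"
    using assms(2)
    by (intro exI[of _ "n * i"] exI[of _ j]) (auto simp: fps_nth_compose_X_power algebra_simps)
qed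

lemma conv1_compose_X_power: "n > 0 \<Longrightarrow> conv1 (fps_compose b (fps_X ^ n)) \<longleftrightarrow> conv1 b"
  using convergent2_compose_X_power[of n "fps_const b"] convergent2_extract[of n "fps_const b"]
  by (auto simp: compose_coeffs_const)

definition rot_coeffs :: "complex \<Rightarrow> complex fps fps \<Rightarrow> complex fps fps" where
  "rot_coeffs \<omega> = compose_coeffs (fps_const \<omega> * fps_X)"

lemma rot_coeffs_nth [simp]: "fps_nth (rot_coeffs \<omega> H) j = rot \<omega> (fps_nth H j)"
  by (simp add: rot_coeffs_def rot_def)

lemma root_of_unity_norm:
  fixes \<omega> :: complex
  assumes "\<omega> ^ n = 1" "n > 0"
  shows "norm \<omega> = 1"
  using assms power_eq_1_iff by blast

lemma conv1_rot:
  assumes "norm \<omega> = 1" "conv1 b"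
  shows "conv1 (rot \<omega> b)"
  by (rule convergent2_dominated[OF assms(2), of 1])
    (use assms(1) in \<open>auto simp: norm_mult norm_power\<close>)

text \<open>The bound is uniform in k because b has no constant term: against (2K)^m the i-th term
  of the convolution carries the factor (1/2)^i with i \<ge> 1, and these factors sum to at most
  1.\<close>

lemma norm_power_nth_le:
  fixes b :: "complex fps"
  assumes b: "fps_nth b 0 = 0" and K: "K \<ge> 0" "\<And>i. i > 0 \<Longrightarrow> norm (fps_nth b i) \<le> K ^ i"
  shows "norm (fps_nth (b ^ k) m) \<le> (2 * K) ^ m"
proof (induction k arbitrary: m)
  case 0
  then show ?case using K by (auto simp: power_0_left)
next
  case (Suc k)
  have half: "(\<Sum>i=1..m. (1 / 2 :: real) ^ i) \<le> 1"
  proof -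
    have "(\<Sum>i=1..m. (1 / 2 :: real) ^ i) = 1 - (1 / 2) ^ m"
      by (induction m) (auto simp: field_simps)
    then show ?thesis by simp
  qed
  have "norm (fps_nth (b ^ Suc k) m) \<le> (\<Sum>i=0..m. norm (fps_nth b i) * norm (fps_nth (b ^ k) (m - i)))"
    by (auto simp: fps_mult_nth norm_mult[symmetric] intro!: norm_sum)
  also have "\<dots> = (\<Sum>i=1..m. norm (fps_nth b i) * norm (fps_nth (b ^ k) (m - i)))"
    by (rule sum.mono_neutral_right) (use b in \<open>auto simp: Suc_le_eq\<close>)
  also have "\<dots> \<le> (\<Sum>i=1..m. (2 * K) ^ m * (1 / 2) ^ i)"
  proof (rule sum_mono)
    fix i assume i: "i \<in> {1..m}"
    have "norm (fps_nth b i) * norm (fps_nth (b ^ k) (m - i)) \<le> K ^ i * (2 * K) ^ (m - i)"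
      using i K by (intro mult_mono Suc.IH) auto
    also have "\<dots> = (2 * K * (1 / 2)) ^ i * (2 * K) ^ (m - i)"
      by simp
    also have "\<dots> = ((2 * K) ^ i * (2 * K) ^ (m - i)) * (1 / 2) ^ i"
      by (simp only: power_mult_distrib mult_ac)
    also have "(2 * K) ^ i * (2 * K) ^ (m - i) = (2 * K) ^ m"
      using i by (simp only: power_add[symmetric]) simp
    finally show "norm (fps_nth b i) * norm (fps_nth (b ^ k) (m - i)) \<le> (2 * K) ^ m * (1 / 2) ^ i" .
  qed
  also have "\<dots> \<le> (2 * K) ^ m"
    using mult_left_mono[OF half, of "(2 * K) ^ m"] K by (simp flip: sum_distrib_left)
  finally show ?case .
qed

text \<open>The shift n is kept in the estimate: n = 0 bounds the value at b, and n = j + 1 bounds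
  the coefficient of Y^j in the quotient by Y - b.\<close>

lemma eval_y_shift_bound:
  assumes "convergent2 H" "conv1 b" and b: "fps_nth b 0 = 0"
  obtains T where "T \<ge> 1"
    "\<And>m n. norm (fps_nth (eval_y b (fps_shift n H)) m) \<le> T ^ (m + n + 1)"
proof -
  obtain R where R: "R \<ge> 1" "\<And>i j. norm (fps_nth (fps_nth H j) i) \<le> R ^ (i + j + 1)"
    using assms(1) convergent2_altdef by blast
  obtain Q where Q: "Q \<ge> 1" "\<And>i j. norm (fps_nth (fps_nth (fps_const b) j) i) \<le> Q ^ (i + j + 1)"
    using assms(2) convergent2_altdef by blast
  \<comment> \<open>\<open>norm_power_nth_le\<close> wants a pure power; the surplus factor Q is
    absorbed by i + 1 \<le> 2 i for i > 0.\<close>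
  have bi: "norm (fps_nth b i) \<le> (Q ^ 2) ^ i" if "i > 0" for i
  proof -
    have "norm (fps_nth b i) \<le> Q ^ (i + 1)"
      using Q(2)[of 0 i] by simp
    also have "\<dots> \<le> Q ^ (2 * i)"
      using that Q(1) by (intro power_increasing) auto
    finally show ?thesis by (simp add: power_mult)
  qed
  define S where "S = max R (2 * Q ^ 2)"
  have S: "S \<ge> 1" "R \<le> S" "2 * Q ^ 2 \<le> S"
    using R(1) by (auto simp: S_def)
  have pow: "norm (fps_nth (b ^ l) m) \<le> S ^ m" for l m
  proof -
    have "norm (fps_nth (b ^ l) m) \<le> (2 * Q ^ 2) ^ m"
      by (rule norm_power_nth_le[OF b _ bi]) (use Q in auto)
    also have "\<dots> \<le> S ^ m"
      using S by (intro power_mono) auto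
    finally show ?thesis .
  qed
  have summand: "norm (fps_nth (fps_nth H k * b ^ l) m) \<le> 2 ^ m * S ^ (m + k + 1)" for k l m
  proof -
    have "norm (fps_nth (fps_nth H k * b ^ l) m) \<le>
        (\<Sum>i=0..m. norm (fps_nth (fps_nth H k) i) * norm (fps_nth (b ^ l) (m - i)))"
      by (auto simp: fps_mult_nth norm_mult[symmetric] intro!: norm_sum)
    also have "\<dots> \<le> (\<Sum>i=0..m. S ^ (m + k + 1))"
    proof (rule sum_mono)
      fix i assume i: "i \<in> {0..m}"
      have "norm (fps_nth (fps_nth H k) i) * norm (fps_nth (b ^ l) (m - i)) \<le>
          R ^ (i + k + 1) * S ^ (m - i)"
        using R(1) by (intro mult_mono R(2) pow) auto
      also have "\<dots> \<le> S ^ (i + k + 1) * S ^ (m - i)"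
        using S R(1) by (intro mult_right_mono power_mono) auto
      also have "\<dots> = S ^ (m + k + 1)"
        using i by (simp add: add_ac flip: power_add power_Suc)
      finally show "norm (fps_nth (fps_nth H k) i) * norm (fps_nth (b ^ l) (m - i)) \<le> S ^ (m + k + 1)" .
    qed
    also have "\<dots> = real (Suc m) * S ^ (m + k + 1)"
      by simp
    also have "\<dots> \<le> 2 ^ m * S ^ (m + k + 1)"
    proof (rule mult_right_mono)
      have "Suc m \<le> 2 ^ m"
        by (simp add: Suc_le_eq less_exp)
      then show "real (Suc m) \<le> 2 ^ m"
        by (metis of_nat_le_iff of_nat_numeral of_nat_power)
    qed (use S in auto)
    finally show ?thesis .
  qed
  have main: "norm (fps_nth (eval_y b (fps_shift n H)) m) \<le> (4 * S ^ 2) ^ (m + n + 1)" for m n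
  proof -
    have "norm (fps_nth (eval_y b (fps_shift n H)) m) \<le>
        (\<Sum>j\<le>m. norm (fps_nth (fps_nth H (j + n) * b ^ j) m))"
      by (auto simp: eval_y_def intro!: norm_sum)
    also have "\<dots> \<le> (\<Sum>j\<le>m. 2 ^ m * S ^ (2 * m + n + 1))"
    proof (rule sum_mono)
      fix j assume "j \<in> {..m}"
      then have "S ^ (m + (j + n) + 1) \<le> S ^ (2 * m + n + 1)"
        using S(1) by (intro power_increasing) auto
      then show "norm (fps_nth (fps_nth H (j + n) * b ^ j) m) \<le> 2 ^ m * S ^ (2 * m + n + 1)"
        using summand[where k = "j + n" and l = j and m = m] by (meson mult_left_mono order_trans zero_le_numeral zero_le_power)
    qed
    also have "\<dots> = real (Suc m) * (2 ^ m * S ^ (2 * m + n + 1))"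
      by simp
    also have "\<dots> \<le> 2 ^ m * (2 ^ m * S ^ (2 * m + n + 1))"
    proof (rule mult_right_mono)
      have "Suc m \<le> 2 ^ m"
        by (simp add: Suc_le_eq less_exp)
      then show "real (Suc m) \<le> 2 ^ m"
        by (metis of_nat_le_iff of_nat_numeral of_nat_power)
    qed (use S in auto)
    also have "\<dots> = 4 ^ m * S ^ (2 * m + n + 1)"
      by (simp flip: power_mult_distrib mult.assoc)
    also have "\<dots> \<le> 4 ^ (m + n + 1) * S ^ (2 * (m + n + 1))"
      using S by (intro mult_mono power_increasing) auto
    also have "\<dots> = (4 * S ^ 2) ^ (m + n + 1)"
      by (simp only: power_mult_distrib power_mult)
    finally show ?thesis .
  qed
  have "S ^ 2 \<ge> 1"
    using S(1) by (rule one_le_power)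
  then have "4 * S ^ 2 \<ge> 1"
    by linarith
  then show thesis
    using main that by blast
qed

lemma conv1_eval_y:
  assumes "convergent2 H" "conv1 b" "fps_nth b 0 = 0"
  shows "conv1 (eval_y b H)"
proof -
  obtain T where T: "T \<ge> 1"
    "\<And>m n. norm (fps_nth (eval_y b (fps_shift n H)) m) \<le> T ^ (m + n + 1)"
    using eval_y_shift_bound[OF assms] by blast
  have "norm (fps_nth (fps_nth (fps_const (eval_y b H)) j) i) \<le> T ^ (i + j + 1)" for i j
    using T(1) T(2)[of 0 i] by auto
  then show ?thesis
    using T(1) convergent2_altdef by blast
qed

lemma convergent2_quot_y:
  assumes "convergent2 H" "conv1 b" "fps_nth b 0 = 0"
  shows "convergent2 (quot_y b H)"
proof -
  obtain T where T: "T \<ge> 1"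
    "\<And>m n. norm (fps_nth (eval_y b (fps_shift n H)) m) \<le> T ^ (m + n + 1)"
    using eval_y_shift_bound[OF assms] by blast
  show ?thesis
  proof (rule convergent2I)
    show "T > 0" using T(1) by simp
    show "norm (fps_nth (fps_nth (quot_y b H) j) i) \<le> T ^ 2 * T ^ (i + j)" for i j
      using T(2)[of "Suc j" i] by (simp add: quot_y_def power2_eq_square algebra_simps)
  qed
qed

text \<open>With b = 1 - z / c, where c is the constant term of z, the inverse is the geometric
  series 1 / (1 - Y) evaluated at b and divided by c.\<close>

lemma conv1_inverse:
  assumes "conv1 z" "fps_nth z 0 \<noteq> 0"
  obtains w where "conv1 w" "z * w = 1"
proof
  define c where "c = fps_nth z 0"
  define b where "b = 1 - fps_const (1 / c) * z"
  have b0: "fps_nth b 0 = 0"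
    using assms(2) by (simp add: b_def c_def)
  have b: "conv1 b"
    unfolding b_def using assms(1) convergent2_1 by (auto intro!: conv1_diff conv1_mult conv1_const)
  define G :: "complex fps fps" where "G = Abs_fps (\<lambda>_. 1)"
  have G: "convergent2 G"
    by (rule convergent2I[of 1 _ 1]) (auto simp: G_def)
  have "(1 - fps_X) * G = 1"
  proof (rule fps_ext)
    fix j
    show "fps_nth ((1 - fps_X) * G) j = fps_nth 1 j"
      by (cases j) (auto simp: left_diff_distrib G_def)
  qed
  then have "eval_y b ((1 - fps_X) * G) = 1"
    using b0 by simp
  then have "(1 - b) * eval_y b G = 1"
    using b0 by simp
  then show "z * (fps_const (1 / c) * eval_y b G) = 1"
    by (simp add: b_def mult_ac)
  show "conv1 (fps_const (1 / c) * eval_y b G)"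
    by (intro conv1_mult conv1_const conv1_eval_y G b b0)
qed

lemma conv1_divide:
  assumes "conv1 z" "conv1 d" "d \<noteq> 0" "z = 0 \<or> subdegree d \<le> subdegree z"
  obtains w where "conv1 w" "z = d * w" "z \<noteq> 0 \<Longrightarrow> subdegree w = subdegree z - subdegree d"
proof (cases "z = 0")
  case True
  then show ?thesis using that[of 0] convergent2_0 by simp
next
  case False
  define k where "k = subdegree d"
  have shift: "conv1 (fps_shift k x)" if "conv1 x" for x
  proof -
    obtain R where R: "R \<ge> 1" "\<And>i j. norm (fps_nth (fps_nth (fps_const x) j) i) \<le> R ^ (i + j + 1)"
      using \<open>conv1 x\<close> convergent2_altdef by blast
    show ?thesis
    proof (rule convergent2I)
      show "R > 0" using R(1) by simp
      show "norm (fps_nth (fps_nth (fps_const (fps_shift k x)) j) i) \<le> R ^ (k + 1) * R ^ (i + j)" for i j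
        using R(1) R(2)[of 0 "i + k"] by (auto simp: power_add algebra_simps)
    qed
  qed
  have dk: "d = fps_X ^ k * fps_shift k d" and zk: "z = fps_X ^ k * fps_shift k z"
    using assms(4) False fps_shift_times_fps_X_power[of k d] fps_shift_times_fps_X_power[of k z]
    by (auto simp: k_def mult.commute)
  obtain u where u: "conv1 u" "fps_shift k d * u = 1"
    by (rule conv1_inverse[OF shift[OF assms(2)]]) (use assms(3) in \<open>auto simp: k_def\<close>)
  define w where "w = fps_shift k z * u"
  have eq: "z = d * w"
  proof -
    have "d * w = fps_X ^ k * (fps_shift k d * u) * fps_shift k z"
      unfolding w_def by (subst dk) (simp only: mult_ac)
    then show ?thesis
      using zk u(2) by simp
  qed
  moreover have "conv1 w"
    unfolding w_def by (intro conv1_mult shift u assms)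
  moreover have "subdegree w = subdegree z - subdegree d"
    using eq False by auto
  ultimately show ?thesis using that by blast
qed

lemma conv1_if_conv_radius:
  assumes "fps_conv_radius b > 0"
  shows "conv1 b"
proof -
  obtain r :: real where r: "0 < r" "ereal r < fps_conv_radius b"
    using ereal_dense2[OF assms] by (metis ereal_less(2))
  have "summable (\<lambda>i. norm (fps_nth b i * of_real r ^ i))"
    by (rule abs_summable_in_conv_radius) (use r in \<open>auto simp: fps_conv_radius_def\<close>)
  then have "Bseq (\<lambda>i. norm (fps_nth b i * of_real r ^ i))"
    by (intro convergent_imp_Bseq) (auto simp: convergent_def dest: summable_LIMSEQ_zero)
  then obtain M where M: "M > 0" "\<And>i. norm (fps_nth b i) * r ^ i \<le> M"
    using r unfolding Bseq_def by (auto simp: norm_mult norm_power)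
  show ?thesis
  proof (rule convergent2I)
    show "1 / r > 0" using r by simp
    show "norm (fps_nth (fps_nth (fps_const b) j) i) \<le> M * (1 / r) ^ (i + j)" for i j
      using M(1) M(2)[of i] r by (auto simp: field_simps)
  qed
qed

section \<open>Quotient dimensions\<close>

lemma series_simps [simp]:
  "series 0 = 0" "series 1 = 1" "series (f + g) = series f + series g" "series (- f) = - series f"
  "series (f - g) = series f - series g" "series (f * g) = series f * series g"
  "series (const_cps2 c) = fps_const (fps_const c)" "series X_cps2 = fps_const fps_X"
  "series Y_cps2 = fps_X"
  by (transfer; simp)+

lemma series_power [simp]: "series (f ^ k) = series f ^ k"
  by (induction k) auto

lemma series_prod: "series (prod f A) = (\<Prod>x\<in>A. series (f x))"
  by (induction A rule: infinite_finite_induct) auto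

lemma convergent2_series [simp]: "convergent2 (series f)"
  using series[of f] by simp

lemma series_eqI: "series f = series g \<Longrightarrow> f = g"
  by (simp add: series_inject)

lemma cps2_exists: "convergent2 F \<Longrightarrow> \<exists>f. series f = F"
  using Abs_cps2_inverse by blast

interpretation cps2: vector_space "\<lambda>c f. const_cps2 c * f"
  by standard (auto intro!: series_eqI simp: ring_distribs mult.assoc simp flip: fps_const_add fps_const_mult)

lemma quotient_basis_iff:
  assumes I: "cps2.subspace I"
  shows "quotient_basis I B \<longleftrightarrow> finite B \<and> cps2.span (B \<union> I) = UNIV \<and>
    (\<forall>u. (\<Sum>b\<in>B. const_cps2 (u b) * b) \<in> I \<longrightarrow> (\<forall>b\<in>B. u b = 0))"
proof (cases "finite B")
  case fin: True
  have I0: "0 \<in> I" and Idiff: "\<And>x y. x \<in> I \<Longrightarrow> y \<in> I \<Longrightarrow> x - y \<in> I"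
    using I by (auto intro: cps2.subspace_0 cps2.subspace_diff)
  show ?thesis
  proof
    assume "quotient_basis I B"
    then have ex1: "\<exists>!c. c \<in> B \<rightarrow>\<^sub>E UNIV \<and> g - (\<Sum>b\<in>B. const_cps2 (c b) * b) \<in> I" for g
      by (simp add: quotient_basis_def)
    have "g \<in> cps2.span (B \<union> I)" for g
    proof -
      obtain c where c: "g - (\<Sum>b\<in>B. const_cps2 (c b) * b) \<in> I"
        using ex1[of g] by blast
      have "g = (g - (\<Sum>b\<in>B. const_cps2 (c b) * b)) + (\<Sum>b\<in>B. const_cps2 (c b) * b)"
        by simp
      also have "\<dots> \<in> cps2.span (B \<union> I)"
        by (intro cps2.span_add cps2.span_sum cps2.span_scale cps2.span_base) (use c in auto)
      finally show ?thesis .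
    qed
    moreover have "u b = 0" if "(\<Sum>b\<in>B. const_cps2 (u b) * b) \<in> I" "b \<in> B" for u b
    proof -
      \<comment> \<open>Uniqueness is applied to the element 0, which is represented by u and by the
        zero family; \<open>restrict\<close> brings both into the required extensional form.\<close>
      have 1: "0 - (\<Sum>b\<in>B. const_cps2 (restrict u B b) * b) \<in> I"
        using Idiff[OF I0 that(1)] by (simp cong: sum.cong)
      have 2: "0 - (\<Sum>b\<in>B. const_cps2 (restrict (\<lambda>_. 0) B b) * b) \<in> I"
        using I0 by (simp cong: sum.cong )
      have uniq: "c = d" if "c \<in> B \<rightarrow>\<^sub>E UNIV \<and> 0 - (\<Sum>b\<in>B. const_cps2 (c b) * b) \<in> I"
        "d \<in> B \<rightarrow>\<^sub>E UNIV \<and> 0 - (\<Sum>b\<in>B. const_cps2 (d b) * b) \<in> I" for c d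
        using ex1[of 0] that by blast
      have "restrict u B = restrict (\<lambda>_. 0) B"
        by (intro uniq conjI; (fact 1 | fact 2 | simp))
      then show ?thesis
        using that(2) by (metis restrict_apply')
    qed
    ultimately show "finite B \<and> cps2.span (B \<union> I) = UNIV \<and>
        (\<forall>u. (\<Sum>b\<in>B. const_cps2 (u b) * b) \<in> I \<longrightarrow> (\<forall>b\<in>B. u b = 0))"
      using fin by blast
  next
    assume *: "finite B \<and> cps2.span (B \<union> I) = UNIV \<and>
        (\<forall>u. (\<Sum>b\<in>B. const_cps2 (u b) * b) \<in> I \<longrightarrow> (\<forall>b\<in>B. u b = 0))"
    have "\<exists>!c. c \<in> B \<rightarrow>\<^sub>E UNIV \<and> g - (\<Sum>b\<in>B. const_cps2 (c b) * b) \<in> I" for g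
    proof (rule ex_ex1I)
      have "g \<in> cps2.span (B \<union> I)"
        using * by simp
      then obtain x i where xi: "g = x + i" "x \<in> cps2.span B" "i \<in> I"
        using cps2.span_Un[of B I] cps2.span_eq_iff[of I] I by (simp only: mem_Collect_eq) blast
      then obtain u where "x = (\<Sum>b\<in>B. const_cps2 (u b) * b)"
        using cps2.span_finite[OF fin] by auto
      then show "\<exists>c. c \<in> B \<rightarrow>\<^sub>E UNIV \<and> g - (\<Sum>b\<in>B. const_cps2 (c b) * b) \<in> I"
        using xi by (intro exI[of _ "restrict u B"]) (simp cong: sum.cong)
    next
      fix c d
      assume c: "c \<in> B \<rightarrow>\<^sub>E UNIV \<and> g - (\<Sum>b\<in>B. const_cps2 (c b) * b) \<in> I"
        and d: "d \<in> B \<rightarrow>\<^sub>E UNIV \<and> g - (\<Sum>b\<in>B. const_cps2 (d b) * b) \<in> I"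
      have "(\<Sum>b\<in>B. const_cps2 (d b - c b) * b) =
          (g - (\<Sum>b\<in>B. const_cps2 (c b) * b)) - (g - (\<Sum>b\<in>B. const_cps2 (d b) * b))"
        by (simp add: cps2.scale_left_diff_distrib sum_subtractf)
      also have "\<dots> \<in> I"
        using c d Idiff by blast
      finally have "\<forall>b\<in>B. d b - c b = 0"
        using conjunct2[OF conjunct2[OF *], THEN spec, of "\<lambda>b. d b - c b"] by (rule rev_mp)
      then show "c = d"
        using c d by (intro PiE_ext[of c B "\<lambda>_. UNIV" d]) auto
    qed
    then show "quotient_basis I B"
      using fin by (simp add: quotient_basis_def)
  qed
qed (simp add: quotient_basis_def)

text \<open>Each b in B is congruent modulo I to some \<phi> b in the span of B'. The \<phi> b are
  independent, as a relation among them would put a combination of B into I; the exchange lemma then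
  bounds their number by that of B'.\<close>

lemma quotient_basis_card_le:
  assumes I: "cps2.subspace I" and B: "quotient_basis I B" and B': "quotient_basis I B'"
  shows "card B \<le> card B'"
proof -
  have fin: "finite B" "finite B'"
    using B B' by (auto simp: quotient_basis_def)
  have indep: "\<And>u b. (\<Sum>b\<in>B. const_cps2 (u b) * b) \<in> I \<Longrightarrow> b \<in> B \<Longrightarrow> u b = 0"
    using B quotient_basis_iff[OF I] by blast
  have "\<exists>x. x \<in> cps2.span B' \<and> b - x \<in> I" for b
  proof -
    obtain c where "b - (\<Sum>b\<in>B'. const_cps2 (c b) * b) \<in> I"
      using B' unfolding quotient_basis_def by meson
    moreover have "(\<Sum>b\<in>B'. const_cps2 (c b) * b) \<in> cps2.span B'"
      by (intro cps2.span_sum cps2.span_scale cps2.span_base)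
    ultimately show ?thesis by blast
  qed
  then obtain \<phi> where \<phi>: "\<And>b. \<phi> b \<in> cps2.span B'" "\<And>b. b - \<phi> b \<in> I"
    by metis
  have key: "b \<in> B \<Longrightarrow> u b = 0" if "(\<Sum>b\<in>B. const_cps2 (u b) * \<phi> b) = 0" for u b
  proof (rule indep[of u])
    have "(\<Sum>b\<in>B. const_cps2 (u b) * b) = (\<Sum>b\<in>B. const_cps2 (u b) * (b - \<phi> b))"
      using that by (simp add: cps2.scale_right_diff_distrib sum_subtractf)
    also have "\<dots> \<in> I"
      using I \<phi>(2) by (intro cps2.subspace_sum cps2.subspace_scale) auto
    finally show "(\<Sum>b\<in>B. const_cps2 (u b) * b) \<in> I" .
  qed
  have inj: "inj_on \<phi> B"
  proof (rule inj_onI, rule ccontr)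
    fix x y assume xy: "x \<in> B" "y \<in> B" "\<phi> x = \<phi> y" "x \<noteq> y"
    define u :: "cps2 \<Rightarrow> complex" where "u = (\<lambda>b. if b = x then 1 else if b = y then -1 else 0)"
    have "(\<Sum>b\<in>B. const_cps2 (u b) * \<phi> b) = (\<Sum>b\<in>{x, y}. const_cps2 (u b) * \<phi> b)"
      by (rule sum.mono_neutral_right) (use xy fin in \<open>auto simp: u_def\<close>)
    also have "\<dots> = 0"
      using xy by (simp add: u_def)
    finally have "u x = 0"
      using key xy(1) by blast
    then show False by (simp add: u_def)
  qed
  have "\<not> cps2.dependent (\<phi> ` B)"
  proof
    assume "cps2.dependent (\<phi> ` B)"
    then obtain u v where uv: "v \<in> \<phi> ` B" "u v \<noteq> 0" "(\<Sum>v\<in>\<phi> ` B. const_cps2 (u v) * v) = 0"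
      using cps2.dependent_finite[of "\<phi> ` B"] fin by auto
    then have "(\<Sum>b\<in>B. const_cps2 (u (\<phi> b)) * \<phi> b) = 0"
      by (simp add: sum.reindex[OF inj])
    then show False
      using key[of "\<lambda>b. u (\<phi> b)"] uv by auto
  qed
  then have "card (\<phi> ` B) \<le> card B'"
    using cps2.independent_span_bound[OF fin(2)] \<phi>(1) by blast
  then show ?thesis
    by (simp add: card_image[OF inj])
qed

lemma quotient_dim_eq:
  assumes I: "cps2.subspace I" and B: "quotient_basis I B"
  shows "quotient_dim I = enat (card B)"
  unfolding quotient_dim_def
  by (rule antisym) (use quotient_basis_card_le[OF I B] B in \<open>auto intro!: INF_lower INF_greatest\<close>)

text \<open>Below c + k the set S has exactly k more elements than below c, and the part of k + S
  below c + k is the translate of the part of S below c.\<close>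

lemma card_semigroup_diff:
  fixes S :: "nat set"
  assumes add: "\<And>a b. a \<in> S \<Longrightarrow> b \<in> S \<Longrightarrow> a + b \<in> S" and k: "k \<in> S"
    and c: "\<And>m. m \<ge> c \<Longrightarrow> m \<in> S"
  shows "finite (S - (+) k ` S)" "card (S - (+) k ` S) = k"
proof -
  let ?A = "S \<inter> {..<c + k}" and ?C = "S \<inter> {..<c}"
  have eq: "S - (+) k ` S = ?A - (+) k ` ?C"
  proof (intro equalityI subsetI)
    fix x assume x: "x \<in> S - (+) k ` S"
    have "x < c + k"
    proof (rule ccontr)
      assume "\<not> x < c + k"
      then have "x = k + (x - k)" "x - k \<in> S"
        using c by auto
      then show False using x by blast
    qed
    then show "x \<in> ?A - (+) k ` ?C" using x by auto
  qed auto
  have sub: "(+) k ` ?C \<subseteq> ?A"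
    using add k by auto
  show "finite (S - (+) k ` S)"
    unfolding eq by auto
  have "card ?A = card (?C \<union> {c..<c + k})"
    by (rule arg_cong[where f = card]) (use c in auto)
  also have "\<dots> = card ?C + card {c..<c + k}"
    by (rule card_Un_disjoint) auto
  finally have "card ?A = card ?C + k"
    by simp
  then show "card (S - (+) k ` S) = k"
    unfolding eq using sub by (subst card_Diff_subset) (auto simp: card_image)
qed

section \<open>Branches with a Puiseux parametrization\<close>

lemma rot_hom [simp]:
  "rot \<omega> (a + b) = rot \<omega> a + rot \<omega> b" "rot \<omega> (a - b) = rot \<omega> a - rot \<omega> b"
  "rot \<omega> (a * b) = rot \<omega> a * rot \<omega> b" "rot \<omega> 0 = 0" "rot \<omega> 1 = 1"
  by (simp_all add: rot_def fps_compose_add_distrib fps_compose_sub_distrib fps_compose_mult_distrib)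

lemma rot_coeffs_hom [simp]:
  "rot_coeffs \<omega> (G + H) = rot_coeffs \<omega> G + rot_coeffs \<omega> H"
  "rot_coeffs \<omega> (G - H) = rot_coeffs \<omega> G - rot_coeffs \<omega> H"
  "rot_coeffs \<omega> (G * H) = rot_coeffs \<omega> G * rot_coeffs \<omega> H"
  "rot_coeffs \<omega> (fps_const c) = fps_const (rot \<omega> c)" "rot_coeffs \<omega> fps_X = fps_X"
  "rot_coeffs \<omega> (prod f A) = (\<Prod>x\<in>A. rot_coeffs \<omega> (f x))"
  "rot_coeffs \<omega> (sum f A) = (\<Sum>x\<in>A. rot_coeffs \<omega> (f x))"
  by (simp_all add: rot_coeffs_def rot_def compose_coeffs_simps)

lemma rot_coeffs_rot_coeffs: "rot_coeffs \<omega> (rot_coeffs \<zeta> H) = rot_coeffs (\<omega> * \<zeta>) H"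
  by (simp add: fps_eq_iff[of "rot_coeffs _ _"])

lemma eval_y_rot: "fps_nth b 0 = 0 \<Longrightarrow> eval_y (rot \<omega> b) (rot_coeffs \<omega> H) = rot \<omega> (eval_y b H)"
  unfolding rot_def rot_coeffs_def by (rule eval_y_compose) auto

lemma rot_coeffs_ramify: "\<omega> ^ n = 1 \<Longrightarrow> rot_coeffs \<omega> (ramify n H) = ramify n H"
  by (simp add: fps_eq_iff[of "rot_coeffs _ _"] ramify_def rot_compose_X_power)

lemma ramify_hom:
  assumes "n > 0"
  shows "ramify n (G + H) = ramify n G + ramify n H" "ramify n (G - H) = ramify n G - ramify n H"
    "ramify n (G * H) = ramify n G * ramify n H" "ramify n (G ^ k) = ramify n G ^ k"
    "ramify n (fps_const c) = fps_const (fps_compose c (fps_X ^ n))" "ramify n fps_X = fps_X"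
    "ramify n 0 = 0" "ramify n 1 = 1" "ramify n (prod f A) = (\<Prod>x\<in>A. ramify n (f x))"
  using assms compose_coeffs_const[of "fps_X ^ n" 0]
  by (simp_all add: ramify_eq_compose_coeffs compose_coeffs_simps)

lemma ramify_inj: "n > 0 \<Longrightarrow> ramify n G = ramify n H \<Longrightarrow> G = H"
  unfolding ramify_eq_compose_coeffs by (rule inj_compose_coeffs) auto

lemma fps_X_power_compose: "fps_nth a 0 = 0 \<Longrightarrow> fps_compose (fps_X ^ m) a = a ^ m" for a :: "complex fps"
  by (simp flip: fps_compose_power)

lemma ramify_ramify: "m > 0 \<Longrightarrow> n > 0 \<Longrightarrow> ramify m (ramify n H) = ramify (m * n) H"
  by (simp add: ramify_eq_compose_coeffs compose_coeffs_compose fps_X_power_compose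
      flip: power_mult)

lemma ramify_descend:
  assumes n: "n > 0" and conv: "convergent2 Q" and inv: "\<And>\<omega>. \<omega> ^ n = 1 \<Longrightarrow> rot_coeffs \<omega> Q = Q"
  obtains q where "ramify n (series q) = Q"
proof -
  define Q' where "Q' = Abs_fps (\<lambda>j. Abs_fps (\<lambda>m. fps_nth (fps_nth Q j) (n * m)))"
  have eq: "compose_coeffs (fps_X ^ n) Q' = Q"
  proof (rule fps_ext)
    fix j
    have "fps_nth Q j = fps_compose (Abs_fps (\<lambda>m. fps_nth (fps_nth Q j) (n * m))) (fps_X ^ n)"
      using inv by (intro rot_invariant_imp_power[OF n]) (metis rot_coeffs_nth)
    then show "fps_nth (compose_coeffs (fps_X ^ n) Q') j = fps_nth Q j"
      by (simp add: Q'_def)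
  qed
  then have "convergent2 Q'"
    using conv convergent2_extract[of n Q'] n by simp
  then obtain q where "series q = Q'"
    using cps2_exists by blast
  then show thesis
    using that[of q] eq by (simp add: ramify_eq_compose_coeffs)
qed

text \<open>Distinctness of the roots drives the induction: at a new root the factors already split
  off are nonzero, so the remaining quotient must vanish there.\<close>

lemma divide_by_linear_factors:
  assumes "finite S" "inj_on b S" "convergent2 H"
    and "\<And>s. s \<in> S \<Longrightarrow> conv1 (b s)" "\<And>s. s \<in> S \<Longrightarrow> fps_nth (b s) 0 = 0"
    and "\<And>s. s \<in> S \<Longrightarrow> eval_y (b s) H = 0"
  obtains Q where "convergent2 Q" "H = (\<Prod>s\<in>S. fps_X - fps_const (b s)) * Q"
  using assms
proof (induction S arbitrary: thesis)
  case empty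
  then show ?case using empty(1)[of H] by simp
next
  case (insert x S)
  obtain Q where Q: "convergent2 Q" "H = (\<Prod>s\<in>S. fps_X - fps_const (b s)) * Q"
    using insert.IH insert.prems by (metis (no_types, lifting) inj_on_insert insert_iff)
  have x0: "fps_nth (b x) 0 = 0"
    using insert.prems by simp
  have "eval_y (b x) H = (\<Prod>s\<in>S. b x - b s) * eval_y (b x) Q"
    using Q(2) x0 by (simp add: eval_y_prod)
  moreover have "(\<Prod>s\<in>S. b x - b s) \<noteq> 0"
    using insert.hyps insert.prems(2) by auto
  ultimately have "eval_y (b x) Q = 0"
    using insert.prems(6)[of x] by simp
  then have Qq: "Q = (fps_X - fps_const (b x)) * quot_y (b x) Q"
    using eval_y_eq_0_dvd x0 by blast
  have "convergent2 (quot_y (b x) Q)"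
    using Q(1) insert.prems by (intro convergent2_quot_y) auto
  moreover have "H = (\<Prod>s\<in>insert x S. fps_X - fps_const (b s)) * quot_y (b x) Q"
    using Q(2) Qq insert.hyps by (simp add: mult_ac)
  ultimately show ?case
    using insert.prems(1) by blast
qed

lemma convergent2_sum: "(\<And>x. x \<in> A \<Longrightarrow> convergent2 (f x)) \<Longrightarrow> convergent2 (sum f A)"
  by (induction A rule: infinite_finite_induct) (auto intro: convergent2_0 convergent2_add)

lemma convergent2_rot_coeffs:
  assumes "norm \<omega> = 1" "convergent2 H"
  shows "convergent2 (rot_coeffs \<omega> H)"
  by (rule convergent2_dominated[OF assms(2), of 1])
    (use assms(1) in \<open>auto simp: norm_mult norm_power\<close>)

lemma cancel_leading_coefficient:
  fixes f g :: "complex fps"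
  assumes g: "g \<noteq> 0" "subdegree g = d" and f: "\<And>i. i < d \<Longrightarrow> fps_nth f i = 0"
  obtains c where "\<And>i. i < Suc d \<Longrightarrow> fps_nth (f - fps_const c * g) i = 0"
proof -
  have "fps_nth (f - fps_const (fps_nth f d / fps_nth g d) * g) i = 0" if "i < Suc d" for i
    using that g f by (cases "i = d") (auto simp: less_Suc_eq)
  then show thesis using that by blast
qed

text \<open>\<open>conjugates_distinct\<close> is primitivity of the parametrization: it makes the
  linear factors of F pairwise distinct and the denominator of the interpolation nonzero.\<close>

locale puiseux_branch =
  fixes n :: nat and y :: "complex fps" and F :: cps2
  assumes n_pos: "n > 0" and y_conv: "conv1 y" and y_0: "fps_nth y 0 = 0"
    and conjugates_distinct: "\<And>\<omega>. \<omega> ^ n = 1 \<Longrightarrow> \<omega> \<noteq> 1 \<Longrightarrow> rot \<omega> y \<noteq> y"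
    and equation: "ramify n (series F) = (\<Prod>\<omega> | \<omega> ^ n = 1. fps_X - fps_const (rot \<omega> y))"
begin

abbreviation roots :: "complex set" where
  "roots \<equiv> {\<omega>. \<omega> ^ n = 1}"

lemma finite_roots [simp]: "finite roots"
  using n_pos by (intro finite_roots_unity) auto

definition ev :: "cps2 \<Rightarrow> complex fps" where
  "ev h = eval_y y (ramify n (series h))"

lemma ev_simps [simp]:
  "ev 0 = 0" "ev 1 = 1" "ev (f + g) = ev f + ev g" "ev (f - g) = ev f - ev g"
  "ev (f * g) = ev f * ev g" "ev (f ^ k) = ev f ^ k" "ev (const_cps2 c) = fps_const c"
  "ev X_cps2 = fps_X ^ n" "ev Y_cps2 = y"
  using n_pos y_0 by (simp_all add: ev_def ramify_hom)

lemma conv1_ev: "conv1 (ev h)"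
  unfolding ev_def ramify_eq_compose_coeffs
  by (intro conv1_eval_y convergent2_compose_X_power n_pos y_conv y_0) auto

lemma rot_y_0 [simp]: "fps_nth (rot \<omega> y) 0 = 0"
  using y_0 by simp

lemma roots_norm: "\<omega> \<in> roots \<Longrightarrow> norm \<omega> = 1"
  using root_of_unity_norm n_pos by blast

lemma roots_nonzero: "\<omega> \<in> roots \<Longrightarrow> \<omega> \<noteq> 0"
  using n_pos by (auto simp: power_0_left)

lemma inj_on_conjugates: "inj_on (\<lambda>\<omega>. rot \<omega> y) roots"
proof (rule inj_onI, rule ccontr)
  fix \<omega> \<zeta> assume *: "\<omega> \<in> roots" "\<zeta> \<in> roots" "rot \<omega> y = rot \<zeta> y" "\<omega> \<noteq> \<zeta>"
  then have "rot (inverse \<zeta>) (rot \<omega> y) = y"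
    using roots_nonzero by simp
  moreover have "(inverse \<zeta> * \<omega>) ^ n = 1"
    using * by (simp add: power_mult_distrib power_inverse)
  moreover have "inverse \<zeta> * \<omega> \<noteq> 1"
    using * roots_nonzero[of \<zeta>] by (auto simp: field_simps)
  ultimately show False
    using conjugates_distinct by simp
qed

lemma ramify_F_nonzero: "ramify n (series F) \<noteq> 0"
proof -
  have "fps_X - fps_const c \<noteq> 0" for c :: "complex fps"
  proof
    assume "fps_X - fps_const c = 0"
    from arg_cong[OF this, of "\<lambda>F. fps_nth F 1"] show False by simp
  qed
  then show ?thesis
    using equation by simp
qed

lemma ev_F: "ev F = 0"
proof -
  have "ev F = (\<Prod>\<omega>\<in>roots. y - rot \<omega> y)"
    using y_0 by (simp add: ev_def equation eval_y_prod)
  then show ?thesis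
    by (auto intro!: exI[of _ 1])
qed

text \<open>If \<open>h\<close> vanishes on the parametrization, it vanishes on all conjugates of it, so the linear
  factors of \<open>F\<close> can be split off one after the other; the quotient is invariant under
  \<open>t \<mapsto> \<omega>t\<close> and hence a series in \<open>x = t\<^sup>n\<close>.\<close>

lemma ev_eq_0_iff: "ev h = 0 \<longleftrightarrow> F dvd h"
proof
  assume h: "ev h = 0"
  let ?H = "ramify n (series h)"
  have "eval_y (rot \<omega> y) ?H = 0" if "\<omega> \<in> roots" for \<omega>
    using eval_y_rot[OF y_0, of \<omega> ?H] that h by (simp add: rot_coeffs_ramify ev_def)
  moreover have "convergent2 ?H"
    unfolding ramify_eq_compose_coeffs using n_pos by (simp add: convergent2_compose_X_power)
  ultimately obtain Q where Q: "convergent2 Q"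
      "?H = (\<Prod>\<omega>\<in>roots. fps_X - fps_const (rot \<omega> y)) * Q"
    using divide_by_linear_factors[OF finite_roots inj_on_conjugates, of ?H] conv1_rot y_conv roots_norm
    by (metis rot_y_0)
  have HQ: "?H = ramify n (series F) * Q"
    using Q(2) equation by simp
  have "rot_coeffs \<omega> Q = Q" if "\<omega> ^ n = 1" for \<omega>
  proof -
    have "ramify n (series F) * rot_coeffs \<omega> Q = rot_coeffs \<omega> (ramify n (series F) * Q)"
      using that by (simp add: rot_coeffs_ramify)
    also have "\<dots> = ramify n (series F) * Q"
      using that by (simp add: rot_coeffs_ramify flip: HQ)
    finally show ?thesis
      using ramify_F_nonzero by simp
  qed
  then obtain q where q: "ramify n (series q) = Q"
    using ramify_descend[OF n_pos Q(1)] by blast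
  have "ramify n (series h) = ramify n (series (F * q))"
    using HQ q n_pos by (simp add: ramify_hom)
  then have "h = F * q"
    by (rule series_eqI[OF ramify_inj[OF n_pos]])
  then show "F dvd h" by simp
next
  assume "F dvd h"
  then show "ev h = 0"
    by (elim dvdE) (simp add: ev_F)
qed

text \<open>This is \<partial>F/\<partial>Y at (t^n, y(t)), the denominator of Lagrange
  interpolation. Its order bounds the conductor of \<open>orders\<close> from above and need not
  equal it.\<close>

definition conductor_series :: "complex fps" where
  "conductor_series = (\<Prod>\<omega>\<in>roots - {1}. y - rot \<omega> y)"

lemma conductor_series_nonzero: "conductor_series \<noteq> 0"
  unfolding conductor_series_def using conjugates_distinct by (auto simp: eq_commute[of y])

lemma conv1_conductor_series: "conv1 conductor_series"
  unfolding conductor_series_def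
  by (intro conv1_prod conv1_diff conv1_rot y_conv) (use roots_norm in auto)

text \<open>Lagrange interpolation at the conjugates of \<open>y\<close>.\<close>

lemma ev_surj:
  assumes "conv1 z" "z = 0 \<or> subdegree conductor_series \<le> subdegree z"
  obtains a where "ev a = z"
proof -
  obtain w where w: "conv1 w" "z = conductor_series * w"
    using conv1_divide[OF assms(1) conv1_conductor_series conductor_series_nonzero assms(2)] by blast
  \<comment> \<open>W is w times a product that vanishes at all conjugates but y. Its trace R is
    invariant under rotations, hence a series in x, and at y only the summand for \<omega> = 1
    survives.\<close>
  define W where "W = fps_const w * (\<Prod>\<omega>\<in>roots - {1}. fps_X - fps_const (rot \<omega> y))"
  have W: "convergent2 W"
    unfolding W_def
    by (intro convergent2_mult convergent2_prod convergent2_diff convergent2_X w conv1_rot y_conv)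
      (use roots_norm in auto)
  define R where "R = (\<Sum>\<omega>\<in>roots. rot_coeffs \<omega> W)"
  have "convergent2 R"
    unfolding R_def by (intro convergent2_sum convergent2_rot_coeffs W) (use roots_norm in auto)
  moreover have "rot_coeffs \<zeta> R = R" if "\<zeta> ^ n = 1" for \<zeta>
  proof -
    have "\<zeta> \<noteq> 0"
      using roots_nonzero that by blast
    have "rot_coeffs \<zeta> R = (\<Sum>\<omega>\<in>roots. rot_coeffs (\<zeta> * \<omega>) W)"
      by (simp add: R_def rot_coeffs_rot_coeffs)
    also have "\<dots> = (\<Sum>\<omega>\<in>roots. rot_coeffs \<omega> W)"
      by (rule sum.reindex_bij_witness[of _ "\<lambda>\<omega>. inverse \<zeta> * \<omega>" "\<lambda>\<omega>. \<zeta> * \<omega>"])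
        (use that \<open>\<zeta> \<noteq> 0\<close> in \<open>auto simp: power_mult_distrib power_inverse\<close>)
    finally show ?thesis by (simp add: R_def)
  qed
  ultimately obtain a where a: "ramify n (series a) = R"
    using ramify_descend[OF n_pos] by blast
  have zero: "eval_y y (rot_coeffs \<omega> W) = 0" if "\<omega> \<in> roots - {1}" for \<omega>
  proof -
    have \<omega>: "inverse \<omega> \<in> roots - {1}" "\<omega> * inverse \<omega> = 1"
      using that roots_nonzero[of \<omega>] by (auto simp: power_inverse)
    have "eval_y y (rot_coeffs \<omega> W) = rot \<omega> w * (\<Prod>\<zeta>\<in>roots - {1}. y - rot (\<omega> * \<zeta>) y)"
      using y_0 by (simp add: W_def eval_y_prod)
    \<comment> \<open>The factor for \<zeta> = 1/\<omega> is y - y.\<close>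
    also have "\<dots> = 0"
      using \<omega> by (auto intro!: bexI[of _ "inverse \<omega>"] exI[of _ "inverse \<omega>"])
    finally show ?thesis .
  qed
  have "ev a = (\<Sum>\<omega>\<in>roots. eval_y y (rot_coeffs \<omega> W))"
    using y_0 by (simp add: ev_def a R_def eval_y_sum)
  also have "\<dots> = (\<Sum>\<omega>\<in>{1}. eval_y y (rot_coeffs \<omega> W))"
    by (rule sum.mono_neutral_right) (use zero in auto)
  also have "\<dots> = w * conductor_series"
    using y_0 by (simp add: W_def eval_y_prod conductor_series_def)
  finally show thesis
    using that w(2) by (simp add: mult.commute)
qed

text \<open>Evaluation maps into a domain and kills exactly the multiples of F, so F divides one
  factor of any product equal to it; the other factor is then a unit.\<close>

lemma irreducible_F: "irreducible F"
proof (rule irreducibleI)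
  show "F \<noteq> 0"
    using ramify_F_nonzero n_pos by (auto simp: ramify_hom)
  show "\<not> F dvd 1"
    using ev_eq_0_iff[of 1] by simp
  fix a b assume ab: "F = a * b"
  have "c dvd 1" if "F dvd d" "F = c * d" for c d
  proof -
    obtain e where "d = F * e" using \<open>F dvd d\<close> by blast
    then have "F * (c * e) = F * 1"
      using \<open>F = c * d\<close> by (metis mult.assoc mult.commute mult_1_right)
    then have "c * e = 1"
      using \<open>F \<noteq> 0\<close> by (subst (asm) mult_cancel_left) simp
    then show ?thesis by (metis dvd_triv_left)
  qed
  moreover have "ev a = 0 \<or> ev b = 0"
    using ev_F ab by simp
  ultimately show "a dvd 1 \<or> b dvd 1"
    using ab ev_eq_0_iff by (metis mult.commute)
qed

section \<open>Orders along the branch and intersection numbers\<close>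

definition orders :: "nat set" where
  "orders = {subdegree (ev h) | h. ev h \<noteq> 0}"

lemma orders_add: "a \<in> orders \<Longrightarrow> b \<in> orders \<Longrightarrow> a + b \<in> orders"
proof -
  assume "a \<in> orders" "b \<in> orders"
  then obtain g h where "ev g \<noteq> 0" "ev h \<noteq> 0" "a = subdegree (ev g)" "b = subdegree (ev h)"
    by (auto simp: orders_def)
  then have "ev (g * h) \<noteq> 0" "a + b = subdegree (ev (g * h))"
    by auto
  then show "a + b \<in> orders"
    unfolding orders_def by blast
qed

lemma orders_conductor:
  assumes "subdegree conductor_series \<le> m"
  shows "m \<in> orders"
proof -
  obtain a where "ev a = fps_X ^ m"
    using ev_surj[of "fps_X ^ m"] assms conv1_fps_X_power by auto
  then show ?thesis
    unfolding orders_def using fps_X_power_subdegree[of m] by (intro CollectI exI[of _ a]) auto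
qed

lemma n_in_orders: "n \<in> orders"
  unfolding orders_def by (intro CollectI exI[of _ X_cps2]) auto

theorem intersection_number_eq:
  assumes h: "ev h \<noteq> 0"
  shows "intersection_number F h = enat (subdegree (ev h))"
proof -
  define k where "k = subdegree (ev h)"
  define I where "I = {a * F + b * h | a b. True}"
  define S where "S = orders - (+) k ` orders"
  have k: "k \<in> orders"
    using h unfolding orders_def k_def by blast
  have S: "finite S" "card S = k"
    unfolding S_def using card_semigroup_diff[OF orders_add k orders_conductor] by blast+
  have I: "cps2.subspace I"
  proof (rule cps2.subspaceI)
    show "0 \<in> I"
      unfolding I_def by (intro CollectI exI[of _ 0]) auto
    fix x z assume "x \<in> I" "z \<in> I"
    then obtain a b a' b' where "x = a * F + b * h" "z = a' * F + b' * h"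
      by (auto simp: I_def)
    then have "x + z = (a + a') * F + (b + b') * h"
      by (simp add: algebra_simps)
    then show "x + z \<in> I"
      unfolding I_def by blast
  next
    fix c x assume "x \<in> I"
    then obtain a b where "x = a * F + b * h"
      by (auto simp: I_def)
    then have "const_cps2 c * x = (const_cps2 c * a) * F + (const_cps2 c * b) * h"
      by (simp add: algebra_simps)
    then show "const_cps2 c * x \<in> I"
      unfolding I_def by blast
  qed
  have "\<exists>g. m \<in> orders \<longrightarrow> ev g \<noteq> 0 \<and> subdegree (ev g) = m" for m
    by (auto simp: orders_def)
  then obtain G where G: "\<And>m. m \<in> orders \<Longrightarrow> ev (G m) \<noteq> 0" "\<And>m. m \<in> orders \<Longrightarrow> subdegree (ev (G m)) = m"
    by metis
  have inj: "inj_on G S"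
    using G(2) by (intro inj_on_inverseI[of _ "\<lambda>g. subdegree (ev g)"]) (auto simp: S_def)
  let ?V = "cps2.span (G ` S \<union> I)"
  have IV: "I \<subseteq> ?V"
    using cps2.span_superset by blast
  \<comment> \<open>An order in S is cancelled with G, an order k + e with G e * h from the ideal,
    and an order outside \<open>orders\<close> cannot be the order of any x - v.\<close>
  have approx: "\<exists>v\<in>?V. \<forall>i<d. fps_nth (ev (x - v)) i = 0" for x d
  proof (induction d)
    case 0
    show ?case using cps2.span_zero by blast
  next
    case (Suc d)
    then obtain v where v: "v \<in> ?V" "\<And>i. i < d \<Longrightarrow> fps_nth (ev (x - v)) i = 0"
      by blast
    show ?case
    proof (cases "d \<in> orders")
      case False
      then have "ev (x - v) = 0 \<or> subdegree (ev (x - v)) \<noteq> d"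
        unfolding orders_def by blast
      moreover have "ev (x - v) \<noteq> 0 \<Longrightarrow> subdegree (ev (x - v)) \<ge> d"
        using v(2) by (intro subdegree_geI) auto
      ultimately have "fps_nth (ev (x - v)) i = 0" if "i < Suc d" for i
        using that nth_less_subdegree_zero[of i "ev (x - v)"]
        by (cases "ev (x - v) = 0") (auto simp del: ev_simps simp: less_Suc_eq)
      then show ?thesis
        using v(1) by blast
    next
      case True
      have "\<exists>g\<in>?V. ev g \<noteq> 0 \<and> subdegree (ev g) = d"
      proof (cases "d \<in> S")
        case True
        then have "G d \<in> ?V"
          by (intro cps2.span_base) auto
        then show ?thesis using G \<open>d \<in> orders\<close> by blast
      next
        case False
        then obtain e where e: "d = k + e" "e \<in> orders"
          using True by (auto simp: S_def)
        have "G e * h = 0 * F + G e * h" by simp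
        then have "G e * h \<in> ?V"
          using IV unfolding I_def by blast
        moreover have "ev (G e * h) \<noteq> 0" "subdegree (ev (G e * h)) = d"
          using G[OF e(2)] h e(1) by (auto simp: k_def)
        ultimately show ?thesis by blast
      qed
      then obtain g where g: "g \<in> ?V" "ev g \<noteq> 0" "subdegree (ev g) = d"
        by blast
      obtain c where c: "\<And>i. i < Suc d \<Longrightarrow> fps_nth (ev (x - v) - fps_const c * ev g) i = 0"
        using cancel_leading_coefficient[OF g(2,3) v(2)] by blast
      have "ev (x - v) - fps_const c * ev g = ev (x - (v + const_cps2 c * g))"
        by (simp add: algebra_simps)
      moreover have "v + const_cps2 c * g \<in> ?V"
        by (intro cps2.span_add cps2.span_scale v g)
      ultimately show ?thesis
        using c by metis
    qed
  qed
  have "x \<in> ?V" for x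
  proof -
    \<comment> \<open>From this order on, the quotient by ev h still has at least the order of
      \<open>conductor_series\<close> and is therefore a value ev a; so x - v differs from a * h by
      a multiple of F.\<close>
    define d where "d = subdegree conductor_series + k"
    obtain v where v: "v \<in> ?V" "\<And>i. i < d \<Longrightarrow> fps_nth (ev (x - v)) i = 0"
      using approx by blast
    have "ev (x - v) = 0 \<or> d \<le> subdegree (ev (x - v))"
      using v(2) by (metis subdegree_geI)
    then have "ev (x - v) = 0 \<or> k \<le> subdegree (ev (x - v))"
      by (auto simp: d_def)
    then obtain w where w: "conv1 w" "ev (x - v) = ev h * w"
        "ev (x - v) \<noteq> 0 \<Longrightarrow> subdegree w = subdegree (ev (x - v)) - k"
      using conv1_divide[OF conv1_ev conv1_ev h] unfolding k_def by metis
    have "w = 0 \<or> subdegree conductor_series \<le> subdegree w"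
    proof (cases "ev (x - v) = 0")
      case True
      then show ?thesis using w(2) h by simp
    next
      case False
      then show ?thesis
        using w(3) \<open>ev (x - v) = 0 \<or> d \<le> subdegree (ev (x - v))\<close> by (auto simp: d_def)
    qed
    then obtain a where a: "ev a = w"
      using ev_surj[OF w(1)] by blast
    have "ev (x - v - a * h) = 0"
      using w(2) a by (simp add: mult.commute)
    then obtain b where "x - v - a * h = F * b"
      using ev_eq_0_iff by blast
    then have x: "x = v + (b * F + a * h)"
      by (simp add: algebra_simps)
    have "b * F + a * h \<in> I"
      unfolding I_def by blast
    then have "b * F + a * h \<in> ?V"
      using IV by blast
    then show ?thesis
      unfolding x by (rule cps2.span_add[OF v(1)])
  qed
  moreover have "\<forall>b\<in>G ` S. u b = 0" if u: "(\<Sum>b\<in>G ` S. const_cps2 (u b) * b) \<in> I" for u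
  proof (rule ccontr)
    assume "\<not> (\<forall>b\<in>G ` S. u b = 0)"
    then have ex: "\<exists>m. m \<in> S \<and> u (G m) \<noteq> 0"
      by blast
    \<comment> \<open>The G m have distinct orders, so the combination has order exactly d. As an
      element of the ideal it also has an order in k + \<open>orders\<close>, which S
      excludes.\<close>
    define d where "d = (LEAST m. m \<in> S \<and> u (G m) \<noteq> 0)"
    have d: "d \<in> S" "u (G d) \<noteq> 0"
      using LeastI_ex[OF ex] by (auto simp: d_def)
    have least: "u (G m) = 0" if "m \<in> S" "m < d" for m
      using not_less_Least[of m "\<lambda>m. m \<in> S \<and> u (G m) \<noteq> 0"] that by (auto simp: d_def)
    obtain a b where "(\<Sum>b\<in>G ` S. const_cps2 (u b) * b) = a * F + b * h"
      using u by (auto simp: I_def)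
    then have "ev (\<Sum>m\<in>S. const_cps2 (u (G m)) * G m) = ev (a * F + b * h)"
      by (simp add: sum.reindex[OF inj])
    moreover have "ev (sum f A) = (\<Sum>x\<in>A. ev (f x))" for f and A :: "nat set"
      by (induction A rule: infinite_finite_induct) auto
    ultimately have eq: "(\<Sum>m\<in>S. fps_const (u (G m)) * ev (G m)) = ev b * ev h"
      by (simp add: ev_F)
    have nth: "fps_nth (ev b * ev h) i = (\<Sum>m\<in>S. u (G m) * fps_nth (ev (G m)) i)" for i
      by (simp flip: eq add: fps_sum_nth)
    have "fps_nth (ev b * ev h) d = (\<Sum>m\<in>{d}. u (G m) * fps_nth (ev (G m)) d)"
      unfolding nth
    proof (rule sum.mono_neutral_right)
      show "\<forall>m\<in>S - {d}. u (G m) * fps_nth (ev (G m)) d = 0"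
      proof
        fix m assume m: "m \<in> S - {d}"
        show "u (G m) * fps_nth (ev (G m)) d = 0"
        proof (cases "m < d")
          case True
          then show ?thesis using least m by simp
        next
          case False
          then have "d < subdegree (ev (G m))"
            using m G(2)[of m] by (auto simp: S_def)
          from nth_less_subdegree_zero[OF this] show ?thesis by simp
        qed
      qed
    qed (use S d in auto)
    also have "\<dots> \<noteq> 0"
    proof -
      have "d \<in> orders" using d(1) by (simp add: S_def)
      then show ?thesis
        using d(2) G[of d] by (metis finite.emptyI mult_eq_0_iff nth_subdegree_nonzero sum.empty
            sum.insert add_0_right empty_iff)
    qed
    finally have nz: "fps_nth (ev b * ev h) d \<noteq> 0" .
    have "subdegree (ev b * ev h) = d"
    proof (rule subdegreeI[OF nz])
      fix i assume "i < d"
      show "fps_nth (ev b * ev h) i = 0"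
        unfolding nth
      proof (rule sum.neutral, rule ballI)
        fix m assume m: "m \<in> S"
        show "u (G m) * fps_nth (ev (G m)) i = 0"
        proof (cases "m < d")
          case True
          then show ?thesis using least[OF m] by simp
        next
          case False
          then have "i < subdegree (ev (G m))"
            using m \<open>i < d\<close> G(2)[of m] by (auto simp: S_def)
          from nth_less_subdegree_zero[OF this] show ?thesis by simp
        qed
      qed
    qed
    moreover have "ev b \<noteq> 0"
      using nz by auto
    ultimately have "d = k + subdegree (ev b)" "subdegree (ev b) \<in> orders"
      using h unfolding orders_def k_def by auto
    then show False
      using d(1) by (auto simp: S_def)
  qed
  ultimately have "quotient_basis I (G ` S)"
    using quotient_basis_iff[OF I, of "G ` S"] S(1) by blast
  then show ?thesis
    unfolding intersection_number_def I_def[symmetric]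
    using quotient_dim_eq[OF I] S(2) by (simp add: card_image[OF inj] k_def)
qed

lemma value_semigroup_eq: "value_semigroup F = orders"
proof (intro equalityI subsetI)
  fix m assume "m \<in> value_semigroup F"
  then obtain h where "ev h \<noteq> 0" "intersection_number F h = enat m"
    using ev_eq_0_iff by (auto simp: value_semigroup_def)
  then show "m \<in> orders"
    using intersection_number_eq[of h] by (auto simp: orders_def)
next
  fix m assume "m \<in> orders"
  then obtain h where "ev h \<noteq> 0" "m = subdegree (ev h)"
    by (auto simp: orders_def)
  then show "m \<in> value_semigroup F"
    using intersection_number_eq[of h] ev_eq_0_iff[of h] unfolding value_semigroup_def by auto
qed

end

section \<open>Smooth branches\<close>

lemma puiseux_branch_smooth:
  assumes "conv1 w" "fps_nth w 0 = 0" "series B = fps_X - fps_const w"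
  shows "puiseux_branch 1 w B"
proof
  show "ramify 1 (series B) = (\<Prod>\<omega> | \<omega> ^ 1 = 1. fps_X - fps_const (rot \<omega> w))"
    using assms by (simp add: ramify_eq_compose_coeffs fps_eq_iff[of "compose_coeffs _ _"])
qed (use assms in auto)

lemma (in puiseux_branch) orders_smooth:
  assumes "n = 1"
  shows "orders = UNIV"
proof -
  have "ev (X_cps2 ^ m) = fps_X ^ m" for m
  proof -
    have "ev (X_cps2 ^ m) = (fps_X ^ n) ^ m" by simp
    then show ?thesis unfolding assms by simp
  qed
  then show ?thesis
    unfolding orders_def by (metis (mono_tags, lifting) UNIV_eq_I fps_X_power_subdegree
        mem_Collect_eq power_not_zero fps_X_neq_zero)
qed

lemma (in puiseux_branch) ev_graph:
  assumes "n = 1" "series B = fps_X - fps_const w"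
  shows "ev B = y - w"
proof -
  have "ev B = y - fps_compose w (fps_X ^ n)"
    using n_pos y_0 by (simp add: ev_def assms(2) ramify_hom)
  then show ?thesis
    unfolding assms(1) by simp
qed

lemma smooth_branch_graph:
  assumes w: "conv1 w" "fps_nth w 0 = 0" and B: "series B = fps_X - fps_const w"
  shows "smooth_branch B" "value_semigroup B = UNIV"
proof -
  interpret puiseux_branch 1 w B
    using puiseux_branch_smooth assms by blast
  have "order2 B = 1"
    unfolding order2_def
  proof (rule Least_equality)
    show "\<exists>i j. i + j = 1 \<and> coeff2 B i j \<noteq> 0"
      by (rule exI[of _ 0], rule exI[of _ 1]) (simp add: coeff2_def B)
    fix k assume "\<exists>i j. i + j = k \<and> coeff2 B i j \<noteq> 0"
    then show "1 \<le> k"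
      using w(2) by (cases k) (auto simp: coeff2_def B)
  qed
  then show "smooth_branch B"
    by (simp add: smooth_branch_def plane_branch_def irreducible_F)
  show "value_semigroup B = UNIV"
    using value_semigroup_eq orders_smooth by simp
qed

lemma intersection_number_graphs:
  assumes "conv1 v" "fps_nth v 0 = 0" "series A = fps_X - fps_const v"
    and "series B = fps_X - fps_const w" and "v \<noteq> w"
  shows "intersection_number A B = enat (subdegree (v - w))"
proof -
  interpret puiseux_branch 1 v A
    using puiseux_branch_smooth assms by blast
  have "ev B = v - w"
    using ev_graph assms(4) by blast
  then show ?thesis
    using intersection_number_eq[of B] assms(5) by auto
qed

section \<open>Cubic branches\<close>

lemma root_of_unity_coprime:
  fixes \<omega> :: complex
  assumes "\<omega> ^ 3 = 1" "\<omega> ^ M = 1" "\<not> 3 dvd M"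
  shows "\<omega> = 1"
proof -
  have "M = 3 * (M div 3) + M mod 3"
    by simp
  then have "\<omega> ^ M = (\<omega> ^ 3) ^ (M div 3) * \<omega> ^ (M mod 3)"
    by (metis power_add power_mult)
  then have *: "\<omega> ^ (M mod 3) = 1"
    using assms by simp
  have "M mod 3 = 1 \<or> M mod 3 = 2"
    using assms(3) by presburger
  then show ?thesis
  proof
    assume "M mod 3 = 1"
    then show ?thesis using * by simp
  next
    assume "M mod 3 = 2"
    then have "\<omega> ^ 2 = 1" using * by simp
    then show ?thesis
      using assms(1) by (simp add: power3_eq_cube power2_eq_square)
  qed
qed

lemma additive_span_add:
  assumes "a \<in> additive_span A" "b \<in> additive_span A"
  shows "a + b \<in> additive_span A"
  using assms by induction (auto simp: add.assoc intro: additive_span.add)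

lemma additive_span_mult: "a \<in> A \<Longrightarrow> k * a \<in> additive_span A"
  by (induction k) (auto intro: additive_span.intros)

lemma additive_span_singleton: "k \<in> additive_span {a} \<Longrightarrow> a dvd k"
  by (induction rule: additive_span.induct) auto

text \<open>All \<open>k \<ge> 2M\<close> lie in \<open>\<langle>3, M\<rangle>\<close>, so an order outside of it is already determined by the
  expansion of \<open>h\<close> around \<open>v = \<rho>(u)\<close> up to the linear term.\<close>

lemma (in puiseux_branch) cubic_orders:
  assumes n: "n = 3" and M: "\<not> 3 dvd M"
    and low: "\<And>i. i < M \<Longrightarrow> fps_nth y i = fps_nth (fps_compose \<rho> (fps_X ^ 3)) i"
    and nz: "fps_nth y M \<noteq> 0"
  shows "orders = additive_span {3, M}"
proof (intro equalityI subsetI)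
  \<comment> \<open>Cut off at M, \<rho> becomes a polynomial and hence convergent. Substituting t^3
    produces no term of degree M, as 3 does not divide M, so the difference u from y has order
    exactly M.\<close>
  define b where "b = fps_cutoff M \<rho>"
  define u where "u = y - fps_compose b (fps_X ^ 3)"
  have M0: "M > 0"
    using M by (cases M) auto
  have b0: "fps_nth b 0 = 0"
    using low[OF M0] y_0 M0 by (simp add: b_def)
  have uM: "fps_nth u M = fps_nth y M"
    using M by (simp add: u_def fps_nth_compose_X_power)
  have ulow: "fps_nth u i = 0" if "i < M" for i
    using low[OF that] that by (auto simp: u_def b_def fps_nth_compose_X_power)
  have u: "u \<noteq> 0" "subdegree u = M"
    using uM nz ulow by (auto intro!: subdegreeI)
  {
    fix k assume "k \<in> additive_span {3, M}"
    then show "k \<in> orders"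
    proof induction
      case zero
      show ?case unfolding orders_def by (intro CollectI exI[of _ 1]) auto
    next
      case (add a m)
      obtain B where B: "series B = fps_const b"
        using cps2_exists[OF conv1_cutoff] unfolding b_def by blast
      have "ev (Y_cps2 - B) = y - fps_compose b (fps_X ^ n)"
        using n_pos y_0 by (simp add: ev_def B ramify_hom)
      then have "ev (Y_cps2 - B) = u"
        by (simp only: n u_def)
      then have "M \<in> orders"
        unfolding orders_def using u by (intro CollectI exI[of _ "Y_cps2 - B"]) auto
      then have "a \<in> orders"
        using add n_in_orders n by auto
      then show ?case using add orders_add by blast
    qed
  }
  {
    fix k assume "k \<in> orders"
    then obtain h where h: "ev h \<noteq> 0" "k = subdegree (ev h)"
      by (auto simp: orders_def)
    show "k \<in> additive_span {3, M}"
    proof (rule ccontr)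
      assume k: "k \<notin> additive_span {3, M}"
      have span: "3 * a + M * c \<in> additive_span {3, M}" for a c
        using additive_span_add[OF additive_span_mult[of 3 "{3, M}" a] additive_span_mult[of M "{3, M}" c]]
        by (simp add: mult.commute)
      have k3: "\<not> 3 dvd k"
        using k span[of _ 0] by auto
      have k2M: "k < 2 * M"
      proof (rule ccontr)
        assume "\<not> k < 2 * M"
        \<comment> \<open>M is invertible modulo 3, so k is congruent to 0, M or 2 M, and each of
          these is at most k.\<close>
        then have "\<exists>a. k = 3 * a \<or> k = 3 * a + M \<or> k = 3 * a + 2 * M"
          using M by presburger
        then show False
          using k span[of _ 0] span[of _ 1] span[of _ 2] by (auto simp: mult.commute)
      qed
      define Q where "Q = quot_y b (series h)"
      define R where "R = quot_y b Q"
      define g where "g = eval_y b (series h)"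
      define q where "q = eval_y b Q"
      have Q: "series h = (fps_X - fps_const b) * Q + fps_const g"
        unfolding Q_def g_def by (rule eval_y_division[OF b0])
      have R: "Q = (fps_X - fps_const b) * R + fps_const q"
        unfolding R_def q_def by (rule eval_y_division[OF b0])
      define g' where "g' = fps_compose g (fps_X ^ 3)"
      define q' where "q' = fps_compose q (fps_X ^ 3)"
      have "ev h = u * (u * eval_y y (ramify 3 R) + q') + g'"
        unfolding ev_def unfolding n Q by (subst R) (use y_0 in \<open>simp add: ramify_hom u_def g'_def q'_def\<close>)
      then have evh: "ev h = u ^ 2 * eval_y y (ramify 3 R) + u * q' + g'"
        by (simp add: algebra_simps power2_eq_square)
      \<comment> \<open>The part with u^2 starts in order at least 2 M, and g' has only exponents
        divisible by 3. In the remaining degrees u q' decides, and its order M + 3 ord q lies in the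
        span.\<close>
      have nth: "fps_nth (ev h) i = fps_nth (u * q') i" if "\<not> 3 dvd i" "i < 2 * M" for i
      proof -
        have "fps_nth (u ^ 2 * eval_y y (ramify 3 R)) i = 0"
        proof (cases "u ^ 2 * eval_y y (ramify 3 R) = 0")
          case False
          then have "i < subdegree (u ^ 2 * eval_y y (ramify 3 R))"
            using that(2) u by simp
          then show ?thesis by (rule nth_less_subdegree_zero)
        qed (simp only: fps_zero_nth)
        moreover have "fps_nth g' i = 0"
          using that(1) by (simp add: g'_def fps_nth_compose_X_power)
        ultimately show ?thesis
          by (simp add: evh)
      qed
      have "fps_nth (u * q') k \<noteq> 0"
        using nth[OF k3 k2M] h nth_subdegree_nonzero[of "ev h"] by simp
      then have q'0: "u * q' \<noteq> 0" by auto
      then have sub: "subdegree (u * q') = M + 3 * subdegree q"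
        using u by (simp add: q'_def)
      have le: "M + 3 * subdegree q \<le> k"
        using \<open>fps_nth (u * q') k \<noteq> 0\<close> sub by (metis subdegree_leI)
      have neq: "M + 3 * subdegree q \<noteq> k"
        using span[of "subdegree q" 1] k by (auto simp: add.commute)
      have "\<not> 3 dvd M + 3 * subdegree q"
        using M by presburger
      then have "fps_nth (ev h) (M + 3 * subdegree q) = fps_nth (u * q') (M + 3 * subdegree q)"
        using nth le k2M by simp
      also have "\<dots> \<noteq> 0"
        using nth_subdegree_nonzero[OF q'0] sub by simp
      finally have "k \<le> M + 3 * subdegree q"
        unfolding h(2) by (rule subdegree_leI)
      then show False using le neq by simp
    qed
  }
qed

section \<open>Products of three factors with prescribed contact\<close>

text \<open>The order \<open>e\<close> in \<open>t\<close> is \<open>M/3\<close> in \<open>u = t\<^sup>N\<close>.\<close>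

locale three_roots =
  fixes D :: cps2 and N e M :: nat and z :: "nat \<Rightarrow> complex fps" and \<rho> :: "complex fps"
    and c :: "nat \<Rightarrow> complex"
  assumes N_pos: "N > 0" and eM: "3 * e = N * M" and M3: "M > 3"
    and z_conv: "\<And>j. j \<in> {1..3} \<Longrightarrow> conv1 (z j)" and z_0: "\<And>j. j \<in> {1..3} \<Longrightarrow> fps_nth (z j) 0 = 0"
    and D_eq: "ramify N (series D) = (\<Prod>j\<in>{1..3}. fps_X - fps_const (z j))"
    and z_low: "\<And>j m. j \<in> {1..3} \<Longrightarrow> m < e \<Longrightarrow> fps_nth (z j) m = fps_nth (fps_compose \<rho> (fps_X ^ N)) m"
    and z_e: "\<And>j. j \<in> {1..3} \<Longrightarrow> fps_nth (z j) e = fps_nth (fps_compose \<rho> (fps_X ^ N)) e + c j"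
    and c_inj: "inj_on c {1..3}" and c_nz: "\<And>j. j \<in> {1..3} \<Longrightarrow> c j \<noteq> 0"
begin

lemma z_e_inj: "j \<in> {1..3} \<Longrightarrow> k \<in> {1..3} \<Longrightarrow> fps_nth (z j) e = fps_nth (z k) e \<Longrightarrow> j = k"
  using z_e[of j] z_e[of k] c_inj by (auto dest: inj_onD)

lemma rot_root:
  assumes "\<xi> ^ N = 1" "j \<in> {1..3}"
  obtains k where "k \<in> {1..3}" "rot \<xi> (z j) = z k"
proof -
  have "eval_y (z j) (ramify N (series D)) = 0"
    using z_0[OF assms(2)] assms(2) by (auto simp: D_eq eval_y_prod)
  then have "eval_y (rot \<xi> (z j)) (ramify N (series D)) = 0"
    using eval_y_rot[OF z_0[OF assms(2)], of \<xi> "ramify N (series D)"] assms(1)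
    by (simp add: rot_coeffs_ramify)
  then have "(\<Prod>k\<in>{1..3}. rot \<xi> (z j) - z k) = 0"
    using z_0[OF assms(2)] by (simp add: D_eq eval_y_prod)
  then show thesis
    using that by auto
qed

text \<open>A rotation by an N-th root of unity sends a root to a root, and the coefficient in
  degree e separates the roots. As d divides both N and e, rotations by d-th roots of unity preserve
  this coefficient and so fix every root.\<close>

lemma z_descend:
  assumes d: "d > 0" "d dvd N" "d dvd e" and j: "j \<in> {1..3}"
  obtains w where "z j = fps_compose w (fps_X ^ d)" "conv1 w" "fps_nth w 0 = 0"
proof -
  have "rot \<xi> (z j) = z j" if "\<xi> ^ d = 1" for \<xi>
  proof -
    have "\<xi> ^ N = 1" "\<xi> ^ e = 1"
      using d that by (auto simp: power_mult)
    obtain k where k: "k \<in> {1..3}" "rot \<xi> (z j) = z k"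
      using rot_root[OF \<open>\<xi> ^ N = 1\<close> j] by blast
    have "fps_nth (z j) e = fps_nth (z k) e"
      using \<open>\<xi> ^ e = 1\<close> arg_cong[OF k(2), of "\<lambda>f. fps_nth f e"] by simp
    then show ?thesis
      using z_e_inj[OF j k(1)] k(2) by simp
  qed
  then obtain w where w: "z j = fps_compose w (fps_X ^ d)"
    using rot_invariant_imp_power[OF d(1)] by blast
  moreover have "conv1 w"
    using z_conv[OF j] conv1_compose_X_power[OF d(1)] w by simp
  moreover have "fps_nth w 0 = 0"
    using z_0[OF j] w d(1) by (simp add: fps_nth_compose_X_power)
  ultimately show thesis using that by blast
qed

text \<open>Here e = N (M/3) is a multiple of N, so all roots descend to series in u, and their
  contact e in t becomes M/3 in u.\<close>

lemma split_case:
  assumes "3 dvd M"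
  obtains B where "D = (\<Prod>l\<in>{1..3::nat}. B l)" "\<And>l. l \<in> {1..3} \<Longrightarrow> smooth_branch (B l)"
    "\<And>l. l \<in> {1..3} \<Longrightarrow> value_semigroup (B l) = UNIV"
    "\<And>l r. l \<in> {1..3} \<Longrightarrow> r \<in> {1..3} \<Longrightarrow> l \<noteq> r \<Longrightarrow> intersection_number (B l) (B r) = enat (M div 3)"
proof -
  have e: "e = N * (M div 3)"
    using eM assms by auto
  have "\<exists>w. j \<in> {1..3} \<longrightarrow> z j = fps_compose w (fps_X ^ N) \<and> conv1 w \<and> fps_nth w 0 = 0" for j
    using z_descend[of N j] N_pos e by (metis dvd_refl dvd_triv_left)
  then obtain w where w: "\<And>j. j \<in> {1..3} \<Longrightarrow> z j = fps_compose (w j) (fps_X ^ N)"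
      "\<And>j. j \<in> {1..3} \<Longrightarrow> conv1 (w j)" "\<And>j. j \<in> {1..3} \<Longrightarrow> fps_nth (w j) 0 = 0"
    by metis
  have "\<exists>B. j \<in> {1..3} \<longrightarrow> series B = fps_X - fps_const (w j)" for j
    using w(2) cps2_exists convergent2_diff convergent2_X by metis
  then obtain B where B: "\<And>j. j \<in> {1..3} \<Longrightarrow> series (B j) = fps_X - fps_const (w j)"
    by metis
  show thesis
  proof
    have "ramify N (series (\<Prod>l\<in>{1..3}. B l)) = (\<Prod>l\<in>{1..3}. ramify N (series (B l)))"
      using N_pos by (simp add: series_prod ramify_hom)
    also have "\<dots> = ramify N (series D)"
      unfolding D_eq by (rule prod.cong) (use N_pos B w(1) in \<open>auto simp: ramify_hom\<close>)
    finally have "ramify N (series D) = ramify N (series (\<Prod>l\<in>{1..3}. B l))"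
      by (rule sym)
    then show "D = (\<Prod>l\<in>{1..3}. B l)"
      by (rule series_eqI[OF ramify_inj[OF N_pos]])
    show "smooth_branch (B l)" "value_semigroup (B l) = UNIV" if "l \<in> {1..3}" for l
      using smooth_branch_graph[of "w l" "B l"] w B that by auto
    fix l r :: nat assume lr: "l \<in> {1..3}" "r \<in> {1..3}" "l \<noteq> r"
    have comp: "fps_compose (w l - w r) (fps_X ^ N) = z l - z r"
      using w(1) lr by (simp add: fps_compose_sub_distrib)
    have "fps_nth (z l - z r) e \<noteq> 0"
      using z_e_inj[OF lr(1,2)] lr(3) by auto
    then have "subdegree (z l - z r) = e"
      using z_low lr by (intro subdegreeI) auto
    then have "subdegree (w l - w r) * N = e"
      using N_pos by (simp flip: comp)
    then have "subdegree (w l - w r) = M div 3"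
      using e N_pos by simp
    moreover have "w l \<noteq> w r"
      using \<open>fps_nth (z l - z r) e \<noteq> 0\<close> comp by auto
    ultimately show "intersection_number (B l) (B r) = enat (M div 3)"
      using intersection_number_graphs[of "w l" "B l" "B r" "w r"] w B lr by simp
  qed
qed

text \<open>Now 3 e = N M forces 3 to divide N. With N = 3 d and e = d M one root descends to a
  series w in the cube root of u. Its term of degree M is moved by each nontrivial cube root of
  unity, so the three conjugates of w are distinct and exhaust the roots.\<close>

lemma irreducible_case:
  assumes M: "\<not> 3 dvd M"
  shows "plane_branch D" "minimally_generated (value_semigroup D) [3, M]"
proof -
  have "3 dvd N * M"
    using eM by (metis dvd_triv_left)
  then have "3 dvd N"
    using M prime_dvd_mult_iff[of 3 N M] by simp
  then obtain d where N: "N = 3 * d" by blast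
  have d: "d > 0" using N N_pos by simp
  have e: "e = d * M"
    using eM N by simp
  have one: "1 \<in> {1..3::nat}" by simp
  obtain w where w: "z 1 = fps_compose w (fps_X ^ d)" "conv1 w" "fps_nth w 0 = 0"
    using z_descend[of d 1] d N e by auto
  have w_nth: "fps_nth w i = fps_nth (z 1) (d * i)" for i
    unfolding w(1) using d by (simp add: fps_nth_compose_X_power)
  \<comment> \<open>The series \<rho> contributes nothing in degree e = d M, since this is not a
    multiple of N = 3 d.\<close>
  have wM: "fps_nth w M = c 1"
    using z_e[OF one] e N M N_pos by (simp add: w_nth fps_nth_compose_X_power)
  have c1: "c 1 \<noteq> 0"
    using c_nz one by blast
  have M_inj: "\<omega> = \<zeta>" if "\<omega> ^ 3 = 1" "\<zeta> ^ 3 = 1" "rot \<omega> w = rot \<zeta> w" for \<omega> \<zeta>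
  proof -
    have \<zeta>: "\<zeta> \<noteq> 0" using that by auto
    have "\<omega> ^ M = \<zeta> ^ M"
      using arg_cong[OF that(3), of "\<lambda>f. fps_nth f M"] wM c1 by simp
    then have "(\<omega> / \<zeta>) ^ M = 1" "(\<omega> / \<zeta>) ^ 3 = 1"
      using that \<zeta> by (auto simp: power_divide)
    then have "\<omega> / \<zeta> = 1"
      using root_of_unity_coprime M by blast
    then show ?thesis using \<zeta> by simp
  qed
  have "\<exists>k. k \<in> {1..3} \<and> fps_compose (rot \<omega> w) (fps_X ^ d) = z k" if "\<omega> ^ 3 = 1" for \<omega>
  proof -
    \<comment> \<open>A d-th root \<xi> of \<omega> lifts the rotation of the cube root of u to a
      rotation of t.\<close>
    obtain \<xi> where \<xi>: "\<xi> ^ d = \<omega>"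
      using exists_complex_root[of d \<omega>] d by auto
    have "\<xi> ^ N = 1"
      using that \<xi> by (simp add: N mult.commute[of 3] power_mult)
    then obtain k where "k \<in> {1..3}" "rot \<xi> (z 1) = z k"
      using rot_root[OF _ one] by blast
    then show ?thesis
      using rot_compose_X_power[OF \<xi>] w(1) by auto
  qed
  then obtain \<kappa> where \<kappa>: "\<And>\<omega>. \<omega> ^ 3 = 1 \<Longrightarrow> \<kappa> \<omega> \<in> {1..3}"
      "\<And>\<omega>. \<omega> ^ 3 = 1 \<Longrightarrow> fps_compose (rot \<omega> w) (fps_X ^ d) = z (\<kappa> \<omega>)"
    by metis
  let ?R = "{\<omega>::complex. \<omega> ^ 3 = 1}"
  have inj: "inj_on \<kappa> ?R"
  proof (rule inj_onI)
    fix \<omega> \<zeta> assume *: "\<omega> \<in> ?R" "\<zeta> \<in> ?R" "\<kappa> \<omega> = \<kappa> \<zeta>"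
    then have "fps_compose (rot \<omega> w) (fps_X ^ d) = fps_compose (rot \<zeta> w) (fps_X ^ d)"
      using \<kappa>(2) by simp
    then have "rot \<omega> w = rot \<zeta> w"
      by (rule inj_compose[rotated 2]) (use d in auto)
    then show "\<omega> = \<zeta>"
      using * M_inj by simp
  qed
  have "card (\<kappa> ` ?R) = 3"
    using card_image[OF inj] card_roots_unity_eq[of 3] by simp
  then have "\<kappa> ` ?R = {1..3}"
    using \<kappa>(1) by (intro card_subset_eq) auto
  then have bij: "bij_betw \<kappa> ?R {1..3}"
    using inj by (simp add: bij_betw_def)
  have "ramify d (ramify 3 (series D)) = (\<Prod>j\<in>{1..3}. fps_X - fps_const (z j))"
    using D_eq d by (simp add: ramify_ramify N mult.commute)
  also have "\<dots> = (\<Prod>\<omega>\<in>?R. fps_X - fps_const (z (\<kappa> \<omega>)))"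
    by (rule prod.reindex_bij_betw[OF bij, symmetric])
  also have "\<dots> = (\<Prod>\<omega>\<in>?R. ramify d (fps_X - fps_const (rot \<omega> w)))"
    by (rule prod.cong) (use d \<kappa>(2) in \<open>auto simp: ramify_hom\<close>)
  also have "\<dots> = ramify d (\<Prod>\<omega>\<in>?R. fps_X - fps_const (rot \<omega> w))"
    using d by (simp add: ramify_hom)
  finally have eq: "ramify 3 (series D) = (\<Prod>\<omega>\<in>?R. fps_X - fps_const (rot \<omega> w))"
    by (rule ramify_inj[OF d])
  interpret puiseux_branch 3 w D
  proof
    show "rot \<omega> w \<noteq> w" if "\<omega> ^ 3 = 1" "\<omega> \<noteq> 1" for \<omega>
      using M_inj[OF that(1), of 1] that(2) by auto
  qed (use w eq in auto)
  show "plane_branch D"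
    by (simp add: plane_branch_def irreducible_F)
  have "orders = additive_span {3, M}"
  proof (rule cubic_orders[where \<rho> = \<rho>])
    fix i assume i: "i < M"
    then have "fps_nth w i = fps_nth (fps_compose \<rho> (fps_X ^ N)) (d * i)"
      using z_low[OF one] d by (simp add: w_nth e)
    also have "\<dots> = fps_nth (fps_compose \<rho> (fps_X ^ 3)) i"
      using d by (simp add: fps_nth_compose_X_power N mult.commute[of 3])
    finally show "fps_nth w i = fps_nth (fps_compose \<rho> (fps_X ^ 3)) i" .
  qed (use M wM c1 in auto)
  moreover have "3 \<notin> additive_span {M}"
    using M3 additive_span_singleton[of 3 M] dvd_imp_le[of M 3] by auto
  moreover have "M \<notin> additive_span {3}"
    using M additive_span_singleton[of M 3] by auto
  moreover have "{3, M} - {3} = {M}" "{3, M} - {M} = {3}"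
    using M3 by auto
  ultimately show "minimally_generated (value_semigroup D) [3, M]"
    using M3 by (simp add: minimally_generated_def value_semigroup_eq)
qed

end

section \<open>Degenerate Newton polygons\<close>

text \<open>The polygon lies in i + s j \<ge> 3 s and meets the boundary line in the segment from
  (0, 3) to (3 s, 0). The edge polynomial is (z + 1)^3.\<close>

lemma degenerate_cubic_edge:
  assumes s: "s > 0"
    and supp: "\<And>i j. coeff2 D i j \<noteq> 0 \<Longrightarrow> 3 * s \<le> i + s * j"
    and coeffs: "coeff2 D 0 3 = 1" "coeff2 D s 2 = 3" "coeff2 D (2 * s) 1 = 3" "coeff2 D (3 * s) 0 = 1"
  shows "\<not> nondegenerate D"
proof -
  define P where "P = newton_polygon D"
  define a :: "real \<times> real" where "a = (1, real s)"
  define L where "L = P \<inter> {x. a \<bullet> x = 3 * real s}"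
  have gen: "(real i + x, real j + y) \<in> P" if "coeff2 D i j \<noteq> 0" "x \<ge> 0" "y \<ge> 0" for i j x y
    unfolding P_def newton_polygon_def support2_def
    by (rule hull_inc) (use that in blast)
  have "P \<subseteq> {x. a \<bullet> x \<ge> 3 * real s} \<inter> {x. (1, 0) \<bullet> x \<ge> 0} \<inter> {x. (0, 1) \<bullet> x \<ge> 0}"
    unfolding P_def newton_polygon_def
  proof (rule hull_minimal)
    have "3 * real s \<le> (real i + x) + real s * (real j + y)"
      if "coeff2 D i j \<noteq> 0" "x \<ge> 0" "y \<ge> 0" for i j x y
    proof -
      have "real (3 * s) \<le> real (i + s * j)"
        using supp[OF that(1)] by linarith
      moreover have "real s * y \<ge> 0"
        using that(3) by simp
      moreover have "(real i + x) + real s * (real j + y) = real (i + s * j) + x + real s * y"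
        by (simp add: algebra_simps)
      ultimately show ?thesis
        using that(2) by linarith
    qed
    then show "{(real i + x, real j + y) |i j x y. (i, j) \<in> support2 D \<and> 0 \<le> x \<and> 0 \<le> y}
        \<subseteq> {x. a \<bullet> x \<ge> 3 * real s} \<inter> {x. (1, 0) \<bullet> x \<ge> 0} \<inter> {x. (0, 1) \<bullet> x \<ge> 0}"
      by (auto simp: support2_def a_def)
  qed (intro convex_Int convex_halfspace_ge)
  then have P: "3 * real s \<le> x + real s * y" "0 \<le> x" "0 \<le> y" if "(x, y) \<in> P" for x y
    using that by (auto simp: a_def)
  have convP: "convex P"
    by (simp add: P_def newton_polygon_def)
  let ?A = "(0, 3) :: real \<times> real" and ?B = "(3 * real s, 0) :: real \<times> real"
  have AB: "?A \<in> P" "?B \<in> P"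
    using gen[of 0 3 0 0] gen[of "3 * s" 0 0 0] coeffs by auto
  have L_eq: "L = closed_segment ?A ?B"
  proof (intro equalityI subsetI)
    fix p assume "p \<in> L"
    then obtain x y where p: "p = (x, y)" "(x, y) \<in> P" "x + real s * y = 3 * real s"
      by (cases p) (auto simp: L_def a_def)
    define t where "t = x / (3 * real s)"
    have "real s * y \<ge> 0"
      using P(3)[OF p(2)] by simp
    then have "x \<le> 3 * real s"
      using p(3) by linarith
    then have "0 \<le> t" "t \<le> 1"
      using P[OF p(2)] s by (auto simp: t_def)
    moreover have "x = t * (3 * real s)" "y = (1 - t) * 3"
      using p(3) s by (auto simp: t_def field_simps)
    ultimately show "p \<in> closed_segment ?A ?B"
      unfolding closed_segment_def p(1) by (intro CollectI exI[of _ t]) auto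
  next
    fix p assume p: "p \<in> closed_segment ?A ?B"
    then have "p \<in> P"
      using closed_segment_subset[OF AB convP] by blast
    moreover have "a \<bullet> p = 3 * real s"
      using p by (auto simp: closed_segment_def a_def algebra_simps)
    ultimately show "p \<in> L" by (simp add: L_def)
  qed
  have "L face_of P"
    unfolding L_def by (rule face_of_Int_supporting_hyperplane_ge[OF convP]) (use P in \<open>auto simp: a_def\<close>)
  moreover have "aff_dim L = 1"
    unfolding L_eq segment_convex_hull aff_dim_convex_hull by simp
  ultimately have edge: "L edge_of newton_polygon D"
    by (simp add: edge_of_def P_def)
  have compact: "compact L"
    unfolding L_eq by (rule compact_segment)
  have on_L: "(real i, real j) \<in> L \<longleftrightarrow> i + s * j = 3 * s" if "coeff2 D i j \<noteq> 0" for i j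
  proof -
    have "(real i, real j) \<in> P"
      using gen[OF that, of 0 0] by simp
    then have "(real i, real j) \<in> L \<longleftrightarrow> real (i + s * j) = real (3 * s)"
      by (simp add: L_def a_def)
    then show ?thesis
      by (simp only: of_nat_eq_iff)
  qed
  have set_eq: "{(i, j). (i, j) \<in> support2 D \<and> (real i, real j) \<in> L} =
      {(0, 3 :: nat), (s, 2), (2 * s, 1), (3 * s, 0)}"
  proof (intro equalityI subsetI)
    fix p assume "p \<in> {(i, j). (i, j) \<in> support2 D \<and> (real i, real j) \<in> L}"
    then obtain i j where p: "p = (i, j)" "i + s * j = 3 * s"
      using on_L by (auto simp: support2_def)
    then have "s * j \<le> s * 3" by linarith
    then have "j \<le> 3" using s by (simp only: mult_le_cancel1)
    then have "j = 0 \<or> j = 1 \<or> j = 2 \<or> j = 3" by auto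
    then show "p \<in> {(0, 3 :: nat), (s, 2), (2 * s, 1), (3 * s, 0)}"
      using p by auto
  next
    fix p assume "p \<in> {(0, 3 :: nat), (s, 2), (2 * s, 1), (3 * s, 0)}"
    then show "p \<in> {(i, j). (i, j) \<in> support2 D \<and> (real i, real j) \<in> L}"
      using coeffs on_L[of 0 3] on_L[of s 2] on_L[of "2 * s" 1] on_L[of "3 * s" 0]
      by (auto simp: support2_def)
  qed
  have least: "(LEAST j. \<exists>i. (real i, real j) \<in> L) = 0"
  proof -
    have "(real (3 * s), real 0) \<in> L"
      using on_L[of "3 * s" 0] coeffs by simp
    then show ?thesis
      by (intro Least_eq_0) blast
  qed
  have "edge_poly D L = (\<Sum>(i, j) \<in> {(0, 3 :: nat), (s, 2), (2 * s, 1), (3 * s, 0)}. monom (coeff2 D i j) j)"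
    unfolding edge_poly_def least by (simp add: set_eq[simplified])
  also have "\<dots> = monom 1 3 + monom 3 2 + monom 3 1 + monom 1 0"
    using s coeffs by simp
  also have "\<dots> = [:1, 1:] ^ 3"
    by (simp add: monom_altdef numeral_3_eq_3 numeral_2_eq_2 algebra_simps)
  finally have poly: "edge_poly D L = [:- (- 1), 1:] ^ 3" by simp
  have "order (- 1) (edge_poly D L) = 3"
    unfolding poly by (rule order_power_n_n)
  then have "\<not> rsquarefree (edge_poly D L)"
    unfolding rsquarefree_def by (metis numeral_eq_one_iff semiring_norm(86) zero_neq_numeral)
  then show ?thesis
    using edge compact by (auto simp: nondegenerate_def)
qed

section \<open>The equation of a normal form\<close>

lemma fourth_roots_of_unity: "{\<omega>::complex. \<omega> ^ 4 = 1} = {1, -1, \<i>, -\<i>}"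
proof (intro equalityI subsetI)
  fix \<omega> :: complex assume "\<omega> \<in> {\<omega>. \<omega> ^ 4 = 1}"
  then have "(\<omega> - 1) * (\<omega> + 1) * (\<omega> - \<i>) * (\<omega> + \<i>) = 0"
    by (simp add: algebra_simps power4_eq_xxxx)
  then show "\<omega> \<in> {1, -1, \<i>, -\<i>}"
    by (auto simp: add_eq_0_iff2)
qed (auto simp: power4_eq_xxxx)

text \<open>E stands for the fourth root of unity \<i>^s inside the ring of series. The last two
  factors form a difference of squares, which eliminates E and leaves a polynomial identity with
  integer coefficients.\<close>

lemma circulant_quartic:
  fixes y a b c E :: "'a :: comm_ring_1"
  assumes "E ^ 2 = - 1"
  shows "(y - (a + b + c)) * (y - (- a + b - c)) * (y - (E * a - b - E * c)) * (y - (- (E * a) - b + E * c)) =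
    y ^ 4 - 2 * (b ^ 2 + 2 * a * c) * y ^ 2 - 4 * (b * (a ^ 2 + c ^ 2)) * y
      + ((b ^ 2 - 2 * a * c) ^ 2 - (a ^ 2 + c ^ 2) ^ 2)"
proof -
  have "(y - (E * a - b - E * c)) * (y - (- (E * a) - b + E * c)) = (y + b) ^ 2 - E ^ 2 * (a - c) ^ 2"
    by (simp add: algebra_simps power2_eq_square)
  then have "(y - (a + b + c)) * (y - (- a + b - c)) * (y - (E * a - b - E * c)) * (y - (- (E * a) - b + E * c)) =
      (y - (a + b + c)) * (y - (- a + b - c)) * ((y + b) ^ 2 + (a - c) ^ 2)"
    by (simp add: assms mult.assoc)
  then show ?thesis
    by (simp only:) (simp add: algebra_simps power2_eq_square power4_eq_xxxx)
qed

text \<open>The constants 2 and 4 are chosen so that the derivative in y is 4 (y^3 - p y -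
  q).\<close>

definition quartic :: "complex fps \<Rightarrow> complex fps \<Rightarrow> complex fps \<Rightarrow> complex fps fps" where
  "quartic p q r = fps_X ^ 4 - fps_const (2 * p) * fps_X ^ 2 - fps_const (4 * q) * fps_X + fps_const r"

text \<open>A, B and C are eigenvectors of the rotations with characters \<omega>^s, \<omega>^2 and
  \<omega>^(3 s). At \<omega> = \<i> and with s odd these are \<eta>, -1 and -\<eta>, where \<eta>^2
  = -1; this gives the four factors of \<open>circulant_quartic\<close>.\<close>

lemma product_of_conjugates:
  fixes A B C :: "complex fps"
  assumes s: "odd s"
    and A: "\<And>\<omega>. \<omega> ^ 4 = 1 \<Longrightarrow> rot \<omega> A = fps_const (\<omega> ^ s) * A"
    and B: "\<And>\<omega>. \<omega> ^ 4 = 1 \<Longrightarrow> rot \<omega> B = fps_const (\<omega> ^ 2) * B"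
    and C: "\<And>\<omega>. \<omega> ^ 4 = 1 \<Longrightarrow> rot \<omega> C = fps_const (\<omega> ^ (3 * s)) * C"
  shows "(\<Prod>\<omega> | \<omega> ^ 4 = 1. fps_X - fps_const (rot \<omega> (A + B + C))) =
    quartic (B ^ 2 + 2 * A * C) (B * (A ^ 2 + C ^ 2)) ((B ^ 2 - 2 * A * C) ^ 2 - (A ^ 2 + C ^ 2) ^ 2)"
proof -
  define \<eta> where "\<eta> = \<i> ^ s"
  have \<eta>2: "\<eta> ^ 2 = - 1"
  proof -
    have "\<eta> ^ 2 = (\<i> ^ 2) ^ s"
      unfolding \<eta>_def by (simp only: mult.commute flip: power_mult)
    then show ?thesis using s by simp
  qed
  have i3: "\<i> ^ (3 * s) = - \<eta>"
  proof -
    have "\<i> ^ (3 * s) = \<eta> ^ 3"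
      unfolding \<eta>_def by (simp only: mult.commute flip: power_mult)
    also have "\<dots> = \<eta> ^ 2 * \<eta>"
      by (simp add: power3_eq_cube power2_eq_square)
    finally show ?thesis using \<eta>2 by simp
  qed
  have "odd (3 * s)" using s by simp
  have minus: "(- \<i>) ^ s = - \<eta>" "(- \<i>) ^ (3 * s) = \<eta>"
    using power_minus_odd[OF s, of \<i>] power_minus_odd[OF \<open>odd (3 * s)\<close>, of \<i>] i3
    by (simp_all add: \<eta>_def)
  have four: "\<i> ^ 4 = (1 :: complex)" "(- \<i>) ^ 4 = (1 :: complex)"
    by (simp_all add: power4_eq_xxxx)
  have rots: "rot 1 (A + B + C) = A + B + C" "rot (- 1) (A + B + C) = - A + B - C"
    "rot \<i> (A + B + C) = fps_const \<eta> * A - B - fps_const \<eta> * C"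
    "rot (- \<i>) (A + B + C) = - (fps_const \<eta> * A) - B + fps_const \<eta> * C"
    using A[of "- 1"] B[of "- 1"] C[of "- 1"] s \<open>odd (3 * s)\<close>
      A[of \<i>] B[of \<i>] C[of \<i>] A[of "- \<i>"] B[of "- \<i>"] C[of "- \<i>"] four minus i3
    by (simp_all add: \<eta>_def[symmetric] flip: fps_const_neg)
  have "(\<Prod>\<omega> | \<omega> ^ 4 = 1. fps_X - fps_const (rot \<omega> (A + B + C))) =
      (\<Prod>\<omega>\<in>{1, -1, \<i>, -\<i>}. fps_X - fps_const (rot \<omega> (A + B + C)))"
    by (simp only: fourth_roots_of_unity)
  also have "\<dots> = (fps_X - fps_const (rot 1 (A + B + C))) * (fps_X - fps_const (rot (- 1) (A + B + C))) *
      (fps_X - fps_const (rot \<i> (A + B + C))) * (fps_X - fps_const (rot (- \<i>) (A + B + C)))"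
    by (simp add: complex_eq_iff mult.assoc del: rot_hom)
  also have "\<dots> = (fps_X - (fps_const A + fps_const B + fps_const C)) * (fps_X - (- fps_const A + fps_const B - fps_const C)) *
      (fps_X - (fps_const (fps_const \<eta>) * fps_const A - fps_const B - fps_const (fps_const \<eta>) * fps_const C)) *
      (fps_X - (- (fps_const (fps_const \<eta>) * fps_const A) - fps_const B + fps_const (fps_const \<eta>) * fps_const C))"
    unfolding rots by simp
  also have "\<dots> = quartic (B ^ 2 + 2 * A * C) (B * (A ^ 2 + C ^ 2)) ((B ^ 2 - 2 * A * C) ^ 2 - (A ^ 2 + C ^ 2) ^ 2)"
    by (subst circulant_quartic) (use \<eta>2 in \<open>simp_all add: quartic_def numeral_fps_const\<close>)
  finally show ?thesis .
qed

lemma quartic_nth: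
  "fps_nth (quartic p q r) j = (if j = 0 then r else if j = 1 then - 4 * q else if j = 2 then - 2 * p
    else if j = 4 then 1 else 0)"
  by (auto simp: quartic_def )

lemma ramify_eq_quartic:
  assumes eq: "ramify n F = quartic p q r" and n: "n > 0"
  obtains p' q' r' where "F = quartic p' q' r'" "fps_compose p' (fps_X ^ n) = p"
    "fps_compose q' (fps_X ^ n) = q" "fps_compose r' (fps_X ^ n) = r"
proof -
  define p' where "p' = fps_const (- 1 / 2) * fps_nth F 2"
  define q' where "q' = fps_const (- 1 / 4) * fps_nth F 1"
  define r' where "r' = fps_nth F 0"
  have nth: "fps_compose (fps_nth F j) (fps_X ^ n) = fps_nth (quartic p q r) j" for j
    using eq by (simp flip: eq add: ramify_def)
  have p: "fps_compose p' (fps_X ^ n) = p" and q: "fps_compose q' (fps_X ^ n) = q"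
    and r: "fps_compose r' (fps_X ^ n) = r"
    using nth[of 2] nth[of 1] nth[of 0] n
    by (simp_all add: p'_def q'_def r'_def quartic_nth fps_compose_mult_distrib numeral_fps_const)
  have "ramify n F = ramify n (quartic p' q' r')"
    unfolding eq using n p q r
    by (simp add: quartic_def ramify_hom fps_compose_mult_distrib numeral_fps_const)
  then have "F = quartic p' q' r'"
    by (rule ramify_inj[OF n])
  then show thesis using that p q r by blast
qed

text \<open>The families with positive \<lambda> are merged. From the index ranges only l \<ge> 1 is
  retained: for odd s it puts every exponent of the tail above \<lambda>.\<close>

lemma nf_param_cases:
  assumes "nf_param i s lam \<sigma>"
  obtains "lam = 0" "\<sigma> = fps_X ^ s"
  | j a L where "2 \<le> j" "j \<le> s div 4" "lam = 2 * s - 4 * j" "\<sigma> = nf_series s j a L"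
      "\<And>l. l \<in> L \<Longrightarrow> 1 \<le> l"
  using assms
proof cases
  case nf1
  then show ?thesis using that(1) by simp
next
  case (nf2 j k a)
  then show ?thesis using that(2)[of j a "{k..k + j - 2}"] by auto
next
  case (nf3 j a)
  then show ?thesis using that(2)[of j a "{s div 4 - j + 1..s div 4}"] by auto
next
  case (nf4 j a)
  then show ?thesis using that(2)[of j a "{s div 4 - j + 1..s div 4 - 1}"] by auto
qed

lemma rot_X_power: "rot \<omega> (fps_X ^ k) = fps_const (\<omega> ^ k) * fps_X ^ k"
  by (simp add: fps_eq_iff )

lemma rot_const: "rot \<omega> (fps_const a) = fps_const a"
  by (simp add: rot_def)

text \<open>In t, with x = t^4, a nonzero p has order above s + \<lambda>, q has order exactly 2 s +
  \<lambda> = 4 (s - j), and r starts with - t^(4 s). The bound on p is stated as 3 k \<le> 2 (s -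
  j) because this is the Newton polygon condition for y^3 = p y + q.\<close>

lemma NF4_quartic:
  assumes "NF4 i s f"
  obtains (zero) "zariski_invariant f = 0" "series f = quartic 0 0 (- (fps_X ^ s))"
  | (pos) j p q r where "2 \<le> j" "j \<le> s div 4" "zariski_invariant f = 2 * s - 4 * j"
      "series f = quartic p q r" "\<And>k. 3 * k \<le> 2 * (s - j) \<Longrightarrow> fps_nth p k = 0"
      "\<And>k. k < s - j \<Longrightarrow> fps_nth q k = 0" "fps_nth q (s - j) = 1"
      "\<And>k. k < s \<Longrightarrow> fps_nth r k = 0" "fps_nth r s = - 1"
proof -
  let ?lam = "zariski_invariant f"
  obtain \<sigma> where s: "odd s" and \<sigma>: "nf_param i s ?lam \<sigma>"
    and eq: "ramify 4 (series f) = (\<Prod>\<omega> | \<omega> ^ 4 = 1. fps_X - fps_const (rot \<omega> \<sigma>))"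
    using assms by (auto simp: NF4_def puiseux_equation_def rot_def)
  from \<sigma> show thesis
  proof (cases rule: nf_param_cases)
    case 1
    have "ramify 4 (series f) = quartic (0 ^ 2 + 2 * fps_X ^ s * 0) (0 * ((fps_X ^ s) ^ 2 + 0 ^ 2))
        ((0 ^ 2 - 2 * fps_X ^ s * 0) ^ 2 - ((fps_X ^ s) ^ 2 + 0 ^ 2) ^ 2)"
      using product_of_conjugates[OF s, of "fps_X ^ s" 0 0] eq 1 by (simp add: rot_X_power)
    also have "\<dots> = quartic 0 0 (- (fps_X ^ (4 * s)))"
      by (simp add: mult.commute flip: power_mult)
    also have "\<dots> = ramify 4 (quartic 0 0 (- (fps_X ^ s)))"
      by (simp add: quartic_def ramify_hom fps_compose_uminus fps_X_power_compose flip: power_mult)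
    finally have "series f = quartic 0 0 (- (fps_X ^ s))"
      using ramify_inj[of 4] by simp
    then show thesis using zero 1 by blast
  next
    case (2 j a L)
    have j4: "4 * j < s"
      using 2(2) s by presburger
    have lam: "?lam = 2 * s - 4 * j" by fact
    have ls: "s < ?lam" using j4 lam by simp
    let ?k = "\<lambda>l. s div 4 + j + 1 - l"
    let ?A = "fps_X ^ s :: complex fps" and ?B = "fps_X ^ ?lam :: complex fps"
    define C :: "complex fps" where "C = (\<Sum>l\<in>L. fps_const (a l) * fps_X ^ (3 * s - 4 * ?k l))"
    have \<sigma>_eq: "\<sigma> = ?A + ?B + C"
      by (simp add: 2(4) nf_series_def lam C_def)
    have k: "4 * ?k l \<le> 3 * s" "?lam + 1 \<le> 3 * s - 4 * ?k l" if "l \<in> L" for l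
    proof -
      have "?k l \<le> s div 4 + j"
        using 2(5)[OF that] by simp
      then have "4 * ?k l < s + 4 * j"
        using s by presburger
      then show "4 * ?k l \<le> 3 * s" "?lam + 1 \<le> 3 * s - 4 * ?k l"
        using j4 lam by linarith+
    qed
    have rotA: "rot \<omega> ?A = fps_const (\<omega> ^ s) * ?A" for \<omega>
      by (rule rot_X_power)
    have rotB: "rot \<omega> ?B = fps_const (\<omega> ^ 2) * ?B" if "\<omega> ^ 4 = 1" for \<omega>
    proof -
      obtain k where "s = 2 * k + 1"
        using s by (rule oddE)
      \<comment> \<open>\<lambda> is congruent to 2 modulo 4, so B transforms with the character
        \<omega>^2.\<close>
      then have "?lam = 4 * (k - j) + 2"
        using j4 lam by simp
      then have "\<omega> ^ ?lam = (\<omega> ^ 4) ^ (k - j) * \<omega> ^ 2"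
        by (metis power_add power_mult)
      then show ?thesis
        using that by (simp add: rot_X_power)
    qed
    have rotC: "rot \<omega> C = fps_const (\<omega> ^ (3 * s)) * C" if "\<omega> ^ 4 = 1" for \<omega>
    proof -
      have summand: "rot \<omega> (fps_const (a l) * fps_X ^ (3 * s - 4 * ?k l)) =
          fps_const (\<omega> ^ (3 * s)) * (fps_const (a l) * fps_X ^ (3 * s - 4 * ?k l))" if "l \<in> L" for l
      proof -
        have "\<omega> ^ (3 * s) = \<omega> ^ (3 * s - 4 * ?k l + 4 * ?k l)"
          using k(1)[OF that] by simp
        also have "\<dots> = \<omega> ^ (3 * s - 4 * ?k l)"
          unfolding power_add power_mult[of \<omega> 4] using \<open>\<omega> ^ 4 = 1\<close> by simp
        finally have "fps_const (\<omega> ^ (3 * s)) = fps_const (\<omega> ^ (3 * s - 4 * ?k l))"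
          by simp
        then show ?thesis
          by (simp only: rot_hom rot_X_power rot_const mult_ac)
      qed
      have "rot \<omega> C = (\<Sum>l\<in>L. rot \<omega> (fps_const (a l) * fps_X ^ (3 * s - 4 * ?k l)))"
        unfolding C_def rot_def by (rule fps_compose_sum_distrib)
      also have "\<dots> = (\<Sum>l\<in>L. fps_const (\<omega> ^ (3 * s)) * (fps_const (a l) * fps_X ^ (3 * s - 4 * ?k l)))"
        by (rule sum.cong[OF refl summand])
      finally show ?thesis
        by (simp add: C_def sum_distrib_left)
    qed
    define C' where "C' = fps_shift (?lam + 1) C"
    have C: "C = fps_X ^ (?lam + 1) * C'"
    proof -
      have "fps_nth C m = 0" if "m < ?lam + 1" for m
        unfolding C_def fps_sum_nth
        by (rule sum.neutral) (use k(2) that in \<open>fastforce simp: \<close>)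
      then have "fps_cutoff (?lam + 1) C = 0"
        by (simp add: fps_eq_iff)
      then show ?thesis
        using fps_shift_cutoff'[of "?lam + 1" C] by (simp add: C'_def)
    qed
    let ?P = "?B ^ 2 + 2 * ?A * C" and ?Q = "?B * (?A ^ 2 + C ^ 2)"
      and ?R = "(?B ^ 2 - 2 * ?A * C) ^ 2 - (?A ^ 2 + C ^ 2) ^ 2"
    have "ramify 4 (series f) = quartic ?P ?Q ?R"
      unfolding eq \<sigma>_eq by (rule product_of_conjugates[OF s rotA rotB rotC])
    then obtain p q r where pqr: "series f = quartic p q r" "fps_compose p (fps_X ^ 4) = ?P"
        "fps_compose q (fps_X ^ 4) = ?Q" "fps_compose r (fps_X ^ 4) = ?R"
      by (rule ramify_eq_quartic) auto
    have nth: "fps_nth p k = fps_nth ?P (4 * k)" "fps_nth q k = fps_nth ?Q (4 * k)"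
        "fps_nth r k = fps_nth ?R (4 * k)" for k
      unfolding pqr(2-4)[symmetric] by (simp_all add: fps_nth_compose_X_power)
    \<comment> \<open>The gap d between s + 1 and \<lambda> lets common powers of t be factored out
      without truncated subtraction.\<close>
    obtain d where d: "?lam = s + 1 + d"
      using ls less_iff_Suc_add by auto
    have powers: "?B = ?A * fps_X * fps_X ^ d" "fps_X ^ (?lam + 1) = ?A * fps_X ^ 2 * fps_X ^ d"
        "fps_X ^ (s + ?lam + 1) = ?A * ?A * fps_X ^ 2 * fps_X ^ d" "fps_X ^ (2 * s) = ?A * ?A"
        "fps_X ^ (2 * d + 4) = fps_X ^ d * fps_X ^ d * (fps_X ^ 2 * fps_X ^ 2 :: complex fps)"
        "fps_X ^ (4 * s) = ?A * ?A * ?A * ?A"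
      unfolding d by (simp_all add: power2_eq_square mult_ac flip: power_add power_Suc)
    have P: "?P = fps_X ^ (s + ?lam + 1) * (fps_X ^ d + 2 * C')"
      and P': "?B ^ 2 - 2 * ?A * C = fps_X ^ (s + ?lam + 1) * (fps_X ^ d - 2 * C')"
      and AC: "?A ^ 2 + C ^ 2 = fps_X ^ (2 * s) * (1 + fps_X ^ (2 * d + 4) * C' ^ 2)"
      unfolding C powers by (simp_all add: algebra_simps power2_eq_square)
    have Q: "?Q = fps_X ^ (4 * (s - j)) * (1 + fps_X ^ (2 * d + 4) * C' ^ 2)"
    proof -
      have "4 * (s - j) = ?lam + 2 * s"
        using lam j4 by simp
      then show ?thesis
        unfolding AC by (simp add: power_add mult.assoc)
    qed
    have R: "?R = fps_X ^ (4 * s) * (fps_X ^ (2 * d + 4) * (fps_X ^ d - 2 * C') ^ 2 -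
        (1 + fps_X ^ (2 * d + 4) * C' ^ 2) ^ 2)"
    proof -
      have "(fps_X ^ (s + ?lam + 1)) ^ 2 = (fps_X ^ (4 * s) * fps_X ^ (2 * d + 4) :: complex fps)"
        "(fps_X ^ (2 * s)) ^ 2 = (fps_X ^ (4 * s) :: complex fps)"
        unfolding powers by (simp_all add: power2_eq_square mult_ac)
      then show ?thesis
        unfolding P' AC power_mult_distrib by (simp only: right_diff_distrib mult.assoc)
    qed
    show thesis
    proof (rule pos[OF 2(1,2) lam pqr(1)])
      show "fps_nth p k = 0" if "3 * k \<le> 2 * (s - j)" for k
      proof -
        \<comment> \<open>Since 8 (s - j) = 4 s + 2 \<lambda>, the assumption gives 12 k \<le> 4 s +
          2 \<lambda>, which is below 3 (s + \<lambda> + 1) because s < \<lambda>.\<close>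
        have "4 * k < s + ?lam + 1"
          using that lam j4 by simp
        then show ?thesis
          unfolding nth P by (subst fps_X_power_mult_nth) simp
      qed
      show "fps_nth q k = 0" if "k < s - j" for k
        unfolding nth Q by (subst fps_X_power_mult_nth) (use that in simp)
      show "fps_nth q (s - j) = 1"
        unfolding nth Q by (subst fps_X_power_mult_nth) (simp add: fps_X_power_mult_nth)
      show "fps_nth r k = 0" if "k < s" for k
        unfolding nth R by (subst fps_X_power_mult_nth) (use that in simp)
      show "fps_nth r s = - 1"
        unfolding nth R by (subst fps_X_power_mult_nth)
          (simp add: fps_X_power_mult_nth power2_eq_square algebra_simps)
    qed
  qed
qed

lemma order2_quartic:
  assumes "series f = quartic p q r" "\<And>k. k < 2 \<Longrightarrow> fps_nth p k = 0"
    "\<And>k. k < 3 \<Longrightarrow> fps_nth q k = 0" "\<And>k. k < 4 \<Longrightarrow> fps_nth r k = 0"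
  shows "order2 f = 4"
  unfolding order2_def
proof (rule Least_equality)
  show "\<exists>i j. i + j = 4 \<and> coeff2 f i j \<noteq> 0"
    by (rule exI[of _ 0], rule exI[of _ 4]) (simp add: coeff2_def assms(1) quartic_nth)
  fix k assume "\<exists>i j. i + j = k \<and> coeff2 f i j \<noteq> 0"
  then obtain i j where ij: "i + j = k" "coeff2 f i j \<noteq> 0"
    by blast
  show "4 \<le> k"
  proof (rule ccontr)
    assume "\<not> 4 \<le> k"
    then have "i + j < 4" using ij by simp
    then have "coeff2 f i j = 0"
      using assms(2-4) by (auto simp: coeff2_def assms(1) quartic_nth 
          numeral_fps_const simp flip: fps_const_neg)
    then show False using ij by simp
  qed
qed

section \<open>The discriminant\<close>

lemma fps_X_minus_const_nonzero: "fps_X - fps_const c \<noteq> (0 :: complex fps fps)"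
proof
  assume "fps_X - fps_const c = 0"
  from arg_cong[OF this, of "\<lambda>F. fps_nth F 1"] show False by simp
qed

lemma atLeastAtMost_1_3: "{1..3} = {1, 2, 3::nat}"
  by auto

lemma prod_1_3: "(\<Prod>j\<in>{1..3::nat}. g j) = g 1 * g 2 * g 3"
  unfolding atLeastAtMost_1_3 by (simp add: mult.assoc)

text \<open>The factors \<open>Y - \<gamma> j\<close> are split off the cubic one by one; each quotient vanishes at the
  remaining roots.\<close>

lemma vieta_cubic:
  fixes \<gamma> :: "nat \<Rightarrow> complex fps"
  assumes eq: "fps_const 4 * (fps_X ^ 3 - fps_const P * fps_X - fps_const Q) =
      w * (\<Prod>j\<in>{1..3}. fps_X - fps_const (\<gamma> j))"
    and \<gamma>0: "\<And>j. j \<in> {1..3} \<Longrightarrow> fps_nth (\<gamma> j) 0 = 0"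
  shows "\<And>j. j \<in> {1..3} \<Longrightarrow> \<gamma> j ^ 3 = P * \<gamma> j + Q"
    and "\<And>j k. j \<in> {1..3} \<Longrightarrow> k \<in> {1..3} \<Longrightarrow> j \<noteq> k \<Longrightarrow> (\<gamma> j) ^ 2 + \<gamma> j * \<gamma> k + (\<gamma> k) ^ 2 = P"
proof -
  define a b c where "a = \<gamma> 1" and "b = \<gamma> 2" and "c = \<gamma> 3"
  note abc = a_def b_def c_def
  let ?Y = "fps_X :: complex fps fps" and ?k = "fps_const :: complex fps \<Rightarrow> complex fps fps"
  have z: "fps_nth a 0 = 0" "fps_nth b 0 = 0" "fps_nth c 0 = 0"
    using \<gamma>0 by (auto simp: abc)
  have eq1: "4 * (?Y ^ 3 - ?k P * ?Y - ?k Q) = w * ((?Y - ?k a) * (?Y - ?k b) * (?Y - ?k c))"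
    using eq unfolding prod_1_3 abc by (simp add: numeral_fps_const)
  have cancel4: "x = 0" if "4 * x = 0" for x :: "complex fps"
    using that by (simp add: numeral_fps_const)
  have "4 * (a ^ 3 - P * a - Q) = 0"
    using arg_cong[OF eq1, of "eval_y a"] z by simp
  from cancel4[OF this] have a: "a ^ 3 = P * a + Q"
    by (simp add: algebra_simps)
  then have Q: "Q = a ^ 3 - P * a" by simp
  have "?Y ^ 3 - ?k P * ?Y - ?k Q = (?Y - ?k a) * (?Y ^ 2 + ?k a * ?Y + ?k a ^ 2 - ?k P)"
    unfolding Q by (simp add: algebra_simps power2_eq_square power3_eq_cube flip: fps_const_mult fps_const_sub)
  then have "(?Y - ?k a) * (4 * (?Y ^ 2 + ?k a * ?Y + ?k a ^ 2 - ?k P)) =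
      (?Y - ?k a) * (w * ((?Y - ?k b) * (?Y - ?k c)))"
    using eq1 by (simp only: mult_ac)
  then have eq2: "4 * (?Y ^ 2 + ?k a * ?Y + ?k a ^ 2 - ?k P) = w * ((?Y - ?k b) * (?Y - ?k c))"
    by (rule mult_left_cancel[OF fps_X_minus_const_nonzero, THEN iffD1])
  have "4 * (b ^ 2 + a * b + a ^ 2 - P) = 0"
    using arg_cong[OF eq2, of "eval_y b"] z by simp
  from cancel4[OF this] have P: "P = b ^ 2 + a * b + a ^ 2"
    by simp
  have "?Y ^ 2 + ?k a * ?Y + ?k a ^ 2 - ?k P = (?Y - ?k b) * (?Y + ?k a + ?k b)"
    unfolding P by (simp add: algebra_simps power2_eq_square flip: fps_const_mult fps_const_add)
  then have "(?Y - ?k b) * (4 * (?Y + ?k a + ?k b)) = (?Y - ?k b) * (w * (?Y - ?k c))"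
    using eq2 by (simp only: mult_ac)
  then have eq3: "4 * (?Y + ?k a + ?k b) = w * (?Y - ?k c)"
    by (rule mult_left_cancel[OF fps_X_minus_const_nonzero, THEN iffD1])
  have "4 * (c + a + b) = 0"
    using arg_cong[OF eq3, of "eval_y c"] z by simp
  then have "c + a + b = 0"
    by (rule cancel4)
  then have c: "c = - (a + b)"
    by (simp add: add_eq_0_iff2 add.assoc)
  show "\<gamma> j ^ 3 = P * \<gamma> j + Q" if "j \<in> {1..3}" for j
  proof -
    have "b ^ 3 = P * b + Q" "c ^ 3 = P * c + Q"
      unfolding c Q P by (simp_all add: algebra_simps power2_eq_square power3_eq_cube)
    moreover have "j = 1 \<or> j = 2 \<or> j = 3"
      using that by auto
    ultimately show ?thesis
      using a unfolding abc by blast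
  qed
  show "(\<gamma> j) ^ 2 + \<gamma> j * \<gamma> k + (\<gamma> k) ^ 2 = P" if "j \<in> {1..3}" "k \<in> {1..3}" "j \<noteq> k" for j k
  proof -
    have "a ^ 2 + a * b + b ^ 2 = P" "a ^ 2 + a * c + c ^ 2 = P" "b ^ 2 + b * c + c ^ 2 = P"
      unfolding c P by (simp_all add: algebra_simps power2_eq_square)
    moreover have "j = 1 \<or> j = 2 \<or> j = 3" "k = 1 \<or> k = 2 \<or> k = 3"
      using that by auto
    ultimately show ?thesis
      using that(3) unfolding abc by (elim disjE) (simp_all add: add_ac mult_ac)
  qed
qed

text \<open>A Newton polygon argument: the lowest order among x^3, P x and Q must occur twice, and
  the bound on P rules out that P x takes part. So x^3 and Q have the same order.\<close>

lemma cubic_root_order: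
  fixes x P Q :: "complex fps"
  assumes eq: "x ^ 3 = P * x + Q" and Q: "Q \<noteq> 0"
    and P: "P = 0 \<or> 2 * subdegree Q < 3 * subdegree P"
  shows "3 * subdegree x = subdegree Q"
proof -
  have x: "x \<noteq> 0"
    using eq Q by auto
  show ?thesis
  proof (cases "P = 0")
    case True
    then have "subdegree (x ^ 3) = subdegree Q"
      using eq by simp
    then show ?thesis by simp
  next
    case False
    then have sP: "2 * subdegree Q < 3 * subdegree P" and Px: "P * x \<noteq> 0"
      using P x by auto
    have sPx: "subdegree (P * x) = subdegree P + subdegree x"
      using False x by simp
    have sx: "subdegree (x ^ 3) = 3 * subdegree x"
      by simp
    consider "3 * subdegree x = subdegree Q" | "3 * subdegree x < subdegree Q" | "subdegree Q < 3 * subdegree x"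
      by linarith
    then show ?thesis
    proof cases
      case 2
      have "fps_nth (P * x) (3 * subdegree x) = fps_nth (x ^ 3) (3 * subdegree x) - fps_nth Q (3 * subdegree x)"
        using eq by simp
      also have "\<dots> \<noteq> 0"
        using nth_subdegree_nonzero[of "x ^ 3"] x nth_less_subdegree_zero[OF 2] by simp
      finally have "subdegree (P * x) \<le> 3 * subdegree x"
        by (rule subdegree_leI)
      then show ?thesis using sPx sP 2 by linarith
    next
      case 3
      have "fps_nth (P * x) (subdegree Q) = fps_nth (x ^ 3) (subdegree Q) - fps_nth Q (subdegree Q)"
        using eq by simp
      also have "\<dots> \<noteq> 0"
        using nth_subdegree_nonzero[OF Q] nth_less_subdegree_zero[of "subdegree Q" "x ^ 3"] 3 sx by simp
      finally have "subdegree (P * x) \<le> subdegree Q"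
        by (rule subdegree_leI)
      then show ?thesis using sPx sP 3 by linarith
    qed
  qed
qed

text \<open>Every root is - u^s plus higher terms, with u = t^N, so the elementary symmetric
  functions start like those of three equal roots - u^s, and the lowest quasihomogeneous part of D
  is (v + u^s)^3.\<close>

lemma degenerate_cubic:
  fixes z :: "nat \<Rightarrow> complex fps"
  assumes N: "N > 0" and s: "s > 0"
    and D: "ramify N (series D) = (\<Prod>j\<in>{1..3}. fps_X - fps_const (z j))"
    and low: "\<And>j i. j \<in> {1..3} \<Longrightarrow> i < N * s \<Longrightarrow> fps_nth (z j) i = 0"
    and lead: "\<And>j. j \<in> {1..3} \<Longrightarrow> fps_nth (z j) (N * s) = - 1"
  shows "\<not> nondegenerate D"
proof -
  define v where "v j = fps_shift (N * s) (z j)" for j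
  define X where "X = (fps_X :: complex fps) ^ (N * s)"
  have z: "z j = X * v j" "fps_nth (v j) 0 = - 1" if "j \<in> {1..3}" for j
  proof -
    have "fps_cutoff (N * s) (z j) = 0"
      using low[OF that] by (simp add: fps_eq_iff)
    then show "z j = X * v j"
      using fps_shift_cutoff'[of "N * s" "z j"] by (simp add: v_def X_def)
    show "fps_nth (v j) 0 = - 1"
      using lead[OF that] by (simp add: v_def)
  qed
  let ?a = "v 1" and ?b = "v 2" and ?c = "v 3"
  have "ramify N (series D) = fps_X ^ 3 - fps_const (X * (?a + ?b + ?c)) * fps_X ^ 2
      + fps_const (X ^ 2 * (?a * ?b + ?a * ?c + ?b * ?c)) * fps_X - fps_const (X ^ 3 * (?a * ?b * ?c))"
    unfolding D prod_1_3 using z(1) by (simp only: atLeastAtMost_1_3 insert_iff simp_thms)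
      (simp add: algebra_simps power2_eq_square power3_eq_cube flip: fps_const_mult fps_const_add)
  then have "fps_nth (ramify N (series D)) j = (if j = 3 then 1 else if j = 2 then - (X * (?a + ?b + ?c))
      else if j = 1 then X ^ 2 * (?a * ?b + ?a * ?c + ?b * ?c) else if j = 0 then - (X ^ 3 * (?a * ?b * ?c))
      else 0)" for j
    by simp
  moreover have "coeff2 D i j = fps_nth (fps_nth (ramify N (series D)) j) (N * i)" for i j
    using N by (simp add: coeff2_def ramify_def fps_nth_compose_X_power)
  ultimately have coeff: "coeff2 D i j = fps_nth (if j = 3 then 1 else if j = 2 then - (X * (?a + ?b + ?c))
      else if j = 1 then X ^ 2 * (?a * ?b + ?a * ?c + ?b * ?c) else if j = 0 then - (X ^ 3 * (?a * ?b * ?c))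
      else 0) (N * i)" for i j
    by simp
  have pow: "X ^ k = fps_X ^ (N * (k * s))" for k
    by (simp add: X_def mult_ac flip: power_mult)
  have nth: "fps_nth (X ^ k * g) (N * i) = (if i < k * s then 0 else fps_nth g (N * i - N * (k * s)))" for k g i
    unfolding pow fps_X_power_mult_nth using N by simp
  have nth1: "fps_nth (X * g) (N * i) = (if i < s then 0 else fps_nth g (N * i - N * s))" for g i
    using nth[of 1] by simp
  have v0: "fps_nth ?a 0 = - 1" "fps_nth ?b 0 = - 1" "fps_nth ?c 0 = - 1"
    using z(2) by auto
  show ?thesis
  proof (rule degenerate_cubic_edge[OF s])
    show "3 * s \<le> i + s * j" if "coeff2 D i j \<noteq> 0" for i j
      using that by (auto simp: coeff nth nth1 not_less split: if_splits)
    show "coeff2 D 0 3 = 1" "coeff2 D s 2 = 3" "coeff2 D (2 * s) 1 = 3" "coeff2 D (3 * s) 0 = 1"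
      using v0 by (simp_all add: coeff nth nth1)
  qed
qed

text \<open>Besides the cubic equation the pairwise relations between the polar roots are recorded:
  they will show that the leading coefficients of the roots are distinct.\<close>

lemma discriminant_roots:
  assumes disc: "discriminant_curve f D" and f: "series f = quartic p q r" and order: "order2 f = 4"
  obtains N and \<gamma> :: "nat \<Rightarrow> complex fps" where "N > 0" "\<And>j. j \<in> {1..3} \<Longrightarrow> conv1 (\<gamma> j)" "\<And>j. j \<in> {1..3} \<Longrightarrow> fps_nth (\<gamma> j) 0 = 0"
    "\<And>j. j \<in> {1..3} \<Longrightarrow>
      \<gamma> j ^ 3 = fps_compose p (fps_X ^ N) * \<gamma> j + fps_compose q (fps_X ^ N)"
    "\<And>j k. j \<in> {1..3} \<Longrightarrow> k \<in> {1..3} \<Longrightarrow> j \<noteq> k \<Longrightarrow>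
      (\<gamma> j) ^ 2 + \<gamma> j * \<gamma> k + (\<gamma> k) ^ 2 = fps_compose p (fps_X ^ N)"
    "ramify N (series D) = (\<Prod>j\<in>{1..3}. fps_X - fps_const (eval_y (\<gamma> j) (ramify N (series f))))"
    "\<And>j. j \<in> {1..3} \<Longrightarrow> eval_y (\<gamma> j) (ramify N (series f)) = fps_compose r (fps_X ^ N)
      - 3 * fps_compose q (fps_X ^ N) * \<gamma> j - fps_compose p (fps_X ^ N) * (\<gamma> j) ^ 2"
proof -
  have J: "{1..<4::nat} = {1..3}" by auto
  obtain N w and \<gamma> :: "nat \<Rightarrow> complex fps" where N: "N > 0"
    and \<gamma>: "\<And>j. j \<in> {1..3} \<Longrightarrow> fps_conv_radius (\<gamma> j) > 0" "\<And>j. j \<in> {1..3} \<Longrightarrow> fps_nth (\<gamma> j) 0 = 0"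
    and deriv: "ramify N (fps_deriv (series f)) = ramify N (series w) * (\<Prod>j\<in>{1..3}. fps_X - fps_const (\<gamma> j))"
    and D: "ramify N (series D) =
        (\<Prod>j\<in>{1..3}. fps_X - fps_const (subst2 (series f) (fps_X ^ N) (\<gamma> j)))"
    using disc unfolding discriminant_curve_def order J by blast
  define P Q R where "P = fps_compose p (fps_X ^ N)" and "Q = fps_compose q (fps_X ^ N)"
    and "R = fps_compose r (fps_X ^ N)"
  have "fps_deriv (series f) = fps_const 4 * (fps_X ^ 3 - fps_const p * fps_X - fps_const q)"
  proof (rule fps_ext)
    fix j
    show "fps_nth (fps_deriv (series f)) j =
        fps_nth (fps_const 4 * (fps_X ^ 3 - fps_const p * fps_X - fps_const q)) j"
      by (auto simp: f quartic_nth)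
  qed
  then have "ramify N (fps_deriv (series f)) = fps_const 4 * (fps_X ^ 3 - fps_const P * fps_X - fps_const Q)"
    using N by (simp add: ramify_hom P_def Q_def numeral_fps_const)
  then have eq: "fps_const 4 * (fps_X ^ 3 - fps_const P * fps_X - fps_const Q) =
      ramify N (series w) * (\<Prod>j\<in>{1..3}. fps_X - fps_const (\<gamma> j))"
    using deriv by simp
  have cubic: "\<gamma> j ^ 3 = P * \<gamma> j + Q" if "j \<in> {1..3}" for j
    by (rule vieta_cubic(1)[OF eq]) (use \<gamma>(2) that in auto)
  have quadratic: "(\<gamma> j) ^ 2 + \<gamma> j * \<gamma> k + (\<gamma> k) ^ 2 = P"
    if "j \<in> {1..3}" "k \<in> {1..3}" "j \<noteq> k" for j k
    by (rule vieta_cubic(2)[OF eq]) (use \<gamma>(2) that in auto)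
  have evaluated: "eval_y (\<gamma> j) (ramify N (series f)) = R - 3 * Q * \<gamma> j - P * (\<gamma> j) ^ 2" if j: "j \<in> {1..3}" for j
  proof -
    have "eval_y (\<gamma> j) (ramify N (series f)) = \<gamma> j ^ 4 - 2 * P * \<gamma> j ^ 2 - 4 * Q * \<gamma> j + R"
      using N \<gamma>(2)[OF j] by (simp add: f quartic_def ramify_hom P_def Q_def R_def fps_compose_mult_distrib
          numeral_fps_const)
    \<comment> \<open>Reducing the fourth power by the cubic turns the coefficients -2 P and -4 Q
      into -P and -3 Q.\<close>
    also have "\<gamma> j ^ 4 = (P * \<gamma> j + Q) * \<gamma> j"
      by (simp flip: cubic[OF j] add: power4_eq_xxxx power3_eq_cube)
    finally show ?thesis
      by (simp add: algebra_simps power2_eq_square)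
  qed
  show thesis
    by (rule that[OF N conv1_if_conv_radius[OF \<gamma>(1)] \<gamma>(2)])
      (use cubic quadratic evaluated D in \<open>auto simp: P_def Q_def R_def subst2_eq_eval_y\<close>)
qed

lemma NF4_discriminant:
  assumes nf: "NF4 i s f" and disc: "discriminant_curve f D"
  obtains (zero) "zariski_invariant f = 0" "D = (Y_cps2 + X_cps2 ^ s) ^ 3" "\<not> nondegenerate D"
  | (pos) j N e z \<rho> c where "2 \<le> j" "j \<le> s div 4" "zariski_invariant f = 2 * s - 4 * j"
      "\<not> nondegenerate D" "three_roots D N e (2 * s + zariski_invariant f) z \<rho> c"
proof -
  have s: "s > 4" "odd s"
    using nf by (auto simp: NF4_def)
  from nf show thesis
  proof (cases rule: NF4_quartic)
    case zero
    have order: "order2 f = 4"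
      by (rule order2_quartic[OF zero(2)]) (use s in auto)
    obtain N \<gamma> where N: "N > 0"
      and "\<And>j. j \<in> {1..3} \<Longrightarrow> conv1 (\<gamma> j)" "\<And>j. j \<in> {1..3} \<Longrightarrow> fps_nth (\<gamma> j) 0 = 0"
      and "\<And>j. j \<in> {1..3} \<Longrightarrow> \<gamma> j ^ 3 = fps_compose 0 (fps_X ^ N) * \<gamma> j + fps_compose 0 (fps_X ^ N)"
      and "\<And>j k. j \<in> {1..3} \<Longrightarrow> k \<in> {1..3} \<Longrightarrow> j \<noteq> k \<Longrightarrow>
        (\<gamma> j) ^ 2 + \<gamma> j * \<gamma> k + (\<gamma> k) ^ 2 = fps_compose 0 (fps_X ^ N)"
      and D: "ramify N (series D) = (\<Prod>j\<in>{1..3::nat}. fps_X - fps_const (eval_y (\<gamma> j) (ramify N (series f))))"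
      and ev: "\<And>j. j \<in> {1..3} \<Longrightarrow> eval_y (\<gamma> j) (ramify N (series f)) = fps_compose (- (fps_X ^ s)) (fps_X ^ N)
        - 3 * fps_compose 0 (fps_X ^ N) * \<gamma> j - fps_compose 0 (fps_X ^ N) * (\<gamma> j) ^ 2"
      by (rule discriminant_roots[OF disc zero(2) order]) (rule that; assumption)
    have evaluated: "eval_y (\<gamma> j) (ramify N (series f)) = - (fps_X ^ (N * s))" if "j \<in> {1..3}" for j
      using ev[OF that] N by (simp add: fps_compose_uminus fps_X_power_compose flip: power_mult)
    have D_eq: "ramify N (series D) = (\<Prod>j\<in>{1..3::nat}. fps_X - fps_const (- (fps_X ^ (N * s))))"
      unfolding D by (rule prod.cong) (use evaluated in auto)
    have "ramify N (series D) = ramify N (series ((Y_cps2 + X_cps2 ^ s) ^ 3))"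
      using N by (simp add: D_eq ramify_hom fps_X_power_compose power_mult flip: fps_const_neg)
    then have "D = (Y_cps2 + X_cps2 ^ s) ^ 3"
      by (rule series_eqI[OF ramify_inj[OF N]])
    moreover have "\<not> nondegenerate D"
      by (rule degenerate_cubic[OF N _ D_eq, where s = s]) (use s in auto)
    ultimately show thesis
      using that(1) zero by blast
  next
    case (pos j p q r)
    let ?lam = "zariski_invariant f"
    \<comment> \<open>m is the order of q in x, so 4 m = 2 s + \<lambda>. In t the polar roots will
      have order g with 3 g = N m, and the roots of D contact 4 g.\<close>
    define m where "m = s - j"
    have j4: "4 * j < s"
      using pos(2) s(2) by presburger
    have m: "4 * m = 2 * s + ?lam" "3 \<le> m" "3 * s < 4 * m"
      using j4 pos(3) s by (auto simp: m_def)
    note p = pos(5)[folded m_def] and q = pos(6,7)[folded m_def] and r = pos(8,9)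
    have order: "order2 f = 4"
      by (rule order2_quartic[OF pos(4)]) (use p q r m s in auto)
    obtain N \<gamma> where N: "N > 0"
      and \<gamma>: "\<And>j. j \<in> {1..3} \<Longrightarrow> conv1 (\<gamma> j)" "\<And>j. j \<in> {1..3} \<Longrightarrow> fps_nth (\<gamma> j) 0 = 0"
      and cubic: "\<And>j. j \<in> {1..3} \<Longrightarrow> \<gamma> j ^ 3 = fps_compose p (fps_X ^ N) * \<gamma> j + fps_compose q (fps_X ^ N)"
      and quad: "\<And>j k. j \<in> {1..3} \<Longrightarrow> k \<in> {1..3} \<Longrightarrow> j \<noteq> k \<Longrightarrow>
        (\<gamma> j) ^ 2 + \<gamma> j * \<gamma> k + (\<gamma> k) ^ 2 = fps_compose p (fps_X ^ N)"
      and D: "ramify N (series D) = (\<Prod>j\<in>{1..3::nat}. fps_X - fps_const (eval_y (\<gamma> j) (ramify N (series f))))"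
      and ev: "\<And>j. j \<in> {1..3} \<Longrightarrow> eval_y (\<gamma> j) (ramify N (series f)) = fps_compose r (fps_X ^ N)
        - 3 * fps_compose q (fps_X ^ N) * \<gamma> j - fps_compose p (fps_X ^ N) * (\<gamma> j) ^ 2"
      by (rule discriminant_roots[OF disc pos(4) order]) (rule that; assumption)
    define P Q R where "P = fps_compose p (fps_X ^ N)" and "Q = fps_compose q (fps_X ^ N)"
      and "R = fps_compose r (fps_X ^ N)"
    note cubic = cubic[folded P_def Q_def] and quad = quad[folded P_def]
      and ev = ev[folded P_def Q_def R_def]
    have q0: "q \<noteq> 0" "subdegree q = m"
      using q by (auto intro!: subdegreeI)
    have Q: "Q \<noteq> 0" "subdegree Q = N * m"
      using q0 N by (auto simp: Q_def fps_compose_eq_0_iff mult.commute)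
    \<comment> \<open>The bound includes equality, so P is divisible by t^(2 g) with a quotient that
      vanishes at 0.\<close>
    have P_low: "fps_nth P k = 0" if "3 * k \<le> 2 * (N * m)" for k
    proof (cases "N dvd k")
      case True
      then obtain i where i: "k = N * i" by blast
      then have "N * (3 * i) \<le> N * (2 * m)"
        using that by (simp add: mult_ac)
      then have "3 * i \<le> 2 * m"
        using N by (simp only: mult_le_cancel1)
      then show ?thesis
        using p[of i] N i by (simp add: P_def fps_nth_compose_X_power)
    next
      case False
      then show ?thesis by (simp add: P_def fps_nth_compose_X_power)
    qed
    have "P = 0 \<or> 2 * subdegree Q < 3 * subdegree P"
      using P_low[of "subdegree P"] Q(2) by (auto simp: not_le[symmetric])
    then have order: "3 * subdegree (\<gamma> k) = N * m" if "k \<in> {1..3}" for k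
      using cubic_root_order[OF cubic[OF that] Q(1)] Q(2) by simp
    define g where "g = subdegree (\<gamma> 1)"
    have g: "3 * g = N * m" "subdegree (\<gamma> k) = g" if "k \<in> {1..3}" for k
      using order[of 1] order[OF that] by (auto simp: g_def)
    have g3: "3 * g = N * m" using g(1)[of 1] by simp
    define v where "v k = fps_shift g (\<gamma> k)" for k
    define P' where "P' = fps_shift (2 * g) P"
    define Q' where "Q' = fps_shift (3 * g) Q"
    have \<gamma>v: "\<gamma> k = fps_X ^ g * v k" if "k \<in> {1..3}" for k
      using fps_shift_times_fps_X_power[of g "\<gamma> k"] g(2)[OF that] by (simp add: v_def mult.commute)
    have P': "P = fps_X ^ (2 * g) * P'" "fps_nth P' 0 = 0"
    proof -
      have "fps_cutoff (2 * g) P = 0"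
        using P_low g3 by (simp add: fps_eq_iff)
      then show "P = fps_X ^ (2 * g) * P'"
        using fps_shift_cutoff'[of "2 * g" P] by (simp add: P'_def)
      show "fps_nth P' 0 = 0"
        using P_low[of "2 * g"] g3 by (simp add: P'_def)
    qed
    have Q': "Q = fps_X ^ (3 * g) * Q'" "fps_nth Q' 0 = 1"
    proof -
      show "Q = fps_X ^ (3 * g) * Q'"
        using fps_shift_times_fps_X_power[of "3 * g" Q] Q(2) g3 by (simp add: Q'_def mult.commute)
      have "fps_nth Q (N * m) = 1"
        using q(2) N by (simp add: Q_def fps_nth_compose_X_power)
      then show "fps_nth Q' 0 = 1"
        by (simp add: Q'_def g3)
    qed
    define c where "c k = fps_nth (v k) 0" for k
    \<comment> \<open>The cubic divided by t^(3 g), at t = 0.\<close>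
    have c3: "c k ^ 3 = 1" if k: "k \<in> {1..3}" for k
    proof -
      have "fps_X ^ (3 * g) * (v k ^ 3) = \<gamma> k ^ 3"
        unfolding \<gamma>v[OF k] by (simp add: power_mult_distrib mult.commute[of 3] power_mult)
      also have "\<dots> = (fps_X ^ (2 * g) * fps_X ^ g) * (P' * v k) + fps_X ^ (3 * g) * Q'"
        unfolding cubic[OF k] unfolding \<gamma>v[OF k] P'(1) Q'(1) by (simp only: mult_ac)
      also have "fps_X ^ (2 * g) * fps_X ^ g = (fps_X ^ (3 * g) :: complex fps)"
        by (simp flip: power_add)
      also have "fps_X ^ (3 * g) * (P' * v k) + fps_X ^ (3 * g) * Q' = fps_X ^ (3 * g) * (P' * v k + Q')"
        by (rule distrib_left[symmetric])
      finally have "v k ^ 3 = P' * v k + Q'"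
        by simp
      from arg_cong[OF this, of "\<lambda>h. fps_nth h 0"] show ?thesis
        using P'(2) Q'(2) by (simp add: c_def power3_eq_cube)
    qed
    \<comment> \<open>The pairwise relation divided by t^(2 g), at t = 0; equal leading coefficients
      would give 3 c^2 = 0.\<close>
    have c_quad: "c k ^ 2 + c k * c l + c l ^ 2 = 0" if kl: "k \<in> {1..3}" "l \<in> {1..3}" "k \<noteq> l" for k l
    proof -
      have "fps_X ^ (2 * g) * (v k ^ 2 + v k * v l + v l ^ 2) = (\<gamma> k) ^ 2 + \<gamma> k * \<gamma> l + (\<gamma> l) ^ 2"
        unfolding \<gamma>v[OF kl(1)] \<gamma>v[OF kl(2)] mult_2 power_add
        by (simp add: algebra_simps power2_eq_square)
      also have "\<dots> = fps_X ^ (2 * g) * P'"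
        using quad[OF kl] P'(1) by simp
      finally have "v k ^ 2 + v k * v l + v l ^ 2 = P'"
        by simp
      from arg_cong[OF this, of "\<lambda>h. fps_nth h 0"] show ?thesis
        using P'(2) by (simp add: c_def power2_eq_square)
    qed
    have c_nz: "c k \<noteq> 0" if "k \<in> {1..3}" for k
      using c3[OF that] by auto
    have c_inj: "inj_on c {1..3}"
    proof (rule inj_onI, rule ccontr)
      fix k l assume *: "k \<in> {1..3}" "l \<in> {1..3}" "c k = c l" "k \<noteq> l"
      from c_quad[OF *(1,2,4)] have "3 * c k ^ 2 = 0"
        using *(3) by (simp add: power2_eq_square)
      then show False using c_nz[OF *(1)] by simp
    qed
    define z where "z k = eval_y (\<gamma> k) (ramify N (series f))" for k
    have z: "z k = R - fps_X ^ (4 * g) * (3 * Q' * v k + P' * v k ^ 2)" if k: "k \<in> {1..3}" for k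
    proof -
      have "(fps_X ^ (3 * g) * fps_X ^ g :: complex fps) = fps_X ^ (4 * g)"
        "(fps_X ^ (2 * g) * (fps_X ^ g) ^ 2 :: complex fps) = fps_X ^ (4 * g)"
        by (simp_all add: mult.commute flip: power_add power_mult)
      then have "3 * (fps_X ^ (3 * g) * Q') * (fps_X ^ g * v k) = fps_X ^ (4 * g) * (3 * Q' * v k)"
        "(fps_X ^ (2 * g) * P') * (fps_X ^ g * v k) ^ 2 = fps_X ^ (4 * g) * (P' * v k ^ 2)"
        by (simp_all only: power_mult_distrib mult_ac)
      then show ?thesis
        unfolding z_def ev[OF k] unfolding \<gamma>v[OF k] P'(1) Q'(1)
        by (simp only: distrib_left diff_diff_eq)
    qed
    have z_low: "fps_nth (z k) i = fps_nth R i" if "k \<in> {1..3}" "i < 4 * g" for k i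
      using that by (simp add: z fps_X_power_mult_nth)
    \<comment> \<open>P' vanishes at 0 and Q' is 1 there, so in degree 4 g only - 3 Q' v contributes
      besides R.\<close>
    have z_e: "fps_nth (z k) (4 * g) = fps_nth R (4 * g) + (- 3 * c k)" if "k \<in> {1..3}" for k
      using P'(2) Q'(2) by (simp add: z[OF that] fps_X_power_mult_nth c_def power2_eq_square numeral_fps_const)
    \<comment> \<open>This is M/3 > s in terms of t: the three roots of D differ only beyond the
      term - u^s.\<close>
    have Ns: "N * s < 4 * g"
    proof -
      have "3 * (N * s) < 4 * (N * m)"
        using mult_strict_left_mono[OF m(3) N] by (simp only: mult.left_commute[of N])
      then show ?thesis using g3 by linarith
    qed
    have R: "fps_nth R k = 0" if "k < N * s" for k
      using r(1) that N by (auto simp: R_def fps_nth_compose_X_power)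
    have R_s: "fps_nth R (N * s) = - 1"
      using r(2) N by (simp add: R_def fps_nth_compose_X_power)
    have D_eq: "ramify N (series D) = (\<Prod>j\<in>{1..3}. fps_X - fps_const (z j))"
      unfolding D z_def ..
    have "three_roots D N (4 * g) (2 * s + ?lam) z r (\<lambda>k. - 3 * c k)"
    proof
      show "3 * (4 * g) = N * (2 * s + ?lam)"
        using g3 m(1) by (metis mult.left_commute)
      show "conv1 (z k)" if "k \<in> {1..3}" for k
        unfolding z_def ramify_eq_compose_coeffs
        by (intro conv1_eval_y convergent2_compose_X_power N \<gamma> that) simp
      show "fps_nth (z k) 0 = 0" if "k \<in> {1..3}" for k
        using z_low[OF that, of 0] R[of 0] Ns N s by simp
    qed (use N s D_eq z_low z_e c_inj c_nz in \<open>auto simp: R_def inj_on_def\<close>)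
    moreover have "\<not> nondegenerate D"
      by (rule degenerate_cubic[OF N _ D_eq, where s = s]) (use s z_low Ns R R_s in auto)
    ultimately show thesis
      using that(2) pos by blast
  qed
qed

text \<open>The odd generator is the least odd element of the semigroup.\<close>

lemma semigroup_generator_unique:
  assumes S: "minimally_generated S [4, s]" "minimally_generated S [4, s']"
    and odd: "odd s" "odd s'"
  shows "s = s'"
proof -
  have span: "\<exists>a b. k = 4 * a + t * b" if "k \<in> additive_span {4, t}" for k t :: nat
    using that
  proof induction
    case zero
    show ?case by (intro exI[of _ 0]) simp
  next
    case (add a n)
    then obtain x y where xy: "n = 4 * x + t * y" by blast
    have "a = 4 \<or> a = t" using add by simp
    then show ?case
    proof
      assume "a = 4"
      then have "a + n = 4 * Suc x + t * y" using xy by simp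
      then show ?thesis by blast
    next
      assume "a = t"
      then have "a + n = 4 * x + t * Suc y" using xy by simp
      then show ?thesis by blast
    qed
  qed
  have le: "t \<le> k" if k: "k \<in> additive_span {4, t}" "odd k" for k t :: nat
  proof -
    obtain a b where ab: "k = 4 * a + t * b"
      using span[OF k(1)] by blast
    then have "b \<noteq> 0" using k(2) by (cases b) auto
    then show ?thesis using ab by (cases b) auto
  qed
  have eq: "additive_span {4, s} = additive_span {4, s'}"
    using S by (simp add: minimally_generated_def)
  have "k \<in> additive_span {4, k}" for k :: nat
    using additive_span_mult[of k "{4, k}" 1] by simp
  then show ?thesis
    using le[of s' s] le[of s s'] eq odd by (metis le_antisym)
qed

lemma gcd_3_eq_1_iff: "gcd 3 M = 1 \<longleftrightarrow> \<not> 3 dvd M" for M :: nat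
proof -
  have "prime (3 :: nat)" by simp
  then show ?thesis
    using coprime_iff_gcd_eq_1 prime_imp_coprime by (metis gcd_nat.absorb_iff1 numeral_eq_one_iff semiring_norm(86))
qed

text \<open>Dependence on the semigroup and \<lambda> alone is expressed by comparison with an
  arbitrary second branch g, which may lie in another family k and has its own discriminant curve
  E.\<close>

theorem proposition3p4:
  fixes f D :: cps2 and s1 i lam :: nat
  assumes "plane_branch f"
    and "minimally_generated (value_semigroup f) [4, s1]"
    and "i \<in> {1..4}" and "NF4 i s1 f"
    and "lam = zariski_invariant f"
    and "discriminant_curve f D"
  shows "\<not> nondegenerate D \<and>
    (\<forall>g E s k. plane_branch g \<and> minimally_generated (value_semigroup g) [4, s] \<and>
       k \<in> {1..4} \<and> NF4 k s g \<and> discriminant_curve g E \<and>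
       value_semigroup g = value_semigroup f \<and> zariski_invariant g = lam \<longrightarrow>
       same_topological_type D E) \<and>
    (lam = 0 \<longrightarrow>
       D = (Y_cps2 + X_cps2 ^ s1) ^ 3 \<and> smooth_branch (Y_cps2 + X_cps2 ^ s1)) \<and>
    (lam \<noteq> 0 \<longrightarrow>
       (\<exists>j. 2 \<le> j \<and> j \<le> s1 div 4 \<and> lam = 2 * s1 - 4 * j) \<and>
       (gcd 3 (2 * s1 + lam) = 1 \<longrightarrow>
          plane_branch D \<and> minimally_generated (value_semigroup D) [3, 2 * s1 + lam]) \<and>
       (gcd 3 (2 * s1 + lam) = 3 \<longrightarrow>
          (\<exists>B. D = (\<Prod>l\<in>{1..3::nat}. B l) \<and> (\<forall>l\<in>{1..3}. smooth_branch (B l)) \<and>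
            (\<forall>l\<in>{1..3}. \<forall>r\<in>{1..3}. l \<noteq> r \<longrightarrow>
               intersection_number (B l) (B r) = enat ((2 * s1 + lam) div 3)))))"
proof -
  let ?M = "2 * s1 + lam"
  have s1: "s1 > 4" "odd s1"
    using assms(4) by (auto simp: NF4_def)
  have smooth: "smooth_branch (Y_cps2 + X_cps2 ^ s1)"
    by (rule smooth_branch_graph(1)[of "- (fps_X ^ s1)"])
      (use s1 convergent2_uminus[OF conv1_fps_X_power[of s1]] in auto)
  \<comment> \<open>Excludes \<lambda> = 0 in the second alternative of
    \<open>NF4_discriminant\<close>, as 4 j \<le> t < 2 t.\<close>
  have pos_lam: "2 * t - 4 * j \<noteq> 0" if "j \<le> t div 4" "t > 4" for t j :: nat
    using that by linarith
  show ?thesis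
  proof (intro conjI allI impI)
    show "\<not> nondegenerate D"
      using NF4_discriminant[OF assms(4,6)] by metis
  next
    fix g E s k
    assume g: "plane_branch g \<and> minimally_generated (value_semigroup g) [4, s] \<and>
       k \<in> {1..4} \<and> NF4 k s g \<and> discriminant_curve g E \<and>
       value_semigroup g = value_semigroup f \<and> zariski_invariant g = lam"
    \<comment> \<open>Equal semigroups force equal s, hence the same M for both discriminant
      curves.\<close>
    have s: "s = s1"
      using semigroup_generator_unique[of "value_semigroup f" s s1] g assms(2) s1 by (auto simp: NF4_def)
    show "same_topological_type D E"
    proof (cases "lam = 0")
      case True
      have eq: "D = (Y_cps2 + X_cps2 ^ s1) ^ 3" "E = (Y_cps2 + X_cps2 ^ s1) ^ 3"
        using NF4_discriminant[OF assms(4,6)] NF4_discriminant[of k s1 g E] g s True assms(5) pos_lam s1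
        by metis+
      \<comment> \<open>Three copies of the same branch stand on both sides, so even the
        self-intersections agree by reflexivity.\<close>
      show ?thesis
        unfolding same_topological_type_def
        by (rule exI[of _ 3], rule exI[of _ "\<lambda>_. Y_cps2 + X_cps2 ^ s1"],
            rule exI[of _ "\<lambda>_. Y_cps2 + X_cps2 ^ s1"])
          (use eq smooth in \<open>auto simp: smooth_branch_def\<close>)
    next
      case False
      obtain N e z \<rho> c where D: "three_roots D N e ?M z \<rho> c"
        using NF4_discriminant[OF assms(4,6)] False assms(5) by metis
      obtain N' e' z' \<rho>' c' where E: "three_roots E N' e' ?M z' \<rho>' c'"
        using NF4_discriminant[of k s1 g E] g s False by metis
      show ?thesis
      proof (cases "3 dvd ?M")
        case True
        obtain B where B: "D = (\<Prod>l\<in>{1..3::nat}. B l)" "\<And>l. l \<in> {1..3} \<Longrightarrow> smooth_branch (B l)"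
            "\<And>l. l \<in> {1..3} \<Longrightarrow> value_semigroup (B l) = UNIV"
            "\<And>l r. l \<in> {1..3} \<Longrightarrow> r \<in> {1..3} \<Longrightarrow> l \<noteq> r \<Longrightarrow> intersection_number (B l) (B r) = enat (?M div 3)"
          using three_roots.split_case[OF D True] by metis
        obtain B' where B': "E = (\<Prod>l\<in>{1..3::nat}. B' l)" "\<And>l. l \<in> {1..3} \<Longrightarrow> smooth_branch (B' l)"
            "\<And>l. l \<in> {1..3} \<Longrightarrow> value_semigroup (B' l) = UNIV"
            "\<And>l r. l \<in> {1..3} \<Longrightarrow> r \<in> {1..3} \<Longrightarrow> l \<noteq> r \<Longrightarrow> intersection_number (B' l) (B' r) = enat (?M div 3)"
          using three_roots.split_case[OF E True] by metis
        \<comment> \<open>\<open>same_topological_type\<close> numbers the branches from 0, the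
          splitting numbers them from 1.\<close>
        have shift: "(\<Prod>l\<in>{1..3::nat}. F l) = (\<Prod>l<3. F (Suc l))" for F :: "nat \<Rightarrow> cps2"
          by (rule prod.reindex_bij_witness[of _ Suc "\<lambda>l. l - 1"]) auto
        show ?thesis
          unfolding same_topological_type_def
          by (rule exI[of _ 3], rule exI[of _ "\<lambda>l. B (Suc l)"], rule exI[of _ "\<lambda>l. B' (Suc l)"])
            (use B B' shift in \<open>auto simp: smooth_branch_def\<close>)
      next
        case False
        have "value_semigroup D = value_semigroup E" "plane_branch D" "plane_branch E"
          using three_roots.irreducible_case[OF D False] three_roots.irreducible_case[OF E False]
          by (auto simp: minimally_generated_def)
        then show ?thesis
          unfolding same_topological_type_def
          by (intro exI[of _ 1] exI[of _ "\<lambda>_. D"] exI[of _ "\<lambda>_. E"]) auto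
      qed
    qed
  next
    assume "lam = 0"
    then show "D = (Y_cps2 + X_cps2 ^ s1) ^ 3"
      using NF4_discriminant[OF assms(4,6)] assms(5) pos_lam s1 by metis
  next
    show "smooth_branch (Y_cps2 + X_cps2 ^ s1)" by (rule smooth)
  next
    assume "lam \<noteq> 0"
    then show "\<exists>j. 2 \<le> j \<and> j \<le> s1 div 4 \<and> lam = 2 * s1 - 4 * j"
      using NF4_discriminant[OF assms(4,6)] assms(5) by metis
  next
    assume lam: "lam \<noteq> 0"
    obtain N e z \<rho> c where D: "three_roots D N e ?M z \<rho> c"
      using NF4_discriminant[OF assms(4,6)] lam assms(5) by metis
    {
      assume "gcd 3 ?M = 1"
      then have "\<not> 3 dvd ?M"
        by (rule iffD1[OF gcd_3_eq_1_iff])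
      then show "plane_branch D" "minimally_generated (value_semigroup D) [3, ?M]"
        by (rule three_roots.irreducible_case[OF D])+
    }
    {
      assume "gcd 3 ?M = 3"
      then have "3 dvd ?M"
        by (metis gcd_dvd2)
      then show "\<exists>B. D = (\<Prod>l\<in>{1..3::nat}. B l) \<and> (\<forall>l\<in>{1..3}. smooth_branch (B l)) \<and>
            (\<forall>l\<in>{1..3}. \<forall>r\<in>{1..3}. l \<noteq> r \<longrightarrow> intersection_number (B l) (B r) = enat (?M div 3))"
        using three_roots.split_case[OF D] by metis
    }
  qed
qed

end
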